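(* Let $\mathcal C$ be a semisimple rigid balanced braided tensor category over $\mathbb C$ with simple unit and let $A$ be a $\mathcal C$-algebra. Define functors $F:\mathcal C\to\mathrm{Rep}\,A$ and $G:\mathrm{Rep}\,A\to\mathcal C$ by $F(V)=A\otimes V$, $\mu_{F(V)}=\mu\otimes\mathrm{id}_V$, and $G(V,\mu_V)=V$. Then: 1. Both $F$ and $G$ are exact and injective on morphisms. 2. $F$ and $G$ are adjoint: there are canonical functorial isomorphisms $\mathrm{Hom}_{A}(F(V),X)=\mathrm{Hom}_{\mathcal C}(V,G(X))$ for $V\in\mathcal C$, $X\in\mathrm{Rep}\,A$. 3. $F$ is a tensor functor: there are canonical isomorphisms $F(V\otimes W)=F(V)\otimes_AF(W)$ and $F(\mathbf 1)=A$. 4. There are canonical isomorphisms $G(F(V))=A\otimes V$ and, more generally, $G(F(V)\otimes_AX)=V\otimes G(X)$ for $V\in\mathcal C$, $X\in\mathrm{Rep}\,A$.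
   Context: $\mathcal C$ has finite-dimensional Hom spaces, unit $\mathbf 1$ and braiding $R_{V,W}:V\otimes W\to W\otimes V$; associativity constraints are suppressed. A $\mathcal C$-algebra is an object $A\in\mathcal C$ with morphisms $\mu:A\otimes A\to A$ and $\iota_A:\mathbf 1\hookrightarrow A$ such that $\mu(\mu\otimes \mathrm{id})=\mu(\mathrm{id}\otimes\mu)$, $\mu R_{A,A}=\mu$, $\mu(\iota_A\otimes\mathrm{id}_A)=\mathrm{id}_A$, and $\dim\mathrm{Hom}_{\mathcal C}(\mathbf 1,A)=1$. $\mathrm{Rep}\,A$ has objects $(V,\mu_V)$ with $V\in\mathcal C$ and $\mu_V:A\otimes V\to V$ satisfying $\mu_V(\mu\otimes\mathrm{id})=\mu_V(\mathrm{id}\otimes\mu_V)$ and $\mu_V(\iota_A\otimes\mathrm{id})=\mathrm{id}$; morphisms (denoted $\mathrm{Hom}_A$) are $\mathcal C$-morphisms commuting with the action. It is an abelian monoidal category with unit $A$ and $V\otimes_AW=(V\otimes W)/\mathrm{Im}(\mu_1-\mu_2)$, where $\mu_1=\mu_V\otimes\mathrm{id}_W$ and $\mu_2=(\mathrm{id}_V\otimes\mu_W)(R_{A,V}\otimes\mathrm{id}_W)$ are morphisms $A\otimes V\otimes W\to V\otimes W$, and $A$ acts on $V\otimes_AW$ via $\mu_1$ (equivalently $\mu_2$). *)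

theory Defs
  imports Complex_Main
begin

section \<open>Linear categories\<close>

text \<open>
  All Hom spaces are subspaces of one ambient complex vector space (the type of morphisms
  with the scalar multiplication \<open>Scl\<close>); every small linear category has this form, the
  ambient space being, for instance, the direct sum of all its Hom spaces.  The Hom spaces
  are not required to be independent, so a morphism need not determine its source and
  target.  This is what allows the modules over an algebra to form a category of the same
  kind, a module morphism being literally a morphism of the underlying objects.
\<close>

record ('o, 'm) lin_cat =
  Ob :: "'o set"
  Hom :: "'o \<Rightarrow> 'o \<Rightarrow> 'm set"
  Cmp :: "'m \<Rightarrow> 'm \<Rightarrow> 'm"  (infixr "\<cdot>\<index>" 68)
  Id :: "'o \<Rightarrow> 'm"
  Scl :: "complex \<Rightarrow> 'm \<Rightarrow> 'm"

locale linear_category =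
  fixes C :: "('o, 'm::ab_group_add, 'z) lin_cat_scheme" (structure)
  assumes Id_in_Hom: "a \<in> Ob C \<Longrightarrow> Id C a \<in> Hom C a a"
    and Cmp_in_Hom: "\<lbrakk>a \<in> Ob C; b \<in> Ob C; c \<in> Ob C; f \<in> Hom C a b; g \<in> Hom C b c\<rbrakk>
      \<Longrightarrow> g \<cdot> f \<in> Hom C a c"
    and Cmp_assoc: "\<lbrakk>a \<in> Ob C; b \<in> Ob C; c \<in> Ob C; d \<in> Ob C;
        f \<in> Hom C a b; g \<in> Hom C b c; h \<in> Hom C c d\<rbrakk> \<Longrightarrow> (h \<cdot> g) \<cdot> f = h \<cdot> (g \<cdot> f)"
    and Cmp_Id_left: "\<lbrakk>a \<in> Ob C; b \<in> Ob C; f \<in> Hom C a b\<rbrakk> \<Longrightarrow> Id C b \<cdot> f = f"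
    and Cmp_Id_right: "\<lbrakk>a \<in> Ob C; b \<in> Ob C; f \<in> Hom C a b\<rbrakk> \<Longrightarrow> f \<cdot> Id C a = f"
    and vector_space_Scl: "vector_space (Scl C)"
    and subspace_Hom: "\<lbrakk>a \<in> Ob C; b \<in> Ob C\<rbrakk> \<Longrightarrow> module.subspace (Scl C) (Hom C a b)"
    and Cmp_add_left: "\<lbrakk>a \<in> Ob C; b \<in> Ob C; c \<in> Ob C;
        f \<in> Hom C a b; g \<in> Hom C b c; g' \<in> Hom C b c\<rbrakk> \<Longrightarrow> (g + g') \<cdot> f = (g \<cdot> f) + (g' \<cdot> f)"
    and Cmp_add_right: "\<lbrakk>a \<in> Ob C; b \<in> Ob C; c \<in> Ob C;
        f \<in> Hom C a b; f' \<in> Hom C a b; g \<in> Hom C b c\<rbrakk> \<Longrightarrow> g \<cdot> (f + f') = (g \<cdot> f) + (g \<cdot> f')"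
    and Cmp_Scl_left: "\<lbrakk>a \<in> Ob C; b \<in> Ob C; c \<in> Ob C; f \<in> Hom C a b; g \<in> Hom C b c\<rbrakk>
      \<Longrightarrow> Scl C z g \<cdot> f = Scl C z (g \<cdot> f)"
    and Cmp_Scl_right: "\<lbrakk>a \<in> Ob C; b \<in> Ob C; c \<in> Ob C; f \<in> Hom C a b; g \<in> Hom C b c\<rbrakk>
      \<Longrightarrow> g \<cdot> Scl C z f = Scl C z (g \<cdot> f)"

context
  fixes C :: "('o, 'm::ab_group_add, 'z) lin_cat_scheme" (structure)
begin

definition hom_finite :: bool where
  "hom_finite \<longleftrightarrow>
    (\<forall>a\<in>Ob C. \<forall>b\<in>Ob C. \<exists>B. finite B \<and> Hom C a b = module.span (Scl C) B)"

definition is_iso :: "'o \<Rightarrow> 'o \<Rightarrow> 'm \<Rightarrow> bool" where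
  "is_iso a b f \<longleftrightarrow> a \<in> Ob C \<and> b \<in> Ob C \<and> f \<in> Hom C a b \<and>
    (\<exists>g\<in>Hom C b a. g \<cdot> f = Id C a \<and> f \<cdot> g = Id C b)"

definition inv_mor :: "'o \<Rightarrow> 'o \<Rightarrow> 'm \<Rightarrow> 'm" where
  "inv_mor a b f = (THE g. g \<in> Hom C b a \<and> g \<cdot> f = Id C a \<and> f \<cdot> g = Id C b)"

definition is_mono :: "'o \<Rightarrow> 'o \<Rightarrow> 'm \<Rightarrow> bool" where
  "is_mono a b f \<longleftrightarrow> a \<in> Ob C \<and> b \<in> Ob C \<and> f \<in> Hom C a b \<and>
    (\<forall>c\<in>Ob C. \<forall>g\<in>Hom C c a. \<forall>h\<in>Hom C c a. f \<cdot> g = f \<cdot> h \<longrightarrow> g = h)"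

definition is_epi :: "'o \<Rightarrow> 'o \<Rightarrow> 'm \<Rightarrow> bool" where
  "is_epi a b f \<longleftrightarrow> a \<in> Ob C \<and> b \<in> Ob C \<and> f \<in> Hom C a b \<and>
    (\<forall>c\<in>Ob C. \<forall>g\<in>Hom C b c. \<forall>h\<in>Hom C b c. g \<cdot> f = h \<cdot> f \<longrightarrow> g = h)"

text \<open>\<open>is_kernel a b f k i\<close>: the morphism \<open>i: k \<rightarrow> a\<close> is a kernel of \<open>f: a \<rightarrow> b\<close>.\<close>

definition is_kernel :: "'o \<Rightarrow> 'o \<Rightarrow> 'm \<Rightarrow> 'o \<Rightarrow> 'm \<Rightarrow> bool" where
  "is_kernel a b f k i \<longleftrightarrow> a \<in> Ob C \<and> b \<in> Ob C \<and> k \<in> Ob C \<and>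
    f \<in> Hom C a b \<and> i \<in> Hom C k a \<and> f \<cdot> i = 0 \<and>
    (\<forall>c\<in>Ob C. \<forall>g\<in>Hom C c a. f \<cdot> g = 0 \<longrightarrow> (\<exists>!h. h \<in> Hom C c k \<and> i \<cdot> h = g))"

text \<open>\<open>is_cokernel a b f k p\<close>: the morphism \<open>p: b \<rightarrow> k\<close> is a cokernel of \<open>f: a \<rightarrow> b\<close>,
  i.e. it is the quotient of \<open>b\<close> by the image of \<open>f\<close>.\<close>

definition is_cokernel :: "'o \<Rightarrow> 'o \<Rightarrow> 'm \<Rightarrow> 'o \<Rightarrow> 'm \<Rightarrow> bool" where
  "is_cokernel a b f k p \<longleftrightarrow> a \<in> Ob C \<and> b \<in> Ob C \<and> k \<in> Ob C \<and>
    f \<in> Hom C a b \<and> p \<in> Hom C b k \<and> p \<cdot> f = 0 \<and>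
    (\<forall>c\<in>Ob C. \<forall>g\<in>Hom C b c. g \<cdot> f = 0 \<longrightarrow> (\<exists>!h. h \<in> Hom C k c \<and> h \<cdot> p = g))"

definition short_exact :: "'o \<Rightarrow> 'o \<Rightarrow> 'o \<Rightarrow> 'm \<Rightarrow> 'm \<Rightarrow> bool" where
  "short_exact a b c f g \<longleftrightarrow> is_kernel b c g a f \<and> is_cokernel a b f c g"

definition is_zero :: "'o \<Rightarrow> bool" where
  "is_zero a \<longleftrightarrow> a \<in> Ob C \<and> (\<forall>b\<in>Ob C. Hom C a b = {0} \<and> Hom C b a = {0})"

text \<open>The object \<open>s\<close> is the direct sum of the objects \<open>x 0, \<dots>, x (n - 1)\<close>, with inclusions
  \<open>i k\<close> and projections \<open>p k\<close>; the empty direct sum is a zero object.\<close>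

definition is_direct_sum ::
  "nat \<Rightarrow> (nat \<Rightarrow> 'o) \<Rightarrow> 'o \<Rightarrow> (nat \<Rightarrow> 'm) \<Rightarrow> (nat \<Rightarrow> 'm) \<Rightarrow> bool" where
  "is_direct_sum n x s i p \<longleftrightarrow> s \<in> Ob C \<and>
    (\<forall>k<n. x k \<in> Ob C \<and> i k \<in> Hom C (x k) s \<and> p k \<in> Hom C s (x k)) \<and>
    (\<forall>j<n. \<forall>k<n. p j \<cdot> i k = (if j = k then Id C (x k) else 0)) \<and>
    (\<Sum>k<n. i k \<cdot> p k) = Id C s"

definition is_simple :: "'o \<Rightarrow> bool" where
  "is_simple s \<longleftrightarrow> s \<in> Ob C \<and> \<not> is_zero s \<and>
    (\<forall>a\<in>Ob C. \<forall>i. is_mono a s i \<longrightarrow> is_zero a \<or> is_iso a s i)"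

definition semisimple :: bool where
  "semisimple \<longleftrightarrow> (\<forall>s\<in>Ob C. \<exists>n x i p. (\<forall>k<n. is_simple (x k)) \<and> is_direct_sum n x s i p)"

end

locale abelian_category = linear_category C
  for C :: "('o, 'm::ab_group_add, 'z) lin_cat_scheme" (structure) +
  assumes ex_zero: "\<exists>z. is_zero C z"
    and ex_biproduct: "\<lbrakk>a \<in> Ob C; b \<in> Ob C\<rbrakk>
      \<Longrightarrow> \<exists>s i p. is_direct_sum C 2 (\<lambda>k. if k = 0 then a else b) s i p"
    and ex_kernel: "\<lbrakk>a \<in> Ob C; b \<in> Ob C; f \<in> Hom C a b\<rbrakk> \<Longrightarrow> \<exists>k i. is_kernel C a b f k i"
    and ex_cokernel: "\<lbrakk>a \<in> Ob C; b \<in> Ob C; f \<in> Hom C a b\<rbrakk> \<Longrightarrow> \<exists>k p. is_cokernel C a b f k p"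
    and mono_normal: "is_mono C a b f \<Longrightarrow> \<exists>c g. is_kernel C b c g a f"
    and epi_normal: "is_epi C a b f \<Longrightarrow> \<exists>c g. is_cokernel C c a g b f"

text \<open>A functor is given by its action \<open>Fo\<close> on objects and its action \<open>Fm\<close> on morphisms.\<close>

locale linear_functor =
  fixes C :: "('o, 'm::ab_group_add, 'y) lin_cat_scheme"
    and D :: "('p, 'n::ab_group_add, 'z) lin_cat_scheme"
    and Fo :: "'o \<Rightarrow> 'p" and Fm :: "'m \<Rightarrow> 'n"
  assumes Fo_in_Ob: "a \<in> Ob C \<Longrightarrow> Fo a \<in> Ob D"
    and Fm_in_Hom: "\<lbrakk>a \<in> Ob C; b \<in> Ob C; f \<in> Hom C a b\<rbrakk> \<Longrightarrow> Fm f \<in> Hom D (Fo a) (Fo b)"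
    and Fm_Id: "a \<in> Ob C \<Longrightarrow> Fm (Id C a) = Id D (Fo a)"
    and Fm_Cmp: "\<lbrakk>a \<in> Ob C; b \<in> Ob C; c \<in> Ob C; f \<in> Hom C a b; g \<in> Hom C b c\<rbrakk>
      \<Longrightarrow> Fm (g \<cdot>\<^bsub>C\<^esub> f) = Fm g \<cdot>\<^bsub>D\<^esub> Fm f"
    and Fm_add: "\<lbrakk>a \<in> Ob C; b \<in> Ob C; f \<in> Hom C a b; g \<in> Hom C a b\<rbrakk>
      \<Longrightarrow> Fm (f + g) = Fm f + Fm g"
    and Fm_Scl: "\<lbrakk>a \<in> Ob C; b \<in> Ob C; f \<in> Hom C a b\<rbrakk> \<Longrightarrow> Fm (Scl C z f) = Scl D z (Fm f)"

locale exact_functor = linear_functor C D Fo Fm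
  for C :: "('o, 'm::ab_group_add, 'y) lin_cat_scheme"
    and D :: "('p, 'n::ab_group_add, 'z) lin_cat_scheme" and Fo Fm +
  assumes preserves_exact: "short_exact C a b c f g
      \<Longrightarrow> short_exact D (Fo a) (Fo b) (Fo c) (Fm f) (Fm g)"

definition injective_on_morphisms ::
  "('o, 'm, 'y) lin_cat_scheme \<Rightarrow> ('m \<Rightarrow> 'n) \<Rightarrow> bool" where
  "injective_on_morphisms C Fm \<longleftrightarrow> (\<forall>a\<in>Ob C. \<forall>b\<in>Ob C. inj_on Fm (Hom C a b))"


section \<open>Balanced rigid braided tensor categories\<close>

text \<open>
  \<open>\<otimes>\<close> is the tensor product of objects and \<open>\<boxtimes>\<close> that of morphisms.  Categories are not
  assumed strict:
  \<open>Assoc a b c: (a \<otimes> b) \<otimes> c \<rightarrow> a \<otimes> (b \<otimes> c)\<close>, \<open>Lun a: \<one> \<otimes> a \<rightarrow> a\<close>, \<open>Run a: a \<otimes> \<one> \<rightarrow> a\<close>.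
\<close>

record ('o, 'm) mon_cat = "('o, 'm) lin_cat" +
  Tens :: "'o \<Rightarrow> 'o \<Rightarrow> 'o"  (infixr "\<otimes>\<index>" 75)
  TensM :: "'m \<Rightarrow> 'm \<Rightarrow> 'm"  (infixr "\<boxtimes>\<index>" 75)
  Unit :: 'o  ("\<one>\<index>")
  Assoc :: "'o \<Rightarrow> 'o \<Rightarrow> 'o \<Rightarrow> 'm"
  Lun :: "'o \<Rightarrow> 'm"
  Run :: "'o \<Rightarrow> 'm"

record ('o, 'm) bal_cat = "('o, 'm) mon_cat" +
  Braid :: "'o \<Rightarrow> 'o \<Rightarrow> 'm"
  Twist :: "'o \<Rightarrow> 'm"

abbreviation inv_Assoc ::
  "('o, 'm::ab_group_add, 'z) mon_cat_scheme \<Rightarrow> 'o \<Rightarrow> 'o \<Rightarrow> 'o \<Rightarrow> 'm" where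
  "inv_Assoc C a b c \<equiv>
    inv_mor C ((a \<otimes>\<^bsub>C\<^esub> b) \<otimes>\<^bsub>C\<^esub> c) (a \<otimes>\<^bsub>C\<^esub> (b \<otimes>\<^bsub>C\<^esub> c)) (Assoc C a b c)"

locale monoidal_category = linear_category C
  for C :: "('o, 'm::ab_group_add, 'z) mon_cat_scheme" (structure) +
  assumes Unit_in_Ob: "\<one> \<in> Ob C"
    and Tens_in_Ob: "\<lbrakk>a \<in> Ob C; b \<in> Ob C\<rbrakk> \<Longrightarrow> a \<otimes> b \<in> Ob C"
    and TensM_in_Hom: "\<lbrakk>a \<in> Ob C; a' \<in> Ob C; b \<in> Ob C; b' \<in> Ob C;
        f \<in> Hom C a a'; g \<in> Hom C b b'\<rbrakk> \<Longrightarrow> f \<boxtimes> g \<in> Hom C (a \<otimes> b) (a' \<otimes> b')"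
    and TensM_Id: "\<lbrakk>a \<in> Ob C; b \<in> Ob C\<rbrakk> \<Longrightarrow> Id C a \<boxtimes> Id C b = Id C (a \<otimes> b)"
    and TensM_Cmp: "\<lbrakk>a \<in> Ob C; a' \<in> Ob C; a'' \<in> Ob C; b \<in> Ob C; b' \<in> Ob C; b'' \<in> Ob C;
        f \<in> Hom C a a'; f' \<in> Hom C a' a''; g \<in> Hom C b b'; g' \<in> Hom C b' b''\<rbrakk>
      \<Longrightarrow> (f' \<cdot> f) \<boxtimes> (g' \<cdot> g) = (f' \<boxtimes> g') \<cdot> (f \<boxtimes> g)"
    and TensM_add_left: "\<lbrakk>a \<in> Ob C; a' \<in> Ob C; b \<in> Ob C; b' \<in> Ob C;
        f \<in> Hom C a a'; f' \<in> Hom C a a'; g \<in> Hom C b b'\<rbrakk>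
      \<Longrightarrow> (f + f') \<boxtimes> g = (f \<boxtimes> g) + (f' \<boxtimes> g)"
    and TensM_add_right: "\<lbrakk>a \<in> Ob C; a' \<in> Ob C; b \<in> Ob C; b' \<in> Ob C;
        f \<in> Hom C a a'; g \<in> Hom C b b'; g' \<in> Hom C b b'\<rbrakk>
      \<Longrightarrow> f \<boxtimes> (g + g') = (f \<boxtimes> g) + (f \<boxtimes> g')"
    and TensM_Scl_left: "\<lbrakk>a \<in> Ob C; a' \<in> Ob C; b \<in> Ob C; b' \<in> Ob C;
        f \<in> Hom C a a'; g \<in> Hom C b b'\<rbrakk> \<Longrightarrow> Scl C z f \<boxtimes> g = Scl C z (f \<boxtimes> g)"
    and TensM_Scl_right: "\<lbrakk>a \<in> Ob C; a' \<in> Ob C; b \<in> Ob C; b' \<in> Ob C;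
        f \<in> Hom C a a'; g \<in> Hom C b b'\<rbrakk> \<Longrightarrow> f \<boxtimes> Scl C z g = Scl C z (f \<boxtimes> g)"
    and Assoc_iso: "\<lbrakk>a \<in> Ob C; b \<in> Ob C; c \<in> Ob C\<rbrakk>
      \<Longrightarrow> is_iso C ((a \<otimes> b) \<otimes> c) (a \<otimes> (b \<otimes> c)) (Assoc C a b c)"
    and Assoc_natural: "\<lbrakk>a \<in> Ob C; a' \<in> Ob C; b \<in> Ob C; b' \<in> Ob C; c \<in> Ob C; c' \<in> Ob C;
        f \<in> Hom C a a'; g \<in> Hom C b b'; h \<in> Hom C c c'\<rbrakk>
      \<Longrightarrow> Assoc C a' b' c' \<cdot> ((f \<boxtimes> g) \<boxtimes> h) = (f \<boxtimes> (g \<boxtimes> h)) \<cdot> Assoc C a b c"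
    and Lun_iso: "a \<in> Ob C \<Longrightarrow> is_iso C (\<one> \<otimes> a) a (Lun C a)"
    and Lun_natural: "\<lbrakk>a \<in> Ob C; b \<in> Ob C; f \<in> Hom C a b\<rbrakk>
      \<Longrightarrow> Lun C b \<cdot> (Id C \<one> \<boxtimes> f) = f \<cdot> Lun C a"
    and Run_iso: "a \<in> Ob C \<Longrightarrow> is_iso C (a \<otimes> \<one>) a (Run C a)"
    and Run_natural: "\<lbrakk>a \<in> Ob C; b \<in> Ob C; f \<in> Hom C a b\<rbrakk>
      \<Longrightarrow> Run C b \<cdot> (f \<boxtimes> Id C \<one>) = f \<cdot> Run C a"
    and pentagon: "\<lbrakk>a \<in> Ob C; b \<in> Ob C; c \<in> Ob C; d \<in> Ob C\<rbrakk>
      \<Longrightarrow> Assoc C a b (c \<otimes> d) \<cdot> Assoc C (a \<otimes> b) c d =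
          (Id C a \<boxtimes> Assoc C b c d) \<cdot> Assoc C a (b \<otimes> c) d \<cdot> (Assoc C a b c \<boxtimes> Id C d)"
    and triangle: "\<lbrakk>a \<in> Ob C; b \<in> Ob C\<rbrakk>
      \<Longrightarrow> (Id C a \<boxtimes> Lun C b) \<cdot> Assoc C a \<one> b = Run C a \<boxtimes> Id C b"

text \<open>\<open>Braid a b: a \<otimes> b \<rightarrow> b \<otimes> a\<close>.\<close>

locale braided_category = monoidal_category C
  for C :: "('o, 'm::ab_group_add, 'z) bal_cat_scheme" (structure) +
  assumes Braid_iso: "\<lbrakk>a \<in> Ob C; b \<in> Ob C\<rbrakk> \<Longrightarrow> is_iso C (a \<otimes> b) (b \<otimes> a) (Braid C a b)"
    and Braid_natural: "\<lbrakk>a \<in> Ob C; a' \<in> Ob C; b \<in> Ob C; b' \<in> Ob C;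
        f \<in> Hom C a a'; g \<in> Hom C b b'\<rbrakk>
      \<Longrightarrow> Braid C a' b' \<cdot> (f \<boxtimes> g) = (g \<boxtimes> f) \<cdot> Braid C a b"
    and hexagon1: "\<lbrakk>a \<in> Ob C; b \<in> Ob C; c \<in> Ob C\<rbrakk>
      \<Longrightarrow> Assoc C b c a \<cdot> Braid C a (b \<otimes> c) \<cdot> Assoc C a b c =
          (Id C b \<boxtimes> Braid C a c) \<cdot> Assoc C b a c \<cdot> (Braid C a b \<boxtimes> Id C c)"
    and hexagon2: "\<lbrakk>a \<in> Ob C; b \<in> Ob C; c \<in> Ob C\<rbrakk>
      \<Longrightarrow> inv_Assoc C c a b \<cdot> Braid C (a \<otimes> b) c \<cdot> inv_Assoc C a b c =
          (Braid C a c \<boxtimes> Id C b) \<cdot> inv_Assoc C a c b \<cdot> (Id C a \<boxtimes> Braid C b c)"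

text \<open>A balancing (twist) in the sense of Joyal and Street.\<close>

locale balanced_category = braided_category C
  for C :: "('o, 'm::ab_group_add, 'z) bal_cat_scheme" (structure) +
  assumes Twist_iso: "a \<in> Ob C \<Longrightarrow> is_iso C a a (Twist C a)"
    and Twist_natural: "\<lbrakk>a \<in> Ob C; b \<in> Ob C; f \<in> Hom C a b\<rbrakk>
      \<Longrightarrow> Twist C b \<cdot> f = f \<cdot> Twist C a"
    and Twist_Tens: "\<lbrakk>a \<in> Ob C; b \<in> Ob C\<rbrakk>
      \<Longrightarrow> Twist C (a \<otimes> b) = Braid C b a \<cdot> Braid C a b \<cdot> (Twist C a \<boxtimes> Twist C b)"
    and Twist_Unit: "Twist C \<one> = Id C \<one>"

context
  fixes C :: "('o, 'm::ab_group_add, 'z) mon_cat_scheme" (structure)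
begin

text \<open>\<open>dual_pair v w e c\<close>: the object \<open>w\<close> is a left dual of \<open>v\<close> (and \<open>v\<close> a right dual of \<open>w\<close>),
  with evaluation \<open>e: w \<otimes> v \<rightarrow> \<one>\<close> and coevaluation \<open>c: \<one> \<rightarrow> v \<otimes> w\<close>.\<close>

definition dual_pair :: "'o \<Rightarrow> 'o \<Rightarrow> 'm \<Rightarrow> 'm \<Rightarrow> bool" where
  "dual_pair v w e c \<longleftrightarrow> v \<in> Ob C \<and> w \<in> Ob C \<and>
    e \<in> Hom C (w \<otimes> v) \<one> \<and> c \<in> Hom C \<one> (v \<otimes> w) \<and>
    Run C v \<cdot> (Id C v \<boxtimes> e) \<cdot> Assoc C v w v \<cdot> (c \<boxtimes> Id C v) = Lun C v \<and>
    Lun C w \<cdot> (e \<boxtimes> Id C w) \<cdot> inv_Assoc C w v w \<cdot> (Id C w \<boxtimes> c) = Run C w"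

definition rigid :: bool where
  "rigid \<longleftrightarrow>
    (\<forall>v\<in>Ob C. (\<exists>w e c. dual_pair v w e c) \<and> (\<exists>w e c. dual_pair w v e c))"

end


section \<open>Algebras and their modules\<close>

record ('o, 'm) alg =
  Car :: 'o
  Mul :: 'm
  Iota :: 'm

context
  fixes C :: "('o, 'm::ab_group_add, 'z) bal_cat_scheme" (structure)
begin

definition C_algebra :: "('o, 'm, 'w) alg_scheme \<Rightarrow> bool" where
  "C_algebra A \<longleftrightarrow> Car A \<in> Ob C \<and>
    Mul A \<in> Hom C (Car A \<otimes> Car A) (Car A) \<and>
    is_mono C \<one> (Car A) (Iota A) \<and>
    Mul A \<cdot> (Mul A \<boxtimes> Id C (Car A)) =
      Mul A \<cdot> (Id C (Car A) \<boxtimes> Mul A) \<cdot> Assoc C (Car A) (Car A) (Car A) \<and>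
    Mul A \<cdot> Braid C (Car A) (Car A) = Mul A \<and>
    Mul A \<cdot> (Iota A \<boxtimes> Id C (Car A)) = Lun C (Car A) \<and>
    vector_space.dim (Scl C) (Hom C \<one> (Car A)) = 1"

definition Rep :: "('o, 'm, 'w) alg_scheme \<Rightarrow> ('o \<times> 'm, 'm) lin_cat" where
  "Rep A = \<lparr>
    Ob = {(V, m). V \<in> Ob C \<and> m \<in> Hom C (Car A \<otimes> V) V \<and>
      m \<cdot> (Mul A \<boxtimes> Id C V) = m \<cdot> (Id C (Car A) \<boxtimes> m) \<cdot> Assoc C (Car A) (Car A) V \<and>
      m \<cdot> (Iota A \<boxtimes> Id C V) = Lun C V},
    Hom = (\<lambda>X Y. {f \<in> Hom C (fst X) (fst Y). f \<cdot> snd X = snd Y \<cdot> (Id C (Car A) \<boxtimes> f)}),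
    Cmp = Cmp C,
    Id = (\<lambda>X. Id C (fst X)),
    Scl = Scl C\<rparr>"

definition Rep_unit :: "('o, 'm, 'w) alg_scheme \<Rightarrow> 'o \<times> 'm" where
  "Rep_unit A = (Car A, Mul A)"

text \<open>The two actions \<open>A \<otimes> (V \<otimes> W) \<rightarrow> V \<otimes> W\<close>.\<close>

definition act1 :: "('o, 'm, 'w) alg_scheme \<Rightarrow> 'o \<times> 'm \<Rightarrow> 'o \<times> 'm \<Rightarrow> 'm" where
  "act1 A X Y = (snd X \<boxtimes> Id C (fst Y)) \<cdot> inv_Assoc C (Car A) (fst X) (fst Y)"

definition act2 :: "('o, 'm, 'w) alg_scheme \<Rightarrow> 'o \<times> 'm \<Rightarrow> 'o \<times> 'm \<Rightarrow> 'm" where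
  "act2 A X Y = (Id C (fst X) \<boxtimes> snd Y) \<cdot> Assoc C (fst X) (Car A) (fst Y) \<cdot>
    (Braid C (Car A) (fst X) \<boxtimes> Id C (fst Y)) \<cdot> inv_Assoc C (Car A) (fst X) (fst Y)"

text \<open>The quotient \<open>V \<otimes> W \<rightarrow> (V \<otimes> W) / Im (act1 - act2)\<close>, unique up to a unique isomorphism;
  one such quotient is chosen.\<close>

definition quot :: "('o, 'm, 'w) alg_scheme \<Rightarrow> 'o \<times> 'm \<Rightarrow> 'o \<times> 'm \<Rightarrow> 'o \<times> 'm" where
  "quot A X Y = (SOME (T, q). is_cokernel C (Car A \<otimes> (fst X \<otimes> fst Y)) (fst X \<otimes> fst Y)
    (act1 A X Y - act2 A X Y) T q)"

definition quot_ob :: "('o, 'm, 'w) alg_scheme \<Rightarrow> 'o \<times> 'm \<Rightarrow> 'o \<times> 'm \<Rightarrow> 'o" where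
  "quot_ob A X Y = fst (quot A X Y)"

definition quot_map :: "('o, 'm, 'w) alg_scheme \<Rightarrow> 'o \<times> 'm \<Rightarrow> 'o \<times> 'm \<Rightarrow> 'm" where
  "quot_map A X Y = snd (quot A X Y)"

text \<open>The object \<open>X \<otimes>\<^sub>A Y\<close> of \<open>Rep A\<close>, with the action induced by \<open>act1\<close>.\<close>

definition tensA :: "('o, 'm, 'w) alg_scheme \<Rightarrow> 'o \<times> 'm \<Rightarrow> 'o \<times> 'm \<Rightarrow> 'o \<times> 'm" where
  "tensA A X Y = (quot_ob A X Y,
    THE m. m \<in> Hom C (Car A \<otimes> quot_ob A X Y) (quot_ob A X Y) \<and>
      m \<cdot> (Id C (Car A) \<boxtimes> quot_map A X Y) = quot_map A X Y \<cdot> act1 A X Y)"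

text \<open>The morphism \<open>f \<otimes>\<^sub>A g: X \<otimes>\<^sub>A Y \<rightarrow> X' \<otimes>\<^sub>A Y'\<close> induced by \<open>f \<boxtimes> g\<close>.\<close>

definition tensA_mor :: "('o, 'm, 'w) alg_scheme \<Rightarrow>
    'o \<times> 'm \<Rightarrow> 'o \<times> 'm \<Rightarrow> 'o \<times> 'm \<Rightarrow> 'o \<times> 'm \<Rightarrow> 'm \<Rightarrow> 'm \<Rightarrow> 'm" where
  "tensA_mor A X X' Y Y' f g =
    (THE h. h \<in> Hom C (quot_ob A X Y) (quot_ob A X' Y') \<and>
      h \<cdot> quot_map A X Y = quot_map A X' Y' \<cdot> (f \<boxtimes> g))"

text \<open>The associativity and unit constraints of \<open>Rep A\<close>.  In the right unit constraint \<open>A\<close> is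
  moved past \<open>X\<close> by the inverse of the braiding \<open>R\<^bsub>A,X\<^esub>\<close>, as in the definition of \<open>act2\<close>; the map
  obtained from \<open>R\<^bsub>X,A\<^esub>\<close> does not factor through \<open>X \<otimes>\<^sub>A A\<close> in general.\<close>

definition assocA :: "('o, 'm, 'w) alg_scheme \<Rightarrow> 'o \<times> 'm \<Rightarrow> 'o \<times> 'm \<Rightarrow> 'o \<times> 'm \<Rightarrow> 'm" where
  "assocA A X Y Z =
    (THE h. h \<in> Hom C (quot_ob A (tensA A X Y) Z) (quot_ob A X (tensA A Y Z)) \<and>
      h \<cdot> quot_map A (tensA A X Y) Z \<cdot> (quot_map A X Y \<boxtimes> Id C (fst Z)) =
        quot_map A X (tensA A Y Z) \<cdot> (Id C (fst X) \<boxtimes> quot_map A Y Z) \<cdot>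
          Assoc C (fst X) (fst Y) (fst Z))"

definition lunA :: "('o, 'm, 'w) alg_scheme \<Rightarrow> 'o \<times> 'm \<Rightarrow> 'm" where
  "lunA A X = (THE h. h \<in> Hom C (quot_ob A (Rep_unit A) X) (fst X) \<and>
    h \<cdot> quot_map A (Rep_unit A) X = snd X)"

definition runA :: "('o, 'm, 'w) alg_scheme \<Rightarrow> 'o \<times> 'm \<Rightarrow> 'm" where
  "runA A X = (THE h. h \<in> Hom C (quot_ob A X (Rep_unit A)) (fst X) \<and>
    h \<cdot> quot_map A X (Rep_unit A) =
      snd X \<cdot> inv_mor C (Car A \<otimes> fst X) (fst X \<otimes> Car A) (Braid C (Car A) (fst X)))"


section \<open>The functors between \<open>C\<close> and \<open>Rep A\<close>, and the canonical maps\<close>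

definition F_ob :: "('o, 'm, 'w) alg_scheme \<Rightarrow> 'o \<Rightarrow> 'o \<times> 'm" where
  "F_ob A V = (Car A \<otimes> V, (Mul A \<boxtimes> Id C V) \<cdot> inv_Assoc C (Car A) (Car A) V)"

definition F_mor :: "('o, 'm, 'w) alg_scheme \<Rightarrow> 'm \<Rightarrow> 'm" where
  "F_mor A f = Id C (Car A) \<boxtimes> f"

text \<open>The morphism \<open>V \<rightarrow> \<one> \<otimes> V \<rightarrow> A \<otimes> V\<close> given by the unit of \<open>A\<close>.\<close>

definition unit_ins :: "('o, 'm, 'w) alg_scheme \<Rightarrow> 'o \<Rightarrow> 'm" where
  "unit_ins A V = (Iota A \<boxtimes> Id C V) \<cdot> inv_mor C (\<one> \<otimes> V) V (Lun C V)"

definition adj_map :: "('o, 'm, 'w) alg_scheme \<Rightarrow> 'o \<Rightarrow> 'm \<Rightarrow> 'm" where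
  "adj_map A V \<phi> = \<phi> \<cdot> unit_ins A V"

text \<open>The composite
  \<open>F(V \<otimes> W) = A \<otimes> (V \<otimes> W) \<rightarrow> (A \<otimes> V) \<otimes> W \<rightarrow> (A \<otimes> V) \<otimes> (A \<otimes> W) \<rightarrow> F(V) \<otimes>\<^sub>A F(W)\<close>.\<close>

definition F_tens :: "('o, 'm, 'w) alg_scheme \<Rightarrow> 'o \<Rightarrow> 'o \<Rightarrow> 'm" where
  "F_tens A V W = quot_map A (F_ob A V) (F_ob A W) \<cdot>
    (Id C (Car A \<otimes> V) \<boxtimes> unit_ins A W) \<cdot> inv_Assoc C (Car A) V W"

text \<open>\<open>F(\<one>) = A \<otimes> \<one> \<rightarrow> A\<close>.\<close>

definition F_unit :: "('o, 'm, 'w) alg_scheme \<Rightarrow> 'm" where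
  "F_unit A = Run C (Car A)"

text \<open>The composite \<open>V \<otimes> X \<rightarrow> (A \<otimes> V) \<otimes> X \<rightarrow> F(V) \<otimes>\<^sub>A X\<close>.\<close>

definition proj_map :: "('o, 'm, 'w) alg_scheme \<Rightarrow> 'o \<Rightarrow> 'o \<times> 'm \<Rightarrow> 'm" where
  "proj_map A V X = quot_map A (F_ob A V) X \<cdot> (unit_ins A V \<boxtimes> Id C (fst X))"

text \<open>\<open>tensor_functor_to_Rep A Fo Fm J u\<close>: the functor \<open>(Fo, Fm)\<close> from \<open>C\<close> to \<open>Rep A\<close> is a tensor
  functor with structure isomorphisms \<open>J V W: Fo (V \<otimes> W) \<rightarrow> Fo V \<otimes>\<^sub>A Fo W\<close> and \<open>u: Fo \<one> \<rightarrow> A\<close>;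
  these are natural and compatible with the associativity and unit constraints.\<close>

definition tensor_functor_to_Rep :: "('o, 'm, 'w) alg_scheme \<Rightarrow>
    ('o \<Rightarrow> 'o \<times> 'm) \<Rightarrow> ('m \<Rightarrow> 'm) \<Rightarrow> ('o \<Rightarrow> 'o \<Rightarrow> 'm) \<Rightarrow> 'm \<Rightarrow> bool" where
  "tensor_functor_to_Rep A Fo Fm J u \<longleftrightarrow>
    linear_functor C (Rep A) Fo Fm \<and>
    (\<forall>V\<in>Ob C. \<forall>W\<in>Ob C. is_iso (Rep A) (Fo (V \<otimes> W)) (tensA A (Fo V) (Fo W)) (J V W)) \<and>
    (\<forall>V\<in>Ob C. \<forall>V'\<in>Ob C. \<forall>W\<in>Ob C. \<forall>W'\<in>Ob C. \<forall>f\<in>Hom C V V'. \<forall>g\<in>Hom C W W'.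
      J V' W' \<cdot> Fm (f \<boxtimes> g) =
        tensA_mor A (Fo V) (Fo V') (Fo W) (Fo W') (Fm f) (Fm g) \<cdot> J V W) \<and>
    is_iso (Rep A) (Fo \<one>) (Rep_unit A) u \<and>
    (\<forall>U\<in>Ob C. \<forall>V\<in>Ob C. \<forall>W\<in>Ob C.
      assocA A (Fo U) (Fo V) (Fo W) \<cdot>
        tensA_mor A (Fo (U \<otimes> V)) (tensA A (Fo U) (Fo V)) (Fo W) (Fo W) (J U V) (Id C (fst (Fo W))) \<cdot>
        J (U \<otimes> V) W =
      tensA_mor A (Fo U) (Fo U) (Fo (V \<otimes> W)) (tensA A (Fo V) (Fo W)) (Id C (fst (Fo U))) (J V W) \<cdot>
        J U (V \<otimes> W) \<cdot> Fm (Assoc C U V W)) \<and>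
    (\<forall>V\<in>Ob C.
      lunA A (Fo V) \<cdot>
        tensA_mor A (Fo \<one>) (Rep_unit A) (Fo V) (Fo V) u (Id C (fst (Fo V))) \<cdot> J \<one> V =
        Fm (Lun C V) \<and>
      runA A (Fo V) \<cdot>
        tensA_mor A (Fo V) (Fo V) (Fo \<one>) (Rep_unit A) (Id C (fst (Fo V))) u \<cdot> J V \<one> =
        Fm (Run C V))"

end

definition G_ob :: "'o \<times> 'm \<Rightarrow> 'o" where
  "G_ob X = fst X"

definition G_mor :: "'m \<Rightarrow> 'm" where
  "G_mor f = f"

end

theory Submission
  imports Defs
begin

text \<open>
  Two observations carry the theorem: free modules are free, and tensor products with them are split coequalizers.

  A module morphism out of the free module \<open>F(V) = A \<otimes> V\<close> is determined by its restriction along the unit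
  \<open>\<eta>: V \<rightarrow> A \<otimes> V\<close>, and every morphism from \<open>V\<close> to a module extends (\<open>free_ext_\<eta>\<close>,
  \<open>free_ext_of_hom\<close>): this is the adjunction.  It gives half of the exactness: \<open>F\<close> preserves
  cokernels (\<open>F_cokernel\<close>) and \<open>G\<close> preserves kernels (\<open>G_kernel\<close>).  The other half comes from rigidity.
  Tensoring with \<open>A\<close> has adjoints on both sides, so it preserves kernels and cokernels in \<open>C\<close>; hence \<open>F\<close>
  preserves kernels (\<open>F_kernel\<close>), and the cokernel in \<open>C\<close> of a module morphism carries an action of \<open>A\<close> and
  is its cokernel among modules (\<open>G_cokernel\<close>).  Likewise \<open>\<eta>\<close> is a monomorphism, so \<open>F\<close> is faithful.

  The tensor product \<open>F(V) \<otimes>\<^sub>A X\<close> is computed by a split coequalizer.  Moving \<open>A\<close> past \<open>V\<close> and letting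
  it act on \<open>X\<close> is a map \<open>(A \<otimes> V) \<otimes> X \<rightarrow> V \<otimes> X\<close>; it coequalizes the two actions because \<open>A\<close> is
  commutative (\<open>split_r_first\<close>, \<open>split_r_second\<close>), and \<open>\<eta>\<close> splits it.  Therefore
  \<open>F(V) \<otimes>\<^sub>A X\<close> is \<open>V \<otimes> X\<close> (\<open>inverses_P\<close>), and since split coequalizers survive every functor, morphisms out of
  iterated tensor products over \<open>A\<close> can be tested before passing to the quotients.  In these terms
  \<open>F(V \<otimes> W) \<rightarrow> F(V) \<otimes>\<^sub>A F(W)\<close> is the braiding of \<open>A\<close> past \<open>V\<close> (\<open>J_eq_braiding\<close>), hence invertible.
  Its coherence is the pentagon and the triangle of \<open>C\<close>; the hexagons and commutativity enter
  in the existence of the constraints of the modules (\<open>\<kappa>_act_left\<close>, \<open>\<kappa>_act_middle\<close>, \<open>\<kappa>_act_right\<close>, \<open>runit\<close>).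
\<close>

section \<open>Arrows\<close>

text \<open>
  A morphism of \<open>C\<close> does not determine its source and target, so a law of composition or tensoring has
  hypotheses about objects that do not occur in its conclusion, and it cannot be used for rewriting.
  An arrow bundles a morphism with its ends.  The composite of arrows that do not fit together is
  \<open>Null\<close>, which makes composition associative without hypotheses.
\<close>

datatype ('o, 'm) arrow = Null | Arrow (src: 'o) (trg: 'o) (mor: 'm)

context linear_category
begin

definition arr :: "('o, 'm) arrow \<Rightarrow> bool" where
  "arr f \<longleftrightarrow> f \<noteq> Null \<and> src f \<in> Ob C \<and> trg f \<in> Ob C \<and> mor f \<in> Hom C (src f) (trg f)"

definition ide :: "'o \<Rightarrow> ('o, 'm) arrow" where
  "ide a = Arrow a a (Id C a)"

definition comp :: "('o, 'm) arrow \<Rightarrow> ('o, 'm) arrow \<Rightarrow> ('o, 'm) arrow"  (infixr "\<bullet>" 68) where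
  "g \<bullet> f = (if arr g \<and> arr f \<and> src g = trg f then Arrow (src f) (trg g) (mor g \<cdot> mor f) else Null)"

abbreviation obj :: "'o \<Rightarrow> bool" where "obj a \<equiv> a \<in> Ob C"

lemma arr_Null [simp]: "\<not> arr Null"
  by (simp add: arr_def)

lemma arr_Arrow [simp]: "arr (Arrow a b f) \<longleftrightarrow> a \<in> Ob C \<and> b \<in> Ob C \<and> f \<in> Hom C a b"
  by (simp add: arr_def)

lemma arrow_eqI:
  assumes "arr f" "arr g" "src f = src g" "trg f = trg g" "mor f = mor g"
  shows "f = g"
  using assms by (cases f; cases g) auto

lemma Arrow_src_trg [simp]: "arr f \<Longrightarrow> Arrow (src f) (trg f) (mor f) = f"
  by (cases f) auto

lemma arr_objects [simp]:
  assumes "arr f"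
  shows "src f \<in> Ob C" "trg f \<in> Ob C"
  using assms by (auto simp: arr_def)

lemma mor_in_Hom: "arr f \<Longrightarrow> src f = a \<Longrightarrow> trg f = b \<Longrightarrow> mor f \<in> Hom C a b"
  by (auto simp: arr_def)

lemma ide_simps [simp]:
  "arr (ide a) \<longleftrightarrow> a \<in> Ob C" "src (ide a) = a" "trg (ide a) = a" "mor (ide a) = Id C a"
  by (auto simp: ide_def Id_in_Hom)

lemma arr_comp [simp]: "arr (g \<bullet> f) \<longleftrightarrow> arr g \<and> arr f \<and> src g = trg f"
  by (auto simp: comp_def intro!: Cmp_in_Hom [of _ "trg f"] mor_in_Hom)

lemma comp_simps [simp]:
  assumes "arr g" "arr f" "src g = trg f"
  shows "src (g \<bullet> f) = src f" "trg (g \<bullet> f) = trg g" "mor (g \<bullet> f) = mor g \<cdot> mor f"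
  using assms by (simp_all add: comp_def)

lemma comp_Arrow:
  assumes "obj a" "obj b" "obj c" "f \<in> Hom C a b" "g \<in> Hom C b c"
  shows "Arrow b c g \<bullet> Arrow a b f = Arrow a c (g \<cdot> f)"
  using assms by (simp add: comp_def)

lemma comp_Null: "\<not> arr (g \<bullet> f) \<Longrightarrow> g \<bullet> f = Null"
  by (auto simp: comp_def intro!: Cmp_in_Hom [of _ "trg f"] mor_in_Hom)

lemma comp_assoc [simp]: "(h \<bullet> g) \<bullet> f = h \<bullet> (g \<bullet> f)"
proof (cases "arr ((h \<bullet> g) \<bullet> f)")
  case True
  then have t: "arr h" "arr g" "arr f" "src h = trg g" "src g = trg f"
    by (auto split: if_splits)
  show ?thesis
  proof (rule arrow_eqI)
    show "mor ((h \<bullet> g) \<bullet> f) = mor (h \<bullet> (g \<bullet> f))"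
      using t Cmp_assoc [of "src f" "trg f" "trg g" "trg h" "mor f" "mor g" "mor h"]
      by (simp add: mor_in_Hom)
  qed (use t in auto)
next
  case False
  then have "\<not> arr (h \<bullet> (g \<bullet> f))" by auto
  with False show ?thesis by (metis comp_Null)
qed

lemma comp_ide [simp]:
  assumes "arr f"
  shows "a = src f \<Longrightarrow> f \<bullet> ide a = f" "b = trg f \<Longrightarrow> ide b \<bullet> f = f"
  using assms Cmp_Id_left [of "src f" "trg f" "mor f"] Cmp_Id_right [of "src f" "trg f" "mor f"]
  by (auto intro!: arrow_eqI simp: mor_in_Hom)

lemma ide_comp_comp [simp]: "arr f \<Longrightarrow> b = trg f \<Longrightarrow> ide b \<bullet> (f \<bullet> g) = f \<bullet> g"
  by (metis comp_assoc comp_ide(2))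

text \<open>Composites are kept nested to the right; these are the forms in which an equation between
  composites rewrites the beginning of a longer one.\<close>

lemma reassoc: "g \<bullet> f = h \<Longrightarrow> g \<bullet> (f \<bullet> x) = h \<bullet> x"
  by (metis comp_assoc)

lemma reassoc3: "g \<bullet> (f \<bullet> e) = h \<Longrightarrow> g \<bullet> (f \<bullet> (e \<bullet> x)) = h \<bullet> x"
  by (metis comp_assoc)

definition inverses :: "('o, 'm) arrow \<Rightarrow> ('o, 'm) arrow \<Rightarrow> bool" where
  "inverses f g \<longleftrightarrow> arr f \<and> arr g \<and> g \<bullet> f = ide (src f) \<and> f \<bullet> g = ide (trg f)"

lemma inverses_ends:
  assumes "inverses f g"
  shows "arr f" "arr g" "src g = trg f" "trg g = src f"
proof -
  show *: "arr f" "arr g" using assms by (auto simp: inverses_def)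
  have "arr (g \<bullet> f)" "arr (f \<bullet> g)" using assms by (auto simp: inverses_def)
  then show "src g = trg f" "trg g = src f" by auto
qed

lemma inverses_sym: "inverses f g \<Longrightarrow> inverses g f"
  by (metis inverses_def inverses_ends)

lemma inverses_comp:
  assumes "inverses f g"
  shows "g \<bullet> f = ide (src f)" "f \<bullet> g = ide (trg f)"
    "arr x \<Longrightarrow> trg x = src f \<Longrightarrow> g \<bullet> (f \<bullet> x) = x" "arr x \<Longrightarrow> trg x = trg f \<Longrightarrow> f \<bullet> (g \<bullet> x) = x"
proof -
  show *: "g \<bullet> f = ide (src f)" "f \<bullet> g = ide (trg f)"
    using assms by (auto simp: inverses_def)
  show "arr x \<Longrightarrow> trg x = src f \<Longrightarrow> g \<bullet> (f \<bullet> x) = x" "arr x \<Longrightarrow> trg x = trg f \<Longrightarrow> f \<bullet> (g \<bullet> x) = x"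
    by (simp_all add: reassoc [OF *(1)] reassoc [OF *(2)])
qed

lemma inverses_cancel_right:
  assumes "inverses f g" "x \<bullet> f = y \<bullet> f" "arr x" "arr y" "src x = trg f" "src y = trg f"
  shows "x = y"
proof -
  have "x \<bullet> (f \<bullet> g) = y \<bullet> (f \<bullet> g)" by (metis assms(2) comp_assoc)
  then show ?thesis using assms inverses_comp(2) [OF assms(1)] by simp
qed

lemma inverses_cancel_left:
  assumes "inverses f g" "f \<bullet> x = f \<bullet> y" "arr x" "arr y" "trg x = src f" "trg y = src f"
  shows "x = y"
  using assms inverses_comp(3) [OF assms(1)] by metis

text \<open>Split epimorphisms stay split, hence epimorphisms, after tensoring.\<close>

lemma split_epi_cancel:
  assumes "p \<bullet> s = ide (trg p)" "x \<bullet> p = y \<bullet> p" "arr p" "arr x" "arr y" "src x = trg p" "src y = trg p"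
  shows "x = y"
proof -
  have "x \<bullet> (p \<bullet> s) = y \<bullet> (p \<bullet> s)" using assms(2) by (metis comp_assoc)
  then show ?thesis using assms by simp
qed

lemma is_iso_inverses:
  assumes "is_iso C a b f"
  shows "inverses (Arrow a b f) (Arrow b a (inv_mor C a b f))"
proof -
  obtain g where g: "g \<in> Hom C b a" "g \<cdot> f = Id C a" "f \<cdot> g = Id C b"
    and f: "obj a" "obj b" "f \<in> Hom C a b"
    using assms by (auto simp: is_iso_def)
  have "inv_mor C a b f = g"
    unfolding inv_mor_def
  proof (rule the_equality)
    fix h assume h: "h \<in> Hom C b a \<and> h \<cdot> f = Id C a \<and> f \<cdot> h = Id C b"
    have "(h \<cdot> f) \<cdot> g = h \<cdot> (f \<cdot> g)" using f g h by (intro Cmp_assoc) auto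
    then show "h = g"
      using f g h Cmp_Id_left [of b a g] Cmp_Id_right [of b a h] by simp
  qed (use g in auto)
  with f g show ?thesis by (auto simp: inverses_def comp_Arrow ide_def)
qed

lemma inverses_is_iso:
  assumes "inverses (Arrow a b f) g"
  shows "is_iso C a b f"
proof -
  have e: "arr g" "src g = b" "trg g = a" "obj a" "obj b" "f \<in> Hom C a b"
    using inverses_ends [OF assms] by auto
  have "mor (g \<bullet> Arrow a b f) = Id C a" "mor (Arrow a b f \<bullet> g) = Id C b"
    using assms by (simp_all add: inverses_def)
  then have "mor g \<cdot> f = Id C a" "f \<cdot> mor g = Id C b"
    using e by simp_all
  with e show ?thesis unfolding is_iso_def by (meson mor_in_Hom)
qed

lemma inverses_trans:
  assumes "inverses f g" "inverses f' g'" "src f' = trg f"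
  shows "inverses (f' \<bullet> f) (g \<bullet> g')"
proof -
  note e = inverses_ends [OF assms(1)] inverses_ends [OF assms(2)] assms(3)
  have "g \<bullet> (g' \<bullet> (f' \<bullet> f)) = ide (src f)" "f' \<bullet> (f \<bullet> (g \<bullet> g')) = ide (trg f')"
    using e inverses_comp [OF assms(1)] inverses_comp [OF assms(2)] by simp_all
  then show ?thesis using e by (simp add: inverses_def)
qed

section \<open>Kernels and cokernels\<close>

lemma Hom_diff: "obj a \<Longrightarrow> obj b \<Longrightarrow> f \<in> Hom C a b \<Longrightarrow> g \<in> Hom C a b \<Longrightarrow> f - g \<in> Hom C a b"
proof -
  interpret vector_space "Scl C" by (rule vector_space_Scl)
  assume "obj a" "obj b" "f \<in> Hom C a b" "g \<in> Hom C a b"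
  then show ?thesis by (blast intro: subspace_diff subspace_Hom)
qed

lemma Hom_zero: "obj a \<Longrightarrow> obj b \<Longrightarrow> 0 \<in> Hom C a b"
proof -
  interpret vector_space "Scl C" by (rule vector_space_Scl)
  assume "obj a" "obj b"
  then show ?thesis by (blast intro: subspace_0 subspace_Hom)
qed

lemma Cmp_diff_right:
  assumes "obj a" "obj b" "obj c" "f \<in> Hom C a b" "f' \<in> Hom C a b" "g \<in> Hom C b c"
  shows "g \<cdot> (f - f') = g \<cdot> f - g \<cdot> f'"
  using Cmp_add_right [of a b c "f - f'" f' g] assms by (simp add: Hom_diff)

lemma mor_zero_comp:
  assumes "arr g" "arr f" "src g = trg f"
  shows "mor f = 0 \<Longrightarrow> mor (g \<bullet> f) = 0" "mor g = 0 \<Longrightarrow> mor (g \<bullet> f) = 0"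
proof -
  have "0 \<cdot> mor f = 0" "mor g \<cdot> 0 = 0"
    using Cmp_add_left [of "src f" "trg f" "trg g" "mor f" 0 0]
      Cmp_diff_right [of "src f" "trg f" "trg g" 0 0 "mor g"] assms by (simp_all add: Hom_zero mor_in_Hom)
  then show "mor f = 0 \<Longrightarrow> mor (g \<bullet> f) = 0" "mor g = 0 \<Longrightarrow> mor (g \<bullet> f) = 0"
    using assms by simp_all
qed

end

text \<open>
  Kernels and cokernels are needed both in \<open>C\<close> and among modules.  In either case the morphisms are
  morphisms of \<open>C\<close> between underlying objects, so that one formulation by arrows serves both.
\<close>

locale category_over = linear_category C
  for C :: "('o, 'm::ab_group_add, 'z) lin_cat_scheme" (structure) +
  fixes D :: "('p, 'm, 'y) lin_cat_scheme" and U :: "'p \<Rightarrow> 'o"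
  assumes U_in_Ob: "X \<in> Ob D \<Longrightarrow> U X \<in> Ob C"
    and Hom_subset: "X \<in> Ob D \<Longrightarrow> Y \<in> Ob D \<Longrightarrow> Hom D X Y \<subseteq> Hom C (U X) (U Y)"
    and Cmp_eq: "Cmp D = Cmp C"
    and Cmp_closed: "X \<in> Ob D \<Longrightarrow> Y \<in> Ob D \<Longrightarrow> Z \<in> Ob D \<Longrightarrow> f \<in> Hom D X Y \<Longrightarrow> g \<in> Hom D Y Z \<Longrightarrow>
      g \<cdot> f \<in> Hom D X Z"
begin

definition hom :: "'p \<Rightarrow> 'p \<Rightarrow> ('o, 'm) arrow \<Rightarrow> bool" where
  "hom X Y f \<longleftrightarrow> X \<in> Ob D \<and> Y \<in> Ob D \<and> arr f \<and> src f = U X \<and> trg f = U Y \<and> mor f \<in> Hom D X Y"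

lemma homD:
  assumes "hom X Y f"
  shows "arr f" "src f = U X" "trg f = U Y" "mor f \<in> Hom D X Y" "X \<in> Ob D" "Y \<in> Ob D"
  using assms by (simp_all add: hom_def)

lemma hom_Arrow:
  assumes "X \<in> Ob D" "Y \<in> Ob D" "f \<in> Hom D X Y"
  shows "hom X Y (Arrow (U X) (U Y) f)"
  using assms Hom_subset [of X Y] by (auto simp: hom_def U_in_Ob)

lemma hom_comp:
  assumes "hom X Y f" "hom Y Z g"
  shows "hom X Z (g \<bullet> f)"
  using assms Cmp_closed [of X Y Z "mor f" "mor g"] by (simp add: hom_def)

lemma kernelI:
  assumes f: "hom X Y f" and i: "hom Z X i" and 0: "mor (f \<bullet> i) = 0"
    and ex: "\<And>W g. hom W X g \<Longrightarrow> mor (f \<bullet> g) = 0 \<Longrightarrow> \<exists>h. hom W Z h \<and> i \<bullet> h = g"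
    and mono: "\<And>W x y. hom W Z x \<Longrightarrow> hom W Z y \<Longrightarrow> i \<bullet> x = i \<bullet> y \<Longrightarrow> x = y"
  shows "is_kernel D X Y (mor f) Z (mor i)"
  unfolding is_kernel_def Cmp_eq
proof (intro conjI ballI impI)
  note fi = homD [OF f] homD [OF i]
  show "mor f \<cdot> mor i = 0"
    using 0 fi by simp
  fix W g assume W: "W \<in> Ob D" and g: "g \<in> Hom D W X" and fg: "mor f \<cdot> g = 0"
  let ?g = "Arrow (U W) (U X) g"
  have g': "hom W X ?g" by (rule hom_Arrow [OF W fi(5) g])
  have "mor (f \<bullet> ?g) = 0"
    using fi homD(1) [OF g'] fg by simp
  from ex [OF g' this] obtain h where h: "hom W Z h" "i \<bullet> h = ?g" by auto
  show "\<exists>!h. h \<in> Hom D W Z \<and> mor i \<cdot> h = g"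
  proof (rule ex1I [of _ "mor h"])
    have "mor i \<cdot> mor h = mor (i \<bullet> h)"
      using fi homD [OF h(1)] by simp
    then show "mor h \<in> Hom D W Z \<and> mor i \<cdot> mor h = g"
      using h homD(4) [OF h(1)] by simp
  next
    fix k assume k: "k \<in> Hom D W Z \<and> mor i \<cdot> k = g"
    let ?k = "Arrow (U W) (U Z) k"
    have k': "hom W Z ?k" using k fi by (intro hom_Arrow [OF W]) simp_all
    have "i \<bullet> ?k = ?g"
      by (rule arrow_eqI) (use fi homD(1) [OF k'] homD(1) [OF g'] k in simp_all)
    with h have "?k = h" by (intro mono [OF k' h(1)]) simp
    then show "k = mor h" by (metis arrow.sel(3))
  qed
qed (use homD [OF f] homD [OF i] in simp_all)

lemma kernelD:
  assumes ker: "is_kernel D X Y f Z i"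
  defines "f' \<equiv> Arrow (U X) (U Y) f" and "i' \<equiv> Arrow (U Z) (U X) i"
  shows "hom X Y f'" "hom Z X i'" "mor (f' \<bullet> i') = 0"
    and "\<And>W g. hom W X g \<Longrightarrow> mor (f' \<bullet> g) = 0 \<Longrightarrow> \<exists>h. hom W Z h \<and> i' \<bullet> h = g"
    and "\<And>W x y. hom W Z x \<Longrightarrow> hom W Z y \<Longrightarrow> i' \<bullet> x = i' \<bullet> y \<Longrightarrow> x = y"
proof -
  have ob: "X \<in> Ob D" "Y \<in> Ob D" "Z \<in> Ob D"
    and f: "f \<in> Hom D X Y" and i: "i \<in> Hom D Z X" and 0: "f \<cdot> i = 0"
    and ex: "\<And>W g. W \<in> Ob D \<Longrightarrow> g \<in> Hom D W X \<Longrightarrow> f \<cdot> g = 0 \<Longrightarrow> \<exists>!h. h \<in> Hom D W Z \<and> i \<cdot> h = g"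
    using ker by (simp_all add: is_kernel_def Cmp_eq)
  show f': "hom X Y f'" and i': "hom Z X i'"
    unfolding f'_def i'_def using ob f i by (simp_all add: hom_Arrow)
  note fi = homD(1-3) [OF f'] homD(1-3) [OF i']
  have m: "mor f' = f" "mor i' = i" by (simp_all add: f'_def i'_def)
  show zero: "mor (f' \<bullet> i') = 0"
    using 0 fi m by simp
  show "\<exists>h. hom W Z h \<and> i' \<bullet> h = g" if g: "hom W X g" and fg: "mor (f' \<bullet> g) = 0" for W g
  proof -
    have "f \<cdot> mor g = 0" using fg fi homD(1-3) [OF g] m by simp
    with ex [OF homD(5,4) [OF g]] obtain h where h: "h \<in> Hom D W Z" "i \<cdot> h = mor g"
      by auto
    have h': "hom W Z (Arrow (U W) (U Z) h)" by (rule hom_Arrow [OF homD(5) [OF g] ob(3) h(1)])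
    have "i' \<bullet> Arrow (U W) (U Z) h = g"
      by (rule arrow_eqI) (use fi homD(1) [OF h'] homD(1-3) [OF g] h(2) m in simp_all)
    with h' show ?thesis by blast
  qed
  show "x = y" if x: "hom W Z x" and y: "hom W Z y" and eq: "i' \<bullet> x = i' \<bullet> y" for W x y
  proof -
    note xy = homD(1-3) [OF x] homD(1-3) [OF y]
    have "mor (i' \<bullet> x) = mor (i' \<bullet> y)" by (simp only: eq)
    then have ixy: "i \<cdot> mor x = i \<cdot> mor y" using xy fi m by simp
    have "mor (f' \<bullet> i' \<bullet> y) = 0"
      using mor_zero_comp(2) [of "f' \<bullet> i'" y] zero fi xy by simp
    then have "f \<cdot> (i \<cdot> mor y) = 0" using fi xy m by simp
    moreover have "i \<cdot> mor y \<in> Hom D W X"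
      using homD(4) [OF hom_comp [OF y i']] fi xy m by simp
    ultimately have "mor x = mor y"
      using ex [OF homD(5) [OF x], of "i \<cdot> mor y"] ixy homD(4) [OF x] homD(4) [OF y] by auto
    then show ?thesis using xy by (intro arrow_eqI) simp_all
  qed
qed

lemma cokernelI:
  assumes f: "hom X Y f" and p: "hom Y Z p" and 0: "mor (p \<bullet> f) = 0"
    and ex: "\<And>W g. hom Y W g \<Longrightarrow> mor (g \<bullet> f) = 0 \<Longrightarrow> \<exists>h. hom Z W h \<and> h \<bullet> p = g"
    and epi: "\<And>W x y. hom Z W x \<Longrightarrow> hom Z W y \<Longrightarrow> x \<bullet> p = y \<bullet> p \<Longrightarrow> x = y"
  shows "is_cokernel D X Y (mor f) Z (mor p)"
  unfolding is_cokernel_def Cmp_eq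
proof (intro conjI ballI impI)
  note fp = homD [OF f] homD [OF p]
  show "mor p \<cdot> mor f = 0"
    using 0 fp by simp
  fix W g assume W: "W \<in> Ob D" and g: "g \<in> Hom D Y W" and gf: "g \<cdot> mor f = 0"
  let ?g = "Arrow (U Y) (U W) g"
  have g': "hom Y W ?g" by (rule hom_Arrow [OF fp(6) W g])
  have "mor (?g \<bullet> f) = 0"
    using fp homD(1) [OF g'] gf by simp
  from ex [OF g' this] obtain h where h: "hom Z W h" "h \<bullet> p = ?g" by auto
  show "\<exists>!h. h \<in> Hom D Z W \<and> h \<cdot> mor p = g"
  proof (rule ex1I [of _ "mor h"])
    have "mor h \<cdot> mor p = mor (h \<bullet> p)"
      using fp homD [OF h(1)] by simp
    then show "mor h \<in> Hom D Z W \<and> mor h \<cdot> mor p = g"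
      using h homD(4) [OF h(1)] by simp
  next
    fix k assume k: "k \<in> Hom D Z W \<and> k \<cdot> mor p = g"
    let ?k = "Arrow (U Z) (U W) k"
    have k': "hom Z W ?k" using k fp by (intro hom_Arrow [OF _ W]) simp_all
    have "?k \<bullet> p = ?g"
      by (rule arrow_eqI) (use fp homD(1) [OF k'] homD(1) [OF g'] k in simp_all)
    with h have "?k = h" by (intro epi [OF k' h(1)]) simp
    then show "k = mor h" by (metis arrow.sel(3))
  qed
qed (use homD [OF f] homD [OF p] in simp_all)

lemma cokernelD:
  assumes coker: "is_cokernel D X Y f Z p"
  defines "f' \<equiv> Arrow (U X) (U Y) f" and "p' \<equiv> Arrow (U Y) (U Z) p"
  shows "hom X Y f'" "hom Y Z p'" "mor (p' \<bullet> f') = 0"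
    and "\<And>W g. hom Y W g \<Longrightarrow> mor (g \<bullet> f') = 0 \<Longrightarrow> \<exists>h. hom Z W h \<and> h \<bullet> p' = g"
    and "\<And>W x y. hom Z W x \<Longrightarrow> hom Z W y \<Longrightarrow> x \<bullet> p' = y \<bullet> p' \<Longrightarrow> x = y"
proof -
  have ob: "X \<in> Ob D" "Y \<in> Ob D" "Z \<in> Ob D"
    and f: "f \<in> Hom D X Y" and p: "p \<in> Hom D Y Z" and 0: "p \<cdot> f = 0"
    and ex: "\<And>W g. W \<in> Ob D \<Longrightarrow> g \<in> Hom D Y W \<Longrightarrow> g \<cdot> f = 0 \<Longrightarrow> \<exists>!h. h \<in> Hom D Z W \<and> h \<cdot> p = g"
    using coker by (simp_all add: is_cokernel_def Cmp_eq)
  show f': "hom X Y f'" and p': "hom Y Z p'"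
    unfolding f'_def p'_def using ob f p by (simp_all add: hom_Arrow)
  note fp = homD(1-3) [OF f'] homD(1-3) [OF p']
  have m: "mor f' = f" "mor p' = p" by (simp_all add: f'_def p'_def)
  show zero: "mor (p' \<bullet> f') = 0"
    using 0 fp m by simp
  show "\<exists>h. hom Z W h \<and> h \<bullet> p' = g" if g: "hom Y W g" and gf: "mor (g \<bullet> f') = 0" for W g
  proof -
    have "mor g \<cdot> f = 0" using gf fp homD(1-3) [OF g] m by simp
    with ex [OF homD(6,4) [OF g]] obtain h where h: "h \<in> Hom D Z W" "h \<cdot> p = mor g"
      by auto
    have h': "hom Z W (Arrow (U Z) (U W) h)" by (rule hom_Arrow [OF ob(3) homD(6) [OF g] h(1)])
    have "Arrow (U Z) (U W) h \<bullet> p' = g"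
      by (rule arrow_eqI) (use fp homD(1) [OF h'] homD(1-3) [OF g] h(2) m in simp_all)
    with h' show ?thesis by blast
  qed
  show "x = y" if x: "hom Z W x" and y: "hom Z W y" and eq: "x \<bullet> p' = y \<bullet> p'" for W x y
  proof -
    note xy = homD(1-3) [OF x] homD(1-3) [OF y]
    have "mor (x \<bullet> p') = mor (y \<bullet> p')" by (simp only: eq)
    then have xyp: "mor x \<cdot> p = mor y \<cdot> p" using xy fp m by simp
    have "mor ((y \<bullet> p') \<bullet> f') = 0"
      using mor_zero_comp(1) [of y "p' \<bullet> f'"] zero fp xy by simp
    then have "(mor y \<cdot> p) \<cdot> f = 0" using fp xy m by (simp del: comp_assoc)
    moreover have "mor y \<cdot> p \<in> Hom D Y W"
      using homD(4) [OF hom_comp [OF p' y]] fp xy m by simp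
    ultimately have "mor x = mor y"
      using ex [OF homD(6) [OF x], of "mor y \<cdot> p"] xyp homD(4) [OF x] homD(4) [OF y] by auto
    then show ?thesis using xy by (intro arrow_eqI) simp_all
  qed
qed

end

context linear_category
begin

interpretation self: category_over C C "\<lambda>a. a"
  by unfold_locales (auto intro: Cmp_in_Hom)

lemma self_hom: "self.hom a b f \<longleftrightarrow> arr f \<and> src f = a \<and> trg f = b"
  by (auto simp: self.hom_def mor_in_Hom)

lemma kernelI:
  assumes "arr f" "arr i" "trg i = src f" "mor (f \<bullet> i) = 0"
    and "\<And>g. arr g \<Longrightarrow> trg g = src f \<Longrightarrow> mor (f \<bullet> g) = 0 \<Longrightarrow>
      \<exists>h. arr h \<and> src h = src g \<and> trg h = src i \<and> i \<bullet> h = g"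
    and "\<And>x y. arr x \<Longrightarrow> arr y \<Longrightarrow> src x = src y \<Longrightarrow> trg x = src i \<Longrightarrow> trg y = src i \<Longrightarrow>
      i \<bullet> x = i \<bullet> y \<Longrightarrow> x = y"
  shows "is_kernel C (src f) (trg f) (mor f) (src i) (mor i)"
proof (rule self.kernelI)
  show "self.hom (src f) (trg f) f" "self.hom (src i) (src f) i" "mor (f \<bullet> i) = 0"
    using assms(1-4) by (simp_all add: self_hom)
qed (use assms(5,6) in \<open>unfold self_hom, blast, metis\<close>)

lemma kernelD:
  assumes "is_kernel C a b f k i"
  shows "arr (Arrow a b f)" "arr (Arrow k a i)" "mor (Arrow a b f \<bullet> Arrow k a i) = 0"
    and "\<And>g. arr g \<Longrightarrow> trg g = a \<Longrightarrow> mor (Arrow a b f \<bullet> g) = 0 \<Longrightarrow>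
      \<exists>h. arr h \<and> src h = src g \<and> trg h = k \<and> Arrow k a i \<bullet> h = g"
    and "\<And>x y. arr x \<Longrightarrow> arr y \<Longrightarrow> src x = src y \<Longrightarrow> trg x = k \<Longrightarrow> trg y = k \<Longrightarrow>
      Arrow k a i \<bullet> x = Arrow k a i \<bullet> y \<Longrightarrow> x = y"
  using self.kernelD [OF assms] unfolding self_hom by (blast | metis)+

lemma cokernelI:
  assumes "arr f" "arr p" "src p = trg f" "mor (p \<bullet> f) = 0"
    and "\<And>g. arr g \<Longrightarrow> src g = trg f \<Longrightarrow> mor (g \<bullet> f) = 0 \<Longrightarrow>
      \<exists>h. arr h \<and> src h = trg p \<and> trg h = trg g \<and> h \<bullet> p = g"
    and "\<And>x y. arr x \<Longrightarrow> arr y \<Longrightarrow> src x = trg p \<Longrightarrow> src y = trg p \<Longrightarrow> trg x = trg y \<Longrightarrow>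
      x \<bullet> p = y \<bullet> p \<Longrightarrow> x = y"
  shows "is_cokernel C (src f) (trg f) (mor f) (trg p) (mor p)"
proof (rule self.cokernelI)
  show "self.hom (src f) (trg f) f" "self.hom (trg f) (trg p) p" "mor (p \<bullet> f) = 0"
    using assms(1-4) by (simp_all add: self_hom)
qed (use assms(5,6) in \<open>unfold self_hom, blast, metis\<close>)

lemma cokernelD:
  assumes "is_cokernel C a b f k p"
  shows "arr (Arrow a b f)" "arr (Arrow b k p)" "mor (Arrow b k p \<bullet> Arrow a b f) = 0"
    and "\<And>g. arr g \<Longrightarrow> src g = b \<Longrightarrow> mor (g \<bullet> Arrow a b f) = 0 \<Longrightarrow>
      \<exists>h. arr h \<and> src h = k \<and> trg h = trg g \<and> h \<bullet> Arrow b k p = g"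
    and "\<And>x y. arr x \<Longrightarrow> arr y \<Longrightarrow> src x = k \<Longrightarrow> src y = k \<Longrightarrow> trg x = trg y \<Longrightarrow>
      x \<bullet> Arrow b k p = y \<bullet> Arrow b k p \<Longrightarrow> x = y"
  using self.cokernelD [OF assms] unfolding self_hom by (blast | metis)+

end

section \<open>Tensor products of arrows\<close>

context monoidal_category
begin

definition tens :: "('o, 'm) arrow \<Rightarrow> ('o, 'm) arrow \<Rightarrow> ('o, 'm) arrow"  (infixr "\<star>" 75) where
  "f \<star> g = (if arr f \<and> arr g
     then Arrow (src f \<otimes> src g) (trg f \<otimes> trg g) (mor f \<boxtimes> mor g) else Null)"

abbreviation whisker_left :: "'o \<Rightarrow> ('o, 'm) arrow \<Rightarrow> ('o, 'm) arrow"  (infixr "\<rhd>" 75) where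
  "a \<rhd> f \<equiv> ide a \<star> f"

abbreviation whisker_right :: "('o, 'm) arrow \<Rightarrow> 'o \<Rightarrow> ('o, 'm) arrow"  (infixl "\<lhd>" 76) where
  "f \<lhd> a \<equiv> f \<star> ide a"

declare Unit_in_Ob [simp] Tens_in_Ob [simp]

lemma arr_tens [simp]: "arr (f \<star> g) \<longleftrightarrow> arr f \<and> arr g"
  by (auto simp: tens_def intro: TensM_in_Hom mor_in_Hom)

lemma tens_simps [simp]:
  assumes "arr f" "arr g"
  shows "src (f \<star> g) = src f \<otimes> src g" "trg (f \<star> g) = trg f \<otimes> trg g"
    "mor (f \<star> g) = mor f \<boxtimes> mor g"
  using assms by (simp_all add: tens_def)

lemma tens_ide [simp]: "obj a \<Longrightarrow> obj b \<Longrightarrow> a \<rhd> ide b = ide (a \<otimes> b)"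
  by (intro arrow_eqI) (auto simp: TensM_Id)

lemma interchange:
  assumes "arr f" "arr f'" "arr g" "arr g'" "src f' = trg f" "src g' = trg g"
  shows "(f' \<star> g') \<bullet> (f \<star> g) = (f' \<bullet> f) \<star> (g' \<bullet> g)"
  using assms TensM_Cmp [of "src f" "trg f" "trg f'" "src g" "trg g" "trg g'"]
  by (intro arrow_eqI) (auto simp: mor_in_Hom)

lemma whisker_comp [simp]:
  assumes "obj a" "arr f" "arr g" "src g = trg f"
  shows "a \<rhd> (g \<bullet> f) = (a \<rhd> g) \<bullet> (a \<rhd> f)" "(g \<bullet> f) \<lhd> a = (g \<lhd> a) \<bullet> (f \<lhd> a)"
  using assms by (simp_all add: interchange)

lemma slide:
  assumes "arr f" "arr g" "a = src f" "b = trg f" "c = src g" "d = trg g"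
  shows "(b \<rhd> g) \<bullet> (f \<lhd> c) = (f \<lhd> d) \<bullet> (a \<rhd> g)"
  using assms by (simp add: interchange del: whisker_comp)

lemma tens_whiskers:
  assumes "arr f" "arr g" "a = trg g" "b = src f"
  shows "f \<star> g = (f \<lhd> a) \<bullet> (b \<rhd> g)"
  using assms by (simp add: interchange del: whisker_comp)

lemma inverses_whisker:
  assumes "inverses f g" "obj a"
  shows "inverses (a \<rhd> f) (a \<rhd> g)" "inverses (f \<lhd> a) (g \<lhd> a)"
  using assms inverses_ends [OF assms(1)] inverses_comp(1,2) [OF assms(1)]
  by (simp_all add: inverses_def interchange del: whisker_comp)

lemma iso_whisker_comp:
  assumes "inverses f g" "obj a"
  shows "(a \<rhd> g) \<bullet> (a \<rhd> f) = ide (a \<otimes> src f)" "(a \<rhd> f) \<bullet> (a \<rhd> g) = ide (a \<otimes> trg f)"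
    "(g \<lhd> a) \<bullet> (f \<lhd> a) = ide (src f \<otimes> a)" "(f \<lhd> a) \<bullet> (g \<lhd> a) = ide (trg f \<otimes> a)"
  using assms inverses_ends [OF assms(1)] inverses_comp(1,2) [OF assms(1)]
  by (simp_all add: interchange del: whisker_comp)

definition \<alpha> :: "'o \<Rightarrow> 'o \<Rightarrow> 'o \<Rightarrow> ('o, 'm) arrow" where
  "\<alpha> a b c = Arrow ((a \<otimes> b) \<otimes> c) (a \<otimes> (b \<otimes> c)) (Assoc C a b c)"

definition \<alpha>' :: "'o \<Rightarrow> 'o \<Rightarrow> 'o \<Rightarrow> ('o, 'm) arrow" where
  "\<alpha>' a b c = Arrow (a \<otimes> (b \<otimes> c)) ((a \<otimes> b) \<otimes> c) (inv_Assoc C a b c)"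

definition lu :: "'o \<Rightarrow> ('o, 'm) arrow" where
  "lu a = Arrow (\<one> \<otimes> a) a (Lun C a)"

definition lu' :: "'o \<Rightarrow> ('o, 'm) arrow" where
  "lu' a = Arrow a (\<one> \<otimes> a) (inv_mor C (\<one> \<otimes> a) a (Lun C a))"

definition ru :: "'o \<Rightarrow> ('o, 'm) arrow" where
  "ru a = Arrow (a \<otimes> \<one>) a (Run C a)"

definition ru' :: "'o \<Rightarrow> ('o, 'm) arrow" where
  "ru' a = Arrow a (a \<otimes> \<one>) (inv_mor C (a \<otimes> \<one>) a (Run C a))"

lemma mor_constraints [simp]:
  "mor (\<alpha> a b c) = Assoc C a b c" "mor (\<alpha>' a b c) = inv_Assoc C a b c"
  "mor (lu a) = Lun C a" "mor (lu' a) = inv_mor C (\<one> \<otimes> a) a (Lun C a)"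
  "mor (ru a) = Run C a"
  by (simp_all add: \<alpha>_def \<alpha>'_def lu_def lu'_def ru_def)

lemma inverses_\<alpha>: "obj a \<Longrightarrow> obj b \<Longrightarrow> obj c \<Longrightarrow> inverses (\<alpha> a b c) (\<alpha>' a b c)"
  unfolding \<alpha>_def \<alpha>'_def by (rule is_iso_inverses) (rule Assoc_iso)

lemma inverses_lu: "obj a \<Longrightarrow> inverses (lu a) (lu' a)"
  unfolding lu_def lu'_def by (rule is_iso_inverses) (rule Lun_iso)

lemma inverses_ru: "obj a \<Longrightarrow> inverses (ru a) (ru' a)"
  unfolding ru_def ru'_def by (rule is_iso_inverses) (rule Run_iso)

lemma \<alpha>_typing [simp]:
  "src (\<alpha> a b c) = (a \<otimes> b) \<otimes> c" "trg (\<alpha> a b c) = a \<otimes> (b \<otimes> c)"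
  "src (\<alpha>' a b c) = a \<otimes> (b \<otimes> c)" "trg (\<alpha>' a b c) = (a \<otimes> b) \<otimes> c"
  "obj a \<Longrightarrow> obj b \<Longrightarrow> obj c \<Longrightarrow> arr (\<alpha> a b c)"
  "obj a \<Longrightarrow> obj b \<Longrightarrow> obj c \<Longrightarrow> arr (\<alpha>' a b c)"
  using inverses_ends [OF inverses_\<alpha>] by (simp_all add: \<alpha>_def \<alpha>'_def)

lemma unit_typing [simp]:
  "src (lu a) = \<one> \<otimes> a" "trg (lu a) = a" "src (lu' a) = a" "trg (lu' a) = \<one> \<otimes> a"
  "src (ru a) = a \<otimes> \<one>" "trg (ru a) = a" "src (ru' a) = a" "trg (ru' a) = a \<otimes> \<one>"
  "obj a \<Longrightarrow> arr (lu a)" "obj a \<Longrightarrow> arr (lu' a)"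
  "obj a \<Longrightarrow> arr (ru a)" "obj a \<Longrightarrow> arr (ru' a)"
  using inverses_ends [OF inverses_lu] inverses_ends [OF inverses_ru]
  by (simp_all add: lu_def lu'_def ru_def ru'_def)

lemma \<alpha>_cancel [simp]:
  assumes "obj a" "obj b" "obj c"
  shows "\<alpha> a b c \<bullet> \<alpha>' a b c = ide (a \<otimes> (b \<otimes> c))" "\<alpha>' a b c \<bullet> \<alpha> a b c = ide ((a \<otimes> b) \<otimes> c)"
    "arr x \<Longrightarrow> trg x = a \<otimes> (b \<otimes> c) \<Longrightarrow> \<alpha> a b c \<bullet> (\<alpha>' a b c \<bullet> x) = x"
    "arr x \<Longrightarrow> trg x = (a \<otimes> b) \<otimes> c \<Longrightarrow> \<alpha>' a b c \<bullet> (\<alpha> a b c \<bullet> x) = x"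
  using inverses_comp [OF inverses_\<alpha> [OF assms]] by simp_all

lemma \<alpha>_whisker_cancel [simp]:
  assumes "obj a" "obj b" "obj c" "obj d"
  shows "(d \<rhd> \<alpha> a b c) \<bullet> (d \<rhd> \<alpha>' a b c) = ide (d \<otimes> (a \<otimes> (b \<otimes> c)))"
    "(d \<rhd> \<alpha>' a b c) \<bullet> (d \<rhd> \<alpha> a b c) = ide (d \<otimes> ((a \<otimes> b) \<otimes> c))"
    "(\<alpha> a b c \<lhd> d) \<bullet> (\<alpha>' a b c \<lhd> d) = ide ((a \<otimes> (b \<otimes> c)) \<otimes> d)"
    "(\<alpha>' a b c \<lhd> d) \<bullet> (\<alpha> a b c \<lhd> d) = ide (((a \<otimes> b) \<otimes> c) \<otimes> d)"
    "arr x \<Longrightarrow> trg x = d \<otimes> (a \<otimes> (b \<otimes> c)) \<Longrightarrow> (d \<rhd> \<alpha> a b c) \<bullet> ((d \<rhd> \<alpha>' a b c) \<bullet> x) = x"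
    "arr x \<Longrightarrow> trg x = d \<otimes> ((a \<otimes> b) \<otimes> c) \<Longrightarrow> (d \<rhd> \<alpha>' a b c) \<bullet> ((d \<rhd> \<alpha> a b c) \<bullet> x) = x"
    "arr x \<Longrightarrow> trg x = (a \<otimes> (b \<otimes> c)) \<otimes> d \<Longrightarrow> (\<alpha> a b c \<lhd> d) \<bullet> ((\<alpha>' a b c \<lhd> d) \<bullet> x) = x"
    "arr x \<Longrightarrow> trg x = ((a \<otimes> b) \<otimes> c) \<otimes> d \<Longrightarrow> (\<alpha>' a b c \<lhd> d) \<bullet> ((\<alpha> a b c \<lhd> d) \<bullet> x) = x"
  using assms inverses_comp [OF inverses_whisker(1) [OF inverses_\<alpha>]]
    inverses_comp [OF inverses_whisker(2) [OF inverses_\<alpha>]] by simp_all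

lemma lu_cancel [simp]:
  assumes "obj a"
  shows "lu a \<bullet> lu' a = ide a" "lu' a \<bullet> lu a = ide (\<one> \<otimes> a)"
    "arr x \<Longrightarrow> trg x = a \<Longrightarrow> lu a \<bullet> (lu' a \<bullet> x) = x"
    "arr x \<Longrightarrow> trg x = \<one> \<otimes> a \<Longrightarrow> lu' a \<bullet> (lu a \<bullet> x) = x"
  using inverses_comp [OF inverses_lu [OF assms]] by simp_all

lemma \<alpha>_natural:
  assumes "arr f" "arr g" "arr h"
  shows "\<alpha> (trg f) (trg g) (trg h) \<bullet> ((f \<star> g) \<star> h) = (f \<star> (g \<star> h)) \<bullet> \<alpha> (src f) (src g) (src h)"
  using assms Assoc_natural [of "src f" "trg f" "src g" "trg g" "src h" "trg h" "mor f" "mor g" "mor h"]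
  by (intro arrow_eqI) (auto simp: mor_in_Hom)

lemma \<alpha>'_natural:
  assumes "arr f" "arr g" "arr h"
  shows "\<alpha>' (trg f) (trg g) (trg h) \<bullet> (f \<star> (g \<star> h)) = ((f \<star> g) \<star> h) \<bullet> \<alpha>' (src f) (src g) (src h)"
proof (rule inverses_cancel_left)
  show "inverses (\<alpha> (trg f) (trg g) (trg h)) (\<alpha>' (trg f) (trg g) (trg h))"
    using assms by (simp add: inverses_\<alpha>)
  show "\<alpha> (trg f) (trg g) (trg h) \<bullet> (\<alpha>' (trg f) (trg g) (trg h) \<bullet> (f \<star> (g \<star> h))) =
      \<alpha> (trg f) (trg g) (trg h) \<bullet> (((f \<star> g) \<star> h) \<bullet> \<alpha>' (src f) (src g) (src h))"
    using assms by (simp add: reassoc [OF \<alpha>_natural])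
qed (use assms in auto)

lemma \<alpha>_natural_whisker:
  assumes "arr f" "obj a" "obj b"
  shows "x = trg f \<Longrightarrow> \<alpha> x a b \<bullet> ((f \<lhd> a) \<lhd> b) = (f \<lhd> (a \<otimes> b)) \<bullet> \<alpha> (src f) a b"
    "x = trg f \<Longrightarrow> \<alpha> a x b \<bullet> ((a \<rhd> f) \<lhd> b) = (a \<rhd> (f \<lhd> b)) \<bullet> \<alpha> a (src f) b"
    "x = trg f \<Longrightarrow> \<alpha> a b x \<bullet> ((a \<otimes> b) \<rhd> f) = (a \<rhd> (b \<rhd> f)) \<bullet> \<alpha> a b (src f)"
  using assms \<alpha>_natural [of f "ide a" "ide b"] \<alpha>_natural [of "ide a" f "ide b"]
    \<alpha>_natural [of "ide a" "ide b" f] by simp_all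

lemma \<alpha>'_natural_whisker:
  assumes "arr f" "obj a" "obj b"
  shows "x = trg f \<Longrightarrow> \<alpha>' x a b \<bullet> (f \<lhd> (a \<otimes> b)) = ((f \<lhd> a) \<lhd> b) \<bullet> \<alpha>' (src f) a b"
    "x = trg f \<Longrightarrow> \<alpha>' a x b \<bullet> (a \<rhd> (f \<lhd> b)) = ((a \<rhd> f) \<lhd> b) \<bullet> \<alpha>' a (src f) b"
    "x = trg f \<Longrightarrow> \<alpha>' a b x \<bullet> (a \<rhd> (b \<rhd> f)) = ((a \<otimes> b) \<rhd> f) \<bullet> \<alpha>' a b (src f)"
  using assms \<alpha>'_natural [of f "ide a" "ide b"] \<alpha>'_natural [of "ide a" f "ide b"]
    \<alpha>'_natural [of "ide a" "ide b" f] by simp_all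

lemma lu_natural: "arr f \<Longrightarrow> b = trg f \<Longrightarrow> lu b \<bullet> (\<one> \<rhd> f) = f \<bullet> lu (src f)"
  using Lun_natural [of "src f" "trg f" "mor f"]
  by (intro arrow_eqI) (auto simp: mor_in_Hom)

lemma lu'_natural: "arr f \<Longrightarrow> b = trg f \<Longrightarrow> lu' b \<bullet> f = (\<one> \<rhd> f) \<bullet> lu' (src f)"
  by (rule inverses_cancel_left [OF inverses_lu [of "trg f"]]) (simp_all add: reassoc [OF lu_natural])

lemma ru_natural: "arr f \<Longrightarrow> b = trg f \<Longrightarrow> ru b \<bullet> (f \<lhd> \<one>) = f \<bullet> ru (src f)"
  using Run_natural [of "src f" "trg f" "mor f"]
  by (intro arrow_eqI) (auto simp: mor_in_Hom)

lemma pentagon_\<alpha>: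
  assumes "obj a" "obj b" "obj c" "obj d"
  shows "(a \<rhd> \<alpha> b c d) \<bullet> \<alpha> a (b \<otimes> c) d \<bullet> (\<alpha> a b c \<lhd> d) = \<alpha> a b (c \<otimes> d) \<bullet> \<alpha> (a \<otimes> b) c d"
  using assms pentagon [of a b c d] by (intro arrow_eqI) auto

lemma pentagon_\<alpha>':
  assumes [simp]: "obj a" "obj b" "obj c" "obj d"
  shows "\<alpha> (a \<otimes> b) c d \<bullet> (\<alpha>' a b c \<lhd> d) \<bullet> \<alpha>' a (b \<otimes> c) d = \<alpha>' a b (c \<otimes> d) \<bullet> (a \<rhd> \<alpha> b c d)"
proof -
  have "\<alpha> a b (c \<otimes> d) \<bullet> \<alpha> (a \<otimes> b) c d \<bullet> (\<alpha>' a b c \<lhd> d) \<bullet> \<alpha>' a (b \<otimes> c) d = a \<rhd> \<alpha> b c d"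
    by (simp add: reassoc [OF pentagon_\<alpha> [symmetric]])
  then have "\<alpha>' a b (c \<otimes> d) \<bullet> \<alpha> a b (c \<otimes> d) \<bullet> \<alpha> (a \<otimes> b) c d \<bullet> (\<alpha>' a b c \<lhd> d) \<bullet> \<alpha>' a (b \<otimes> c) d =
      \<alpha>' a b (c \<otimes> d) \<bullet> (a \<rhd> \<alpha> b c d)"
    by (rule arg_cong)
  then show ?thesis by simp
qed

lemma triangle_\<alpha>:
  assumes "obj a" "obj b"
  shows "(a \<rhd> lu b) \<bullet> \<alpha> a \<one> b = ru a \<lhd> b"
  using assms triangle [of a b] by (intro arrow_eqI) auto

section \<open>Coherence for the unit\<close>

lemma unit_whisker_left_faithful:
  assumes "arr f" "arr g" "src f = src g" "trg f = trg g" "\<one> \<rhd> f = \<one> \<rhd> g"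
  shows "f = g"
proof (rule inverses_cancel_right [OF inverses_lu [of "src f"]])
  show "f \<bullet> lu (src f) = g \<bullet> lu (src f)"
    using lu_natural [of f "trg f"] lu_natural [of g "trg g"] assms by simp
qed (use assms in simp_all)

lemma unit_whisker_right_faithful:
  assumes "arr f" "arr g" "src f = src g" "trg f = trg g" "f \<lhd> \<one> = g \<lhd> \<one>"
  shows "f = g"
proof (rule inverses_cancel_right [OF inverses_ru [of "src f"]])
  show "f \<bullet> ru (src f) = g \<bullet> ru (src f)"
    using ru_natural [of f "trg f"] ru_natural [of g "trg g"] assms by simp
qed (use assms in simp_all)

text \<open>
  Kelly's consequences of the pentagon and the triangle: tensoring with the unit is faithful, so each
  equation may be checked with one more unit factor, where the pentagon applies.
\<close>

lemma lu_tens: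
  assumes [simp]: "obj a" "obj b"
  shows "lu (a \<otimes> b) \<bullet> \<alpha> \<one> a b = lu a \<lhd> b"
proof (rule unit_whisker_left_faithful)
  let ?x = "\<alpha> \<one> (\<one> \<otimes> a) b \<bullet> (\<alpha> \<one> \<one> a \<lhd> b)"
  have inv: "inverses ?x ((\<alpha>' \<one> \<one> a \<lhd> b) \<bullet> \<alpha>' \<one> (\<one> \<otimes> a) b)"
    by (rule inverses_trans) (simp_all add: inverses_\<alpha> inverses_whisker)
  have "(\<one> \<rhd> (lu (a \<otimes> b) \<bullet> \<alpha> \<one> a b)) \<bullet> ?x =
      (\<one> \<rhd> lu (a \<otimes> b)) \<bullet> \<alpha> \<one> \<one> (a \<otimes> b) \<bullet> \<alpha> (\<one> \<otimes> \<one>) a b"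
    by (simp add: pentagon_\<alpha>)
  also have "\<dots> = (ru \<one> \<lhd> (a \<otimes> b)) \<bullet> \<alpha> (\<one> \<otimes> \<one>) a b"
    by (simp add: reassoc [OF triangle_\<alpha>])
  also have "\<dots> = \<alpha> \<one> a b \<bullet> ((ru \<one> \<lhd> a) \<lhd> b)"
    by (simp add: \<alpha>_natural_whisker)
  also have "\<dots> = \<alpha> \<one> a b \<bullet> (((\<one> \<rhd> lu a) \<bullet> \<alpha> \<one> \<one> a) \<lhd> b)"
    by (simp only: triangle_\<alpha> Unit_in_Ob assms)
  also have "\<dots> = (\<one> \<rhd> (lu a \<lhd> b)) \<bullet> ?x"
    by (simp add: reassoc [OF \<alpha>_natural_whisker(2)])
  finally show "\<one> \<rhd> (lu (a \<otimes> b) \<bullet> \<alpha> \<one> a b) = \<one> \<rhd> (lu a \<lhd> b)"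
    by (rule inverses_cancel_right [OF inv]) simp_all
qed simp_all

lemma ru_tens:
  assumes [simp]: "obj a" "obj b"
  shows "(a \<rhd> ru b) \<bullet> \<alpha> a b \<one> = ru (a \<otimes> b)"
proof (rule unit_whisker_right_faithful)
  have "\<alpha> a b \<one> \<bullet> (((a \<rhd> ru b) \<bullet> \<alpha> a b \<one>) \<lhd> \<one>) =
      (a \<rhd> (ru b \<lhd> \<one>)) \<bullet> \<alpha> a (b \<otimes> \<one>) \<one> \<bullet> (\<alpha> a b \<one> \<lhd> \<one>)"
    by (simp add: reassoc [OF \<alpha>_natural_whisker(2)])
  also have "\<dots> = (a \<rhd> (b \<rhd> lu \<one>)) \<bullet> (a \<rhd> \<alpha> b \<one> \<one>) \<bullet> \<alpha> a (b \<otimes> \<one>) \<one> \<bullet> (\<alpha> a b \<one> \<lhd> \<one>)"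
    by (simp flip: triangle_\<alpha>)
  also have "\<dots> = (a \<rhd> (b \<rhd> lu \<one>)) \<bullet> \<alpha> a b (\<one> \<otimes> \<one>) \<bullet> \<alpha> (a \<otimes> b) \<one> \<one>"
    by (simp add: pentagon_\<alpha>)
  also have "\<dots> = \<alpha> a b \<one> \<bullet> ((a \<otimes> b) \<rhd> lu \<one>) \<bullet> \<alpha> (a \<otimes> b) \<one> \<one>"
    by (simp add: reassoc [OF \<alpha>_natural_whisker(3)])
  also have "\<dots> = \<alpha> a b \<one> \<bullet> (ru (a \<otimes> b) \<lhd> \<one>)"
    by (simp add: triangle_\<alpha>)
  finally show "((a \<rhd> ru b) \<bullet> \<alpha> a b \<one>) \<lhd> \<one> = ru (a \<otimes> b) \<lhd> \<one>"
    by (rule inverses_cancel_left [OF inverses_\<alpha> [OF assms Unit_in_Ob]]) simp_all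
qed simp_all

lemma lu_unit: "lu \<one> = ru \<one>"
proof (rule unit_whisker_right_faithful)
  have "lu (\<one> \<otimes> \<one>) = \<one> \<rhd> lu \<one>"
    by (rule inverses_cancel_left [OF inverses_lu [of \<one>]]) (simp_all add: lu_natural)
  then show "lu \<one> \<lhd> \<one> = ru \<one> \<lhd> \<one>"
    by (simp flip: lu_tens triangle_\<alpha>)
qed simp_all

section \<open>Right-nested form\<close>

text \<open>
  All objects are written nested to the right, as in \<open>a \<otimes> (b \<otimes> x)\<close>.  A morphism that consumes the two
  leftmost factors then acts through \<open>lift\<close>, and in terms of \<open>lift\<close> the diagrams below contain
  hardly any associativity constraints.
\<close>

definition lift :: "'o \<Rightarrow> 'o \<Rightarrow> 'o \<Rightarrow> ('o, 'm) arrow \<Rightarrow> ('o, 'm) arrow" where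
  "lift a b x f = (f \<lhd> x) \<bullet> \<alpha>' a b x"

lemma lift_simps [simp]:
  assumes "obj a" "obj b" "obj x" "arr f" "src f = a \<otimes> b"
  shows "arr (lift a b x f)" "src (lift a b x f) = a \<otimes> (b \<otimes> x)" "trg (lift a b x f) = trg f \<otimes> x"
  using assms by (simp_all add: lift_def)

lemma lift_\<alpha>:
  assumes "obj a" "obj b" "obj x" "arr f" "src f = a \<otimes> b"
  shows "lift a b x f \<bullet> \<alpha> a b x = f \<lhd> x"
  using assms by (simp add: lift_def)

lemma lift_comp:
  assumes "obj a" "obj b" "obj x" "arr f" "src f = a \<otimes> b" "arr h" "src h = trg f"
  shows "lift a b x (h \<bullet> f) = (h \<lhd> x) \<bullet> lift a b x f"
  using assms by (simp add: lift_def)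

lemma lift_comp_left:
  assumes "obj a" "obj x" "arr f" "arr g" "src f = a \<otimes> trg g" "b = src g"
  shows "lift a b x (f \<bullet> (a \<rhd> g)) = lift a (trg g) x f \<bullet> (a \<rhd> (g \<lhd> x))"
  using assms by (simp add: lift_def \<alpha>'_natural_whisker)

lemma lift_comp_right:
  assumes "obj b" "obj x" "arr f" "arr g" "src f = trg g \<otimes> b" "a = src g"
  shows "lift a b x (f \<bullet> (g \<lhd> b)) = lift (trg g) b x f \<bullet> (g \<lhd> (b \<otimes> x))"
  using assms by (simp add: lift_def \<alpha>'_natural_whisker)

lemma lift_natural:
  assumes "obj a" "obj b" "arr f" "arr g" "src f = a \<otimes> b" "x = trg g"
  shows "lift a b x f \<bullet> (a \<rhd> (b \<rhd> g)) = (trg f \<rhd> g) \<bullet> lift a b (src g) f"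
  using assms by (simp add: lift_def \<alpha>'_natural_whisker reassoc [OF slide])

text \<open>The pentagon, with \<open>f\<close> applied to its two leftmost factors.\<close>

lemma lift_assoc:
  assumes [simp]: "obj a" "obj b" "obj x" "obj y" "arr f" "src f = a \<otimes> b" "c = trg f"
  shows "\<alpha> c x y \<bullet> (lift a b x f \<lhd> y) = lift a b (x \<otimes> y) f \<bullet> (a \<rhd> \<alpha> b x y) \<bullet> \<alpha> a (b \<otimes> x) y"
proof (rule inverses_cancel_right [OF inverses_whisker(2) [OF inverses_\<alpha> [of a b x]]])
  show "(\<alpha> c x y \<bullet> (lift a b x f \<lhd> y)) \<bullet> (\<alpha> a b x \<lhd> y) =
      (lift a b (x \<otimes> y) f \<bullet> (a \<rhd> \<alpha> b x y) \<bullet> \<alpha> a (b \<otimes> x) y) \<bullet> (\<alpha> a b x \<lhd> y)"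
    by (simp add: lift_def pentagon_\<alpha> \<alpha>_natural_whisker)
qed simp_all

lemma lift_reassoc:
  assumes [simp]: "obj a" "obj b" "obj c" "obj x" "arr f" "src f = a \<otimes> (b \<otimes> c)"
  shows "lift (a \<otimes> b) c x (f \<bullet> \<alpha> a b c) = lift a (b \<otimes> c) x f \<bullet> (a \<rhd> \<alpha>' b c x) \<bullet> \<alpha> a b (c \<otimes> x)"
proof (rule inverses_cancel_right [OF inverses_\<alpha> [of "a \<otimes> b" c x]])
  show "lift (a \<otimes> b) c x (f \<bullet> \<alpha> a b c) \<bullet> \<alpha> (a \<otimes> b) c x =
      (lift a (b \<otimes> c) x f \<bullet> (a \<rhd> \<alpha>' b c x) \<bullet> \<alpha> a b (c \<otimes> x)) \<bullet> \<alpha> (a \<otimes> b) c x"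
    by (simp add: lift_\<alpha>) (simp add: lift_def flip: pentagon_\<alpha>)
qed simp_all

end

section \<open>The braiding in right-nested form\<close>

context braided_category
begin

definition R :: "'o \<Rightarrow> 'o \<Rightarrow> ('o, 'm) arrow" where
  "R a b = Arrow (a \<otimes> b) (b \<otimes> a) (Braid C a b)"

definition R' :: "'o \<Rightarrow> 'o \<Rightarrow> ('o, 'm) arrow" where
  "R' a b = Arrow (b \<otimes> a) (a \<otimes> b) (inv_mor C (a \<otimes> b) (b \<otimes> a) (Braid C a b))"

lemma inverses_R: "obj a \<Longrightarrow> obj b \<Longrightarrow> inverses (R a b) (R' a b)"
  unfolding R_def R'_def by (rule is_iso_inverses) (rule Braid_iso)

lemma R_simps [simp]:
  "src (R a b) = a \<otimes> b" "trg (R a b) = b \<otimes> a" "src (R' a b) = b \<otimes> a" "trg (R' a b) = a \<otimes> b"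
  "mor (R a b) = Braid C a b" "mor (R' a b) = inv_mor C (a \<otimes> b) (b \<otimes> a) (Braid C a b)"
  "obj a \<Longrightarrow> obj b \<Longrightarrow> arr (R a b)" "obj a \<Longrightarrow> obj b \<Longrightarrow> arr (R' a b)"
  using inverses_ends [OF inverses_R] by (simp_all add: R_def R'_def)

lemma R_cancel [simp]:
  assumes "obj a" "obj b"
  shows "R a b \<bullet> R' a b = ide (b \<otimes> a)" "R' a b \<bullet> R a b = ide (a \<otimes> b)"
    "arr x \<Longrightarrow> trg x = b \<otimes> a \<Longrightarrow> R a b \<bullet> (R' a b \<bullet> x) = x"
    "arr x \<Longrightarrow> trg x = a \<otimes> b \<Longrightarrow> R' a b \<bullet> (R a b \<bullet> x) = x"
  using inverses_comp [OF inverses_R [OF assms]] by simp_all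

lemma R_natural:
  assumes "arr f" "arr g"
  shows "R (trg f) (trg g) \<bullet> (f \<star> g) = (g \<star> f) \<bullet> R (src f) (src g)"
  using assms Braid_natural [of "src f" "trg f" "src g" "trg g" "mor f" "mor g"]
  by (intro arrow_eqI) (auto simp: mor_in_Hom)

lemma R_natural_whisker:
  assumes "arr f" "obj a" "x = trg f"
  shows "R x a \<bullet> (f \<lhd> a) = (a \<rhd> f) \<bullet> R (src f) a" "R a x \<bullet> (a \<rhd> f) = (f \<lhd> a) \<bullet> R a (src f)"
  using assms R_natural [of f "ide a"] R_natural [of "ide a" f] by simp_all

lemma hexagon1_R:
  assumes "obj a" "obj b" "obj c"
  shows "\<alpha> b c a \<bullet> R a (b \<otimes> c) \<bullet> \<alpha> a b c = (b \<rhd> R a c) \<bullet> \<alpha> b a c \<bullet> (R a b \<lhd> c)"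
  using assms hexagon1 [of a b c] by (intro arrow_eqI) auto

lemma hexagon2_R:
  assumes "obj a" "obj b" "obj c"
  shows "\<alpha>' c a b \<bullet> R (a \<otimes> b) c \<bullet> \<alpha>' a b c = (R a c \<lhd> b) \<bullet> \<alpha>' a c b \<bullet> (a \<rhd> R b c)"
  using assms hexagon2 [of a b c] by (intro arrow_eqI) auto

text \<open>
  Braiding with the unit is trivial: in a hexagon whose middle factor is the unit, the two braidings
  of the outer objects cancel by naturality.
\<close>

lemma lu_R:
  assumes [simp]: "obj a"
  shows "lu a \<bullet> R a \<one> = ru a"
proof (rule unit_whisker_right_faithful)
  have "R a \<one> \<bullet> ((lu a \<bullet> R a \<one>) \<lhd> \<one>) = R a \<one> \<bullet> lu (a \<otimes> \<one>) \<bullet> \<alpha> \<one> a \<one> \<bullet> (R a \<one> \<lhd> \<one>)"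
    by (simp add: reassoc [OF lu_tens])
  also have "\<dots> = lu (\<one> \<otimes> a) \<bullet> (\<one> \<rhd> R a \<one>) \<bullet> \<alpha> \<one> a \<one> \<bullet> (R a \<one> \<lhd> \<one>)"
    by (simp add: reassoc [OF lu_natural])
  also have "\<dots> = lu (\<one> \<otimes> a) \<bullet> \<alpha> \<one> \<one> a \<bullet> R a (\<one> \<otimes> \<one>) \<bullet> \<alpha> a \<one> \<one>"
    by (simp add: hexagon1_R)
  also have "\<dots> = R a \<one> \<bullet> (a \<rhd> lu \<one>) \<bullet> \<alpha> a \<one> \<one>"
    by (simp add: reassoc [OF lu_tens] reassoc [OF R_natural_whisker(2)])
  also have "\<dots> = R a \<one> \<bullet> (ru a \<lhd> \<one>)"
    by (simp add: triangle_\<alpha>)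
  finally show "(lu a \<bullet> R a \<one>) \<lhd> \<one> = ru a \<lhd> \<one>"
    by (rule inverses_cancel_left [OF inverses_R [OF assms Unit_in_Ob]]) simp_all
qed simp_all

lemma ru_R:
  assumes [simp]: "obj c"
  shows "ru c \<bullet> R \<one> c = lu c"
proof (rule unit_whisker_left_faithful)
  have "R \<one> c \<bullet> (\<one> \<rhd> (ru c \<bullet> R \<one> c)) =
      R \<one> c \<bullet> (\<one> \<rhd> ru c) \<bullet> \<alpha> \<one> c \<one> \<bullet> \<alpha>' \<one> c \<one> \<bullet> (\<one> \<rhd> R \<one> c)"
    by simp
  also have "\<dots> = R \<one> c \<bullet> ru (\<one> \<otimes> c) \<bullet> \<alpha>' \<one> c \<one> \<bullet> (\<one> \<rhd> R \<one> c)"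
    by (simp only: reassoc [OF ru_tens] Unit_in_Ob assms)
  also have "\<dots> = ru (c \<otimes> \<one>) \<bullet> (R \<one> c \<lhd> \<one>) \<bullet> \<alpha>' \<one> c \<one> \<bullet> (\<one> \<rhd> R \<one> c)"
    by (simp add: reassoc [OF ru_natural])
  also have "\<dots> = ru (c \<otimes> \<one>) \<bullet> \<alpha>' c \<one> \<one> \<bullet> R (\<one> \<otimes> \<one>) c \<bullet> \<alpha>' \<one> \<one> c"
    by (simp add: hexagon2_R)
  also have "\<dots> = (c \<rhd> ru \<one>) \<bullet> R (\<one> \<otimes> \<one>) c \<bullet> \<alpha>' \<one> \<one> c"
    by (simp flip: ru_tens)
  also have "\<dots> = R \<one> c \<bullet> (ru \<one> \<lhd> c) \<bullet> \<alpha>' \<one> \<one> c"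
    by (simp add: reassoc [OF R_natural_whisker(1)])
  also have "\<dots> = R \<one> c \<bullet> (\<one> \<rhd> lu c)"
    by (simp flip: triangle_\<alpha>)
  finally show "\<one> \<rhd> (ru c \<bullet> R \<one> c) = \<one> \<rhd> lu c"
    by (rule inverses_cancel_left [OF inverses_R [OF Unit_in_Ob assms]]) simp_all
qed simp_all

text \<open>The braiding of the two leftmost factors, \<open>a \<otimes> (b \<otimes> x) \<rightarrow> b \<otimes> (a \<otimes> x)\<close>.\<close>

definition B :: "'o \<Rightarrow> 'o \<Rightarrow> 'o \<Rightarrow> ('o, 'm) arrow" where
  "B a b x = \<alpha> b a x \<bullet> lift a b x (R a b)"

lemma B_simps [simp]:
  assumes "obj a" "obj b" "obj x"
  shows "arr (B a b x)" "src (B a b x) = a \<otimes> (b \<otimes> x)" "trg (B a b x) = b \<otimes> (a \<otimes> x)"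
  using assms by (simp_all add: B_def)

lemma inverses_B:
  assumes "obj a" "obj b" "obj x"
  shows "inverses (B a b x) ((\<alpha> a b x \<bullet> (R' a b \<lhd> x)) \<bullet> \<alpha>' b a x)"
  unfolding B_def lift_def using assms
  by (intro inverses_trans inverses_\<alpha> inverses_whisker(2) inverses_R inverses_sym [OF inverses_\<alpha>]) simp_all

lemma B_natural:
  assumes "arr g" "obj a" "obj b" "y = trg g"
  shows "B a b y \<bullet> (a \<rhd> (b \<rhd> g)) = (b \<rhd> (a \<rhd> g)) \<bullet> B a b (src g)"
    "B a y b \<bullet> (a \<rhd> (g \<lhd> b)) = (g \<lhd> (a \<otimes> b)) \<bullet> B a (src g) b"
    "B y a b \<bullet> (g \<lhd> (a \<otimes> b)) = (a \<rhd> (g \<lhd> b)) \<bullet> B (src g) a b"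
proof -
  note [simp] = assms
  show "B a b y \<bullet> (a \<rhd> (b \<rhd> g)) = (b \<rhd> (a \<rhd> g)) \<bullet> B a b (src g)"
    by (simp add: B_def lift_natural reassoc [OF \<alpha>_natural_whisker(3)])
  have "B a y b \<bullet> (a \<rhd> (g \<lhd> b)) = \<alpha> y a b \<bullet> lift a (src g) b (R a y \<bullet> (a \<rhd> g))"
    by (simp add: B_def lift_comp_left)
  also have "\<dots> = (g \<lhd> (a \<otimes> b)) \<bullet> B a (src g) b"
    by (simp add: R_natural_whisker lift_comp B_def reassoc [OF \<alpha>_natural_whisker(1)])
  finally show "B a y b \<bullet> (a \<rhd> (g \<lhd> b)) = (g \<lhd> (a \<otimes> b)) \<bullet> B a (src g) b" .
  have "B y a b \<bullet> (g \<lhd> (a \<otimes> b)) = \<alpha> a y b \<bullet> lift (src g) a b (R y a \<bullet> (g \<lhd> a))"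
    by (simp add: B_def lift_comp_right)
  also have "\<dots> = (a \<rhd> (g \<lhd> b)) \<bullet> B (src g) a b"
    by (simp add: R_natural_whisker lift_comp B_def reassoc [OF \<alpha>_natural_whisker(2)])
  finally show "B y a b \<bullet> (g \<lhd> (a \<otimes> b)) = (a \<rhd> (g \<lhd> b)) \<bullet> B (src g) a b" .
qed

lemma B_assoc:
  assumes [simp]: "obj a" "obj b" "obj x" "obj y"
  shows "(b \<rhd> \<alpha> a x y) \<bullet> \<alpha> b (a \<otimes> x) y \<bullet> (B a b x \<lhd> y) =
    B a b (x \<otimes> y) \<bullet> (a \<rhd> \<alpha> b x y) \<bullet> \<alpha> a (b \<otimes> x) y"
proof -
  have "(b \<rhd> \<alpha> a x y) \<bullet> \<alpha> b (a \<otimes> x) y \<bullet> (B a b x \<lhd> y) =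
      \<alpha> b a (x \<otimes> y) \<bullet> \<alpha> (b \<otimes> a) x y \<bullet> (lift a b x (R a b) \<lhd> y)"
    by (simp add: B_def reassoc3 [OF pentagon_\<alpha>])
  then show ?thesis
    by (simp add: lift_assoc B_def)
qed

text \<open>The two hexagons, read on three leftmost factors of a right-nested object.\<close>

lemma B_hexagon1:
  assumes [simp]: "obj a" "obj b" "obj c" "obj x"
  shows "\<alpha> b c (a \<otimes> x) \<bullet> B a (b \<otimes> c) x = (b \<rhd> B a c x) \<bullet> B a b (c \<otimes> x) \<bullet> (a \<rhd> \<alpha> b c x)"
proof (rule inverses_cancel_right [OF inverses_\<alpha> [of a "b \<otimes> c" x]])
  have hex: "\<alpha> b c a \<bullet> R a (b \<otimes> c) = (b \<rhd> R a c) \<bullet> B a b c"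
  proof (rule inverses_cancel_right [OF inverses_\<alpha> [of a b c]])
    show "(\<alpha> b c a \<bullet> R a (b \<otimes> c)) \<bullet> \<alpha> a b c = ((b \<rhd> R a c) \<bullet> B a b c) \<bullet> \<alpha> a b c"
      by (simp add: hexagon1_R B_def lift_\<alpha>)
  qed simp_all
  have "(\<alpha> b c (a \<otimes> x) \<bullet> B a (b \<otimes> c) x) \<bullet> \<alpha> a (b \<otimes> c) x =
      \<alpha> b c (a \<otimes> x) \<bullet> \<alpha> (b \<otimes> c) a x \<bullet> (R a (b \<otimes> c) \<lhd> x)"
    by (simp add: B_def lift_\<alpha>)
  also have "\<dots> = (b \<rhd> \<alpha> c a x) \<bullet> \<alpha> b (c \<otimes> a) x \<bullet> ((\<alpha> b c a \<bullet> R a (b \<otimes> c)) \<lhd> x)"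
    by (simp add: reassoc3 [OF pentagon_\<alpha>])
  also have "\<dots> = (b \<rhd> \<alpha> c a x) \<bullet> (b \<rhd> (R a c \<lhd> x)) \<bullet> \<alpha> b (a \<otimes> c) x \<bullet> (B a b c \<lhd> x)"
    by (simp add: hex reassoc [OF \<alpha>_natural_whisker(2)])
  also have "\<dots> = (b \<rhd> B a c x) \<bullet> (b \<rhd> \<alpha> a c x) \<bullet> \<alpha> b (a \<otimes> c) x \<bullet> (B a b c \<lhd> x)"
    by (simp add: B_def lift_def)
  also have "\<dots> = ((b \<rhd> B a c x) \<bullet> B a b (c \<otimes> x) \<bullet> (a \<rhd> \<alpha> b c x)) \<bullet> \<alpha> a (b \<otimes> c) x"
    by (simp add: B_assoc)
  finally show "(\<alpha> b c (a \<otimes> x) \<bullet> B a (b \<otimes> c) x) \<bullet> \<alpha> a (b \<otimes> c) x = \<dots>" .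
qed simp_all

lemma R_hexagon2:
  assumes [simp]: "obj a" "obj b" "obj c"
  shows "R (a \<otimes> b) c = B a c b \<bullet> (a \<rhd> R b c) \<bullet> \<alpha> a b c"
proof -
  have "R (a \<otimes> b) c = \<alpha> c a b \<bullet> (\<alpha>' c a b \<bullet> R (a \<otimes> b) c \<bullet> \<alpha>' a b c) \<bullet> \<alpha> a b c"
    by simp
  also have "\<dots> = B a c b \<bullet> (a \<rhd> R b c) \<bullet> \<alpha> a b c"
    by (simp add: hexagon2_R B_def lift_def)
  finally show ?thesis .
qed

lemma B_hexagon2:
  assumes [simp]: "obj a" "obj b" "obj c" "obj x"
  shows "(c \<rhd> \<alpha> a b x) \<bullet> B (a \<otimes> b) c x = B a c (b \<otimes> x) \<bullet> (a \<rhd> B b c x) \<bullet> \<alpha> a b (c \<otimes> x)"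
proof (rule inverses_cancel_right [OF inverses_\<alpha> [of "a \<otimes> b" c x]])
  have "((c \<rhd> \<alpha> a b x) \<bullet> B (a \<otimes> b) c x) \<bullet> \<alpha> (a \<otimes> b) c x =
      (c \<rhd> \<alpha> a b x) \<bullet> \<alpha> c (a \<otimes> b) x \<bullet> (B a c b \<lhd> x) \<bullet> ((a \<rhd> R b c) \<lhd> x) \<bullet> (\<alpha> a b c \<lhd> x)"
    by (simp add: B_def [of "a \<otimes> b"] lift_\<alpha> R_hexagon2)
  also have "\<dots> = B a c (b \<otimes> x) \<bullet> (a \<rhd> \<alpha> c b x) \<bullet> (a \<rhd> (R b c \<lhd> x)) \<bullet> \<alpha> a (b \<otimes> c) x \<bullet> (\<alpha> a b c \<lhd> x)"
    by (simp add: reassoc3 [OF B_assoc] reassoc [OF \<alpha>_natural_whisker(2)])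
  also have "\<dots> = B a c (b \<otimes> x) \<bullet> (a \<rhd> B b c x) \<bullet> (a \<rhd> \<alpha> b c x) \<bullet> \<alpha> a (b \<otimes> c) x \<bullet> (\<alpha> a b c \<lhd> x)"
    by (simp add: B_def [of b] lift_def)
  also have "\<dots> = (B a c (b \<otimes> x) \<bullet> (a \<rhd> B b c x) \<bullet> \<alpha> a b (c \<otimes> x)) \<bullet> \<alpha> (a \<otimes> b) c x"
    by (simp add: pentagon_\<alpha>)
  finally show "((c \<rhd> \<alpha> a b x) \<bullet> B (a \<otimes> b) c x) \<bullet> \<alpha> (a \<otimes> b) c x = \<dots>" .
qed simp_all

text \<open>Moving \<open>v\<close> past the result of \<open>f: a \<otimes> b \<rightarrow> c\<close> is moving it past \<open>b\<close> and then past \<open>a\<close>: naturality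
  and the second hexagon.\<close>

lemma B_lift:
  assumes [simp]: "obj a" "obj b" "obj v" "obj x" "arr f" "src f = a \<otimes> b"
  shows "B (trg f) v x \<bullet> lift a b (v \<otimes> x) f = (v \<rhd> lift a b x f) \<bullet> B a v (b \<otimes> x) \<bullet> (a \<rhd> B b v x)"
proof -
  have "B (trg f) v x \<bullet> lift a b (v \<otimes> x) f =
      (v \<rhd> lift a b x f) \<bullet> ((v \<rhd> \<alpha> a b x) \<bullet> B (a \<otimes> b) v x) \<bullet> \<alpha>' a b (v \<otimes> x)"
    by (simp add: lift_def reassoc [OF B_natural(3)])
  then show ?thesis
    by (simp only: B_hexagon2 assms) simp
qed

end

section \<open>The algebra and its modules\<close>

locale commutative_algebra = abelian_category C + braided_category C
  for C :: "('o, 'm::ab_group_add, 'z) bal_cat_scheme" (structure) +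
  fixes A :: "('o, 'm, 'w) alg_scheme"
  assumes algebra: "C_algebra C A"
begin

abbreviation K :: 'o where "K \<equiv> Car A"

abbreviation Mod :: "('o \<times> 'm) set" where "Mod \<equiv> Ob (Rep C A)"

abbreviation HomA :: "'o \<times> 'm \<Rightarrow> 'o \<times> 'm \<Rightarrow> 'm set" where "HomA \<equiv> Hom (Rep C A)"

abbreviation tensor_over :: "'o \<times> 'm \<Rightarrow> 'o \<times> 'm \<Rightarrow> 'o \<times> 'm"  (infixl "\<odot>" 75) where
  "X \<odot> Y \<equiv> tensA C A X Y"

abbreviation F :: "'o \<Rightarrow> 'o \<times> 'm" where "F \<equiv> F_ob C A"

abbreviation Q :: "'o \<times> 'm \<Rightarrow> 'o \<times> 'm \<Rightarrow> 'o" where "Q \<equiv> quot_ob C A"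

definition \<mu> :: "('o, 'm) arrow" where "\<mu> = Arrow (K \<otimes> K) K (Mul A)"

definition \<iota> :: "('o, 'm) arrow" where "\<iota> = Arrow \<one> K (Iota A)"

lemma K_object [simp]: "obj K"
  using algebra by (simp add: C_algebra_def)

lemma \<mu>_\<iota>_simps [simp]:
  "arr \<mu>" "src \<mu> = K \<otimes> K" "trg \<mu> = K" "mor \<mu> = Mul A"
  "arr \<iota>" "src \<iota> = \<one>" "trg \<iota> = K" "mor \<iota> = Iota A"
  using algebra by (simp_all add: C_algebra_def is_mono_def \<mu>_def \<iota>_def)

lemma \<mu>_laws:
  shows \<mu>_assoc: "\<mu> \<bullet> (\<mu> \<lhd> K) = \<mu> \<bullet> (K \<rhd> \<mu>) \<bullet> \<alpha> K K K"
    and \<mu>_comm: "\<mu> \<bullet> R K K = \<mu>"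
    and \<mu>_unit_left: "\<mu> \<bullet> (\<iota> \<lhd> K) = lu K"
  using algebra by (auto intro!: arrow_eqI simp: C_algebra_def)

lemma \<mu>_unit_right: "\<mu> \<bullet> (K \<rhd> \<iota>) = ru K"
proof -
  have "\<mu> \<bullet> (K \<rhd> \<iota>) = (\<mu> \<bullet> R K K) \<bullet> (K \<rhd> \<iota>)"
    by (simp only: \<mu>_comm)
  also have "\<dots> = \<mu> \<bullet> (\<iota> \<lhd> K) \<bullet> R K \<one>"
    by (simp add: R_natural_whisker)
  also have "\<dots> = ru K"
    by (simp add: reassoc [OF \<mu>_unit_left] lu_R)
  finally show ?thesis .
qed

text \<open>The module axioms, with the associativity constraint absorbed into \<open>lift\<close>.\<close>

definition is_action :: "('o, 'm) arrow \<Rightarrow> bool" where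
  "is_action m \<longleftrightarrow> arr m \<and> src m = K \<otimes> trg m \<and>
    m \<bullet> lift K K (trg m) \<mu> = m \<bullet> (K \<rhd> m) \<and> m \<bullet> (\<iota> \<lhd> trg m) = lu (trg m)"

definition act :: "'o \<times> 'm \<Rightarrow> ('o, 'm) arrow" where
  "act X = Arrow (K \<otimes> fst X) (fst X) (snd X)"

lemma is_actionD:
  assumes "is_action m"
  shows "arr m" "src m = K \<otimes> trg m" "m \<bullet> (\<iota> \<lhd> trg m) = lu (trg m)"
    "m \<bullet> lift K K (trg m) \<mu> = m \<bullet> (K \<rhd> m)"
  using assms by (simp_all add: is_action_def)

lemma Rep_Ob_iff: "X \<in> Mod \<longleftrightarrow> fst X \<in> Ob C \<and> is_action (act X)"
proof (cases X)
  case (Pair V m)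
  let ?m = "Arrow (K \<otimes> V) V m"
  have "m \<cdot> (Mul A \<boxtimes> Id C V) = m \<cdot> (Id C K \<boxtimes> m) \<cdot> Assoc C K K V \<longleftrightarrow>
      ?m \<bullet> lift K K V \<mu> = ?m \<bullet> (K \<rhd> ?m)" (is "?l \<longleftrightarrow> ?r") if [simp]: "obj V" "m \<in> Hom C (K \<otimes> V) V"
  proof -
    have "?l \<longleftrightarrow> mor (?m \<bullet> (\<mu> \<lhd> V)) = mor (?m \<bullet> (K \<rhd> ?m) \<bullet> \<alpha> K K V)"
      by simp
    also have "\<dots> \<longleftrightarrow> ?m \<bullet> (\<mu> \<lhd> V) = ?m \<bullet> (K \<rhd> ?m) \<bullet> \<alpha> K K V"
      by (rule iffI, rule arrow_eqI) simp_all
    also have "\<dots> \<longleftrightarrow> ?r"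
    proof
      assume "?m \<bullet> (\<mu> \<lhd> V) = ?m \<bullet> (K \<rhd> ?m) \<bullet> \<alpha> K K V"
      then have "(?m \<bullet> (\<mu> \<lhd> V)) \<bullet> \<alpha>' K K V = (?m \<bullet> (K \<rhd> ?m) \<bullet> \<alpha> K K V) \<bullet> \<alpha>' K K V"
        by (rule arg_cong)
      then show ?r by (simp add: lift_def)
    next
      assume ?r
      then have "(?m \<bullet> lift K K V \<mu>) \<bullet> \<alpha> K K V = (?m \<bullet> (K \<rhd> ?m)) \<bullet> \<alpha> K K V"
        by (rule arg_cong)
      then show "?m \<bullet> (\<mu> \<lhd> V) = ?m \<bullet> (K \<rhd> ?m) \<bullet> \<alpha> K K V" by (simp add: lift_\<alpha>)
    qed
    finally show ?thesis .
  qed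
  moreover have "m \<cdot> (Iota A \<boxtimes> Id C V) = Lun C V \<longleftrightarrow> ?m \<bullet> (\<iota> \<lhd> V) = lu V"
    if [simp]: "obj V" "m \<in> Hom C (K \<otimes> V) V"
  proof -
    have "m \<cdot> (Iota A \<boxtimes> Id C V) = Lun C V \<longleftrightarrow> mor (?m \<bullet> (\<iota> \<lhd> V)) = mor (lu V)"
      by simp
    also have "\<dots> \<longleftrightarrow> ?m \<bullet> (\<iota> \<lhd> V) = lu V"
      by (rule iffI, rule arrow_eqI) simp_all
    finally show ?thesis .
  qed
  ultimately show ?thesis
    using Pair by (auto simp: Rep_def act_def is_action_def)
qed

lemma act_simps [simp]:
  assumes "X \<in> Mod"
  shows "fst X \<in> Ob C" "arr (act X)" "src (act X) = K \<otimes> fst X" "trg (act X) = fst X"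
    "mor (act X) = snd X"
proof -
  show "arr (act X)" "fst X \<in> Ob C"
    using assms by (simp_all add: Rep_Ob_iff is_actionD(1))
qed (simp_all add: act_def)

lemma act_laws:
  assumes "X \<in> Mod"
  shows act_assoc: "act X \<bullet> lift K K (fst X) \<mu> = act X \<bullet> (K \<rhd> act X)"
    and act_unit: "act X \<bullet> (\<iota> \<lhd> fst X) = lu (fst X)"
  using is_actionD(3,4) [of "act X"] assms by (simp_all add: Rep_Ob_iff)

lemma Rep_Hom: "HomA X Y = {f \<in> Hom C (fst X) (fst Y). f \<cdot> snd X = snd Y \<cdot> (Id C K \<boxtimes> f)}"
  by (simp add: Rep_def)

lemma Rep_Hom_iff:
  assumes [simp]: "X \<in> Mod" "Y \<in> Mod"
  shows "f \<in> HomA X Y \<longleftrightarrow> arr (Arrow (fst X) (fst Y) f) \<and>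
    Arrow (fst X) (fst Y) f \<bullet> act X = act Y \<bullet> (K \<rhd> Arrow (fst X) (fst Y) f)"
proof (cases "f \<in> Hom C (fst X) (fst Y)")
  case True
  let ?f = "Arrow (fst X) (fst Y) f"
  have "f \<cdot> snd X = snd Y \<cdot> (Id C K \<boxtimes> f) \<longleftrightarrow> mor (?f \<bullet> act X) = mor (act Y \<bullet> (K \<rhd> ?f))"
    using True by simp
  also have "\<dots> \<longleftrightarrow> ?f \<bullet> act X = act Y \<bullet> (K \<rhd> ?f)"
    using True by (intro iffI, intro arrow_eqI) simp_all
  finally show ?thesis using True by (simp add: Rep_Hom)
qed (simp_all add: Rep_Hom)

lemma Rep_sel [simp]:
  "Cmp (Rep C A) = Cmp C" "Id (Rep C A) X = Id C (fst X)" "Scl (Rep C A) = Scl C"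
  by (simp_all add: Rep_def)

sublocale modules: category_over C "Rep C A" fst
proof
  fix X Y Z f g
  assume [simp]: "X \<in> Mod" "Y \<in> Mod" "Z \<in> Mod"
    and f: "f \<in> HomA X Y" and g: "g \<in> HomA Y Z"
  let ?f = "Arrow (fst X) (fst Y) f" and ?g = "Arrow (fst Y) (fst Z) g"
  have f': "arr ?f" "?f \<bullet> act X = act Y \<bullet> (K \<rhd> ?f)" and g': "arr ?g" "?g \<bullet> act Y = act Z \<bullet> (K \<rhd> ?g)"
    using f g by (simp_all only: Rep_Hom_iff \<open>X \<in> _\<close> \<open>Y \<in> _\<close> \<open>Z \<in> _\<close>)
  have arr: "arr (?g \<bullet> ?f)"
    using f'(1) g'(1) by simp
  have gf: "?g \<bullet> ?f = Arrow (fst X) (fst Z) (g \<cdot> f)"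
    using f'(1) g'(1) by (simp add: comp_Arrow)
  have "(?g \<bullet> ?f) \<bullet> act X = (?g \<bullet> act Y) \<bullet> (K \<rhd> ?f)"
    by (simp only: f'(2) comp_assoc)
  also have "\<dots> = act Z \<bullet> (K \<rhd> (?g \<bullet> ?f))"
    using f'(1) g'(1) by (simp only: g'(2)) simp
  finally show "g \<cdot> f \<in> HomA X Z"
    using arr unfolding gf by (simp only: Rep_Hom_iff \<open>X \<in> _\<close> \<open>Z \<in> _\<close>)
qed (auto simp: Rep_Hom)

abbreviation hom :: "'o \<times> 'm \<Rightarrow> 'o \<times> 'm \<Rightarrow> ('o, 'm) arrow \<Rightarrow> bool" where
  "hom \<equiv> modules.hom"

lemma hom_iff:
  assumes "X \<in> Mod" "Y \<in> Mod"
  shows "hom X Y f \<longleftrightarrow> arr f \<and> src f = fst X \<and> trg f = fst Y \<and> f \<bullet> act X = act Y \<bullet> (K \<rhd> f)"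
proof (cases "arr f \<and> src f = fst X \<and> trg f = fst Y")
  case True
  then have "Arrow (fst X) (fst Y) (mor f) = f"
    by (metis Arrow_src_trg)
  with True assms show ?thesis
    by (simp add: modules.hom_def Rep_Hom_iff)
qed (auto simp: modules.hom_def)

lemma homD:
  assumes "hom X Y f"
  shows "arr f" "src f = fst X" "trg f = fst Y" "f \<bullet> act X = act Y \<bullet> (K \<rhd> f)"
  using assms hom_iff [of X Y f] by (simp_all add: modules.hom_def)

lemma is_action_inverses:
  assumes "is_action m" "inverses p p'" "src p = trg m"
  shows "is_action (p \<bullet> m \<bullet> (K \<rhd> p'))"
proof -
  note [simp] = is_actionD(1,2) [OF assms(1)] inverses_ends [OF assms(2)] assms(3)
    inverses_comp [OF assms(2)] inverses_comp [OF inverses_whisker(1) [OF assms(2) K_object]]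
  let ?V = "trg m" and ?W = "trg p"
  have "(p \<bullet> m \<bullet> (K \<rhd> p')) \<bullet> lift K K ?W \<mu> = p \<bullet> m \<bullet> lift K K ?V \<mu> \<bullet> (K \<rhd> (K \<rhd> p'))"
    by (simp add: lift_natural)
  also have "\<dots> = p \<bullet> m \<bullet> (K \<rhd> m) \<bullet> (K \<rhd> (K \<rhd> p'))"
    by (simp add: reassoc [OF is_actionD(4) [OF assms(1)]])
  finally have assoc: "(p \<bullet> m \<bullet> (K \<rhd> p')) \<bullet> lift K K ?W \<mu> =
      (p \<bullet> m \<bullet> (K \<rhd> p')) \<bullet> (K \<rhd> (p \<bullet> m \<bullet> (K \<rhd> p')))"
    by simp
  have "(p \<bullet> m \<bullet> (K \<rhd> p')) \<bullet> (\<iota> \<lhd> ?W) = p \<bullet> m \<bullet> (\<iota> \<lhd> ?V) \<bullet> (\<one> \<rhd> p')"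
    by (simp add: slide)
  also have "\<dots> = lu ?W"
    by (simp add: reassoc [OF is_actionD(3) [OF assms(1)]] lu_natural)
  finally show ?thesis
    using assoc by (simp add: is_action_def)
qed

subsection \<open>Free modules\<close>

lemma is_action_free:
  assumes [simp]: "obj V"
  shows "is_action (lift K K V \<mu>)"
proof -
  have "lift K K V \<mu> \<bullet> lift K K (K \<otimes> V) \<mu> = lift K K V \<mu> \<bullet> (\<mu> \<lhd> (K \<otimes> V)) \<bullet> \<alpha>' K K (K \<otimes> V)"
    by (simp add: lift_def [of K K "K \<otimes> V"])
  also have "\<dots> = lift (K \<otimes> K) K V (\<mu> \<bullet> (\<mu> \<lhd> K)) \<bullet> \<alpha>' K K (K \<otimes> V)"
    by (subst lift_comp_right) simp_all
  also have "\<mu> \<bullet> (\<mu> \<lhd> K) = (\<mu> \<bullet> (K \<rhd> \<mu>)) \<bullet> \<alpha> K K K"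
    by (simp only: \<mu>_assoc comp_assoc)
  also have "lift (K \<otimes> K) K V \<dots> \<bullet> \<alpha>' K K (K \<otimes> V) =
      (lift K (K \<otimes> K) V (\<mu> \<bullet> (K \<rhd> \<mu>)) \<bullet> (K \<rhd> \<alpha>' K K V) \<bullet> \<alpha> K K (K \<otimes> V)) \<bullet> \<alpha>' K K (K \<otimes> V)"
    by (subst lift_reassoc) simp_all
  also have "\<dots> = lift K (K \<otimes> K) V (\<mu> \<bullet> (K \<rhd> \<mu>)) \<bullet> (K \<rhd> \<alpha>' K K V)"
    by simp
  also have "\<dots> = lift K K V \<mu> \<bullet> (K \<rhd> lift K K V \<mu>)"
    by (subst lift_comp_left) (simp_all add: lift_def)
  finally have "lift K K V \<mu> \<bullet> lift K K (K \<otimes> V) \<mu> = lift K K V \<mu> \<bullet> (K \<rhd> lift K K V \<mu>)" .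
  moreover have "lift K K V \<mu> \<bullet> (\<iota> \<lhd> (K \<otimes> V)) = lift \<one> K V (\<mu> \<bullet> (\<iota> \<lhd> K))"
    by (subst lift_comp_right) simp_all
  moreover have "\<dots> = lu (K \<otimes> V)"
    by (simp add: \<mu>_unit_left lift_def flip: lu_tens)
  ultimately show ?thesis by (simp add: is_action_def)
qed

lemma F_ob_simps [simp]:
  assumes "obj V"
  shows "F V \<in> Mod" "fst (F V) = K \<otimes> V" "act (F V) = lift K K V \<mu>"
proof -
  have "Arrow (K \<otimes> (K \<otimes> V)) (K \<otimes> V) (mor (lift K K V \<mu>)) = lift K K V \<mu>"
    using assms Arrow_src_trg [of "lift K K V \<mu>"] by simp
  moreover show fst: "fst (F V) = K \<otimes> V"
    by (simp add: F_ob_def)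
  ultimately show act: "act (F V) = lift K K V \<mu>"
    using assms by (simp add: F_ob_def act_def lift_def)
  show "F V \<in> Mod"
    using assms is_action_free [OF assms] by (simp add: Rep_Ob_iff act fst)
qed

definition \<eta> :: "'o \<Rightarrow> ('o, 'm) arrow" where
  "\<eta> V = (\<iota> \<lhd> V) \<bullet> lu' V"

lemma \<eta>_simps [simp]:
  assumes "obj V"
  shows "arr (\<eta> V)" "src (\<eta> V) = V" "trg (\<eta> V) = K \<otimes> V" "mor (\<eta> V) = unit_ins C A V"
  using assms by (simp_all add: \<eta>_def unit_ins_def)

lemma \<eta>_natural:
  assumes [simp]: "arr f" "y = trg f"
  shows "\<eta> y \<bullet> f = (K \<rhd> f) \<bullet> \<eta> (src f)"
  by (simp add: \<eta>_def lu'_natural reassoc [OF slide [symmetric]])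

lemma \<eta>_tens:
  assumes [simp]: "obj V" "obj W"
  shows "\<alpha>' K V W \<bullet> \<eta> (V \<otimes> W) = \<eta> V \<lhd> W"
proof (rule inverses_cancel_right [OF inverses_lu [of "V \<otimes> W"]])
  have "((\<eta> V \<lhd> W) \<bullet> lu (V \<otimes> W)) \<bullet> \<alpha> \<one> V W = ((\<iota> \<lhd> V) \<bullet> lu' V \<bullet> lu V) \<lhd> W"
    by (simp add: \<eta>_def lu_tens del: lu_cancel)
  also have "\<dots> = (\<alpha>' K V W \<bullet> (\<iota> \<lhd> (V \<otimes> W))) \<bullet> \<alpha> \<one> V W"
    by (simp add: \<alpha>'_natural_whisker)
  finally have "(\<eta> V \<lhd> W) \<bullet> lu (V \<otimes> W) = \<alpha>' K V W \<bullet> (\<iota> \<lhd> (V \<otimes> W))"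
    by (rule inverses_cancel_right [OF inverses_\<alpha> [OF Unit_in_Ob assms]]) simp_all
  then show "(\<alpha>' K V W \<bullet> \<eta> (V \<otimes> W)) \<bullet> lu (V \<otimes> W) = (\<eta> V \<lhd> W) \<bullet> lu (V \<otimes> W)"
    by (simp add: \<eta>_def)
qed simp_all

lemma act_\<eta>:
  assumes [simp]: "X \<in> Mod"
  shows "act X \<bullet> \<eta> (fst X) = ide (fst X)"
  by (simp add: \<eta>_def reassoc [OF act_unit])

text \<open>The right unit law of \<open>A\<close>, which commutativity reduces to the left one; it makes \<open>\<eta>\<close> generate \<open>F(V)\<close>.\<close>

lemma free_\<eta>:
  assumes [simp]: "obj V"
  shows "lift K K V \<mu> \<bullet> (K \<rhd> \<eta> V) = ide (K \<otimes> V)"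
proof -
  have "lift K K V \<mu> \<bullet> (K \<rhd> \<eta> V) = lift K \<one> V (\<mu> \<bullet> (K \<rhd> \<iota>)) \<bullet> (K \<rhd> lu' V)"
    by (subst lift_comp_left) (simp_all add: \<eta>_def)
  also have "\<dots> = ((K \<rhd> lu V) \<bullet> \<alpha> K \<one> V) \<bullet> \<alpha>' K \<one> V \<bullet> (K \<rhd> lu' V)"
    by (simp add: \<mu>_unit_right lift_def triangle_\<alpha>)
  also have "\<dots> = K \<rhd> (lu V \<bullet> lu' V)"
    by (simp del: lu_cancel)
  finally show ?thesis by simp
qed

section \<open>Actions through a braiding\<close>

text \<open>
  This action makes \<open>V \<otimes> X\<close> a module for every object \<open>V\<close> and module \<open>X\<close>, and this module turns out to
  be \<open>F(V) \<otimes>\<^sub>A X\<close>.  When \<open>V\<close> underlies a module, it is also the second of the two actions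
  whose difference is divided out in the tensor product over \<open>A\<close>.
\<close>

definition past :: "'o \<Rightarrow> ('o, 'm) arrow \<Rightarrow> ('o, 'm) arrow" where
  "past V m = (V \<rhd> m) \<bullet> B K V (trg m)"

lemma past_simps [simp]:
  assumes "obj V" "arr m" "src m = K \<otimes> trg m"
  shows "arr (past V m)" "src (past V m) = K \<otimes> (V \<otimes> trg m)" "trg (past V m) = V \<otimes> trg m"
  using assms by (simp_all add: past_def)

lemma is_action_past:
  assumes [simp]: "obj V" and m: "is_action m"
  shows "is_action (past V m)"
proof -
  note [simp] = is_actionD(1,2) [OF m]
  let ?X = "trg m"
  have "past V m \<bullet> lift K K (V \<otimes> ?X) \<mu> =
      (V \<rhd> (m \<bullet> lift K K ?X \<mu>)) \<bullet> B K V (K \<otimes> ?X) \<bullet> (K \<rhd> B K V ?X)"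
    using B_lift [of K K V ?X \<mu>] by (simp add: past_def)
  also have "\<dots> = (V \<rhd> m) \<bullet> (V \<rhd> (K \<rhd> m)) \<bullet> B K V (K \<otimes> ?X) \<bullet> (K \<rhd> B K V ?X)"
    by (simp add: is_actionD(4) [OF m])
  also have "\<dots> = past V m \<bullet> (K \<rhd> past V m)"
    by (simp add: past_def reassoc [OF B_natural(1)])
  finally have assoc: "past V m \<bullet> lift K K (V \<otimes> ?X) \<mu> = past V m \<bullet> (K \<rhd> past V m)" .
  have "past V m \<bullet> (\<iota> \<lhd> (V \<otimes> ?X)) = (V \<rhd> (m \<bullet> (\<iota> \<lhd> ?X))) \<bullet> B \<one> V ?X"
    by (simp add: past_def B_natural)
  also have "\<dots> = ((ru V \<bullet> R \<one> V) \<lhd> ?X) \<bullet> \<alpha>' \<one> V ?X"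
    by (simp add: is_actionD(3) [OF m] B_def lift_def reassoc [OF triangle_\<alpha>])
  also have "\<dots> = lu (V \<otimes> ?X)"
    by (simp only: ru_R assms) (simp flip: lu_tens)
  finally show ?thesis
    using assoc by (simp add: is_action_def)
qed

lemma lift_\<mu>_B:
  assumes [simp]: "obj x"
  shows "lift K K x \<mu> \<bullet> B K K x = lift K K x \<mu>"
proof -
  have "lift K K x \<mu> \<bullet> B K K x = lift K K x (\<mu> \<bullet> R K K)"
    by (simp add: lift_comp B_def reassoc [OF lift_\<alpha>])
  then show ?thesis
    by (simp only: \<mu>_comm)
qed

text \<open>By commutativity two successive actions of \<open>A\<close> may be exchanged.\<close>

lemma act_past:
  assumes "is_action m"
  shows "m \<bullet> past K m = m \<bullet> (K \<rhd> m)"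
proof -
  note [simp] = is_actionD(1,2) [OF assms]
  have "m \<bullet> past K m = m \<bullet> lift K K (trg m) \<mu> \<bullet> B K K (trg m)"
    by (simp add: past_def reassoc [OF is_actionD(4) [OF assms]])
  then show ?thesis
    by (simp add: lift_\<mu>_B is_actionD(4) [OF assms])
qed

subsection \<open>The split coequalizer\<close>

text \<open>
  For a free module \<open>F(V)\<close> and a module \<open>X\<close> the two actions on \<open>F(V) \<otimes> X\<close> have the coequalizer
  \<open>split_r\<close>, with the splittings \<open>split_s\<close> and \<open>split_t\<close>.  Being split, it remains a coequalizer after
  tensoring with further objects.
\<close>

definition split_r :: "'o \<Rightarrow> ('o, 'm) arrow \<Rightarrow> ('o, 'm) arrow" where
  "split_r V m = past V m \<bullet> \<alpha> K V (trg m)"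

definition split_s :: "'o \<Rightarrow> ('o, 'm) arrow \<Rightarrow> ('o, 'm) arrow" where
  "split_s V m = \<eta> V \<lhd> trg m"

definition split_t :: "'o \<Rightarrow> ('o, 'm) arrow \<Rightarrow> ('o, 'm) arrow" where
  "split_t V m = (K \<rhd> split_s V m) \<bullet> \<alpha> K V (trg m)"

context
  fixes V m
  assumes V [simp]: "obj V" and m: "is_action m"
begin

lemma split_simps [simp]:
  "arr (split_r V m)" "src (split_r V m) = (K \<otimes> V) \<otimes> trg m" "trg (split_r V m) = V \<otimes> trg m"
  "arr (split_s V m)" "src (split_s V m) = V \<otimes> trg m" "trg (split_s V m) = (K \<otimes> V) \<otimes> trg m"
  "arr (split_t V m)" "src (split_t V m) = (K \<otimes> V) \<otimes> trg m"
  "trg (split_t V m) = K \<otimes> ((K \<otimes> V) \<otimes> trg m)"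
  using is_actionD(1,2) [OF m] by (simp_all add: split_r_def split_s_def split_t_def)

text \<open>Multiplying in \<open>A\<close> first and acting through \<open>split_r\<close> afterwards is acting twice, as \<open>past V m\<close> is an action.\<close>

lemma split_r_first:
  "split_r V m \<bullet> lift K (K \<otimes> V) (trg m) (lift K K V \<mu>) = past V m \<bullet> (K \<rhd> split_r V m)"
proof -
  note [simp] = is_actionD(1,2) [OF m]
  let ?X = "trg m"
  have "\<alpha> K V ?X \<bullet> lift K (K \<otimes> V) ?X (lift K K V \<mu>) = lift K K (V \<otimes> ?X) \<mu> \<bullet> (K \<rhd> \<alpha> K V ?X)"
    by (simp add: lift_def [of K "K \<otimes> V"] reassoc [OF lift_assoc])
  then have "split_r V m \<bullet> lift K (K \<otimes> V) ?X (lift K K V \<mu>) =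
      (past V m \<bullet> lift K K (V \<otimes> ?X) \<mu>) \<bullet> (K \<rhd> \<alpha> K V ?X)"
    by (simp add: split_r_def)
  also have "past V m \<bullet> lift K K (V \<otimes> ?X) \<mu> = past V m \<bullet> (K \<rhd> past V m)"
    using is_actionD(4) [OF is_action_past [OF V m]] by simp
  finally show ?thesis
    by (simp add: split_r_def)
qed

text \<open>The first hexagon turns the left-hand side into two actions in exchanged order.\<close>

lemma split_r_second: "split_r V m \<bullet> past (K \<otimes> V) m = past V m \<bullet> (K \<rhd> split_r V m)"
proof -
  note [simp] = is_actionD(1,2) [OF m]
  let ?X = "trg m"
  have "\<alpha> K V ?X \<bullet> past (K \<otimes> V) m = (K \<rhd> (V \<rhd> m)) \<bullet> (\<alpha> K V (K \<otimes> ?X) \<bullet> B K (K \<otimes> V) ?X)"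
    by (simp add: past_def reassoc [OF \<alpha>_natural_whisker(3)])
  also have "\<dots> = past K (past V m) \<bullet> (K \<rhd> \<alpha> K V ?X)"
    by (simp add: past_def B_hexagon1)
  finally have "split_r V m \<bullet> past (K \<otimes> V) m = (past V m \<bullet> past K (past V m)) \<bullet> (K \<rhd> \<alpha> K V ?X)"
    by (simp add: split_r_def)
  then show ?thesis
    by (simp only: act_past [OF is_action_past [OF V m]]) (simp add: split_r_def)
qed

lemma split_r_split_s: "split_r V m \<bullet> split_s V m = ide (V \<otimes> trg m)"
proof -
  note [simp] = is_actionD(1,2) [OF m]
  let ?X = "trg m"
  have "split_r V m \<bullet> split_s V m = (V \<rhd> m) \<bullet> \<alpha> V K ?X \<bullet> ((R K V \<bullet> \<eta> V) \<lhd> ?X)"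
    by (simp add: split_r_def split_s_def past_def B_def reassoc [OF lift_\<alpha>])
  also have "R K V \<bullet> \<eta> V = (V \<rhd> \<iota>) \<bullet> R \<one> V \<bullet> lu' V"
    by (simp add: \<eta>_def reassoc [OF R_natural_whisker(1)])
  also have "(V \<rhd> m) \<bullet> \<alpha> V K ?X \<bullet> (\<dots> \<lhd> ?X) =
      (V \<rhd> (m \<bullet> (\<iota> \<lhd> ?X))) \<bullet> \<alpha> V \<one> ?X \<bullet> ((R \<one> V \<bullet> lu' V) \<lhd> ?X)"
    by (simp add: reassoc [OF \<alpha>_natural_whisker(2)])
  also have "\<dots> = (ru V \<bullet> R \<one> V \<bullet> lu' V) \<lhd> ?X"
    by (simp add: is_actionD(3) [OF m] reassoc [OF triangle_\<alpha>])
  also have "\<dots> = ide (V \<otimes> ?X)"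
    by (simp add: reassoc [OF ru_R])
  finally show ?thesis .
qed

lemma split_t_first: "lift K (K \<otimes> V) (trg m) (lift K K V \<mu>) \<bullet> split_t V m = ide ((K \<otimes> V) \<otimes> trg m)"
proof -
  note [simp] = is_actionD(1,2) [OF m]
  have "lift K (K \<otimes> V) (trg m) (lift K K V \<mu>) \<bullet> split_t V m =
      lift K V (trg m) (lift K K V \<mu> \<bullet> (K \<rhd> \<eta> V)) \<bullet> \<alpha> K V (trg m)"
    by (subst lift_comp_left) (simp_all add: split_t_def split_s_def)
  then show ?thesis
    by (simp only: free_\<eta> V) (simp add: lift_def)
qed

lemma split_t_second: "past (K \<otimes> V) m \<bullet> split_t V m = split_s V m \<bullet> split_r V m"
proof -
  note [simp] = is_actionD(1,2) [OF m]
  let ?X = "trg m"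
  have "past (K \<otimes> V) m \<bullet> split_t V m =
      ((K \<otimes> V) \<rhd> m) \<bullet> (\<eta> V \<lhd> (K \<otimes> ?X)) \<bullet> B K V ?X \<bullet> \<alpha> K V ?X"
    by (simp add: past_def split_t_def split_s_def reassoc [OF B_natural(2)])
  also have "\<dots> = split_s V m \<bullet> split_r V m"
    by (simp add: past_def split_s_def split_r_def reassoc [OF slide])
  finally show ?thesis .
qed

end

section \<open>The tensor product over the algebra\<close>

definition act_first :: "'o \<times> 'm \<Rightarrow> 'o \<times> 'm \<Rightarrow> ('o, 'm) arrow" where
  "act_first X Y = lift K (fst X) (fst Y) (act X)"

definition act_second :: "'o \<times> 'm \<Rightarrow> 'o \<times> 'm \<Rightarrow> ('o, 'm) arrow" where
  "act_second X Y = past (fst X) (act Y)"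

definition q :: "'o \<times> 'm \<Rightarrow> 'o \<times> 'm \<Rightarrow> ('o, 'm) arrow" where
  "q X Y = Arrow (fst X \<otimes> fst Y) (Q X Y) (quot_map C A X Y)"

definition desc :: "'o \<times> 'm \<Rightarrow> 'o \<times> 'm \<Rightarrow> ('o, 'm) arrow \<Rightarrow> ('o, 'm) arrow" where
  "desc X Y g = (THE h. arr h \<and> src h = Q X Y \<and> trg h = trg g \<and> h \<bullet> q X Y = g)"

lemma is_action_act [simp]: "X \<in> Mod \<Longrightarrow> is_action (act X)"
  using Rep_Ob_iff by blast

lemma fst_tensA [simp]: "fst (X \<odot> Y) = Q X Y"
  by (simp add: tensA_def)

context
  fixes X Y
  assumes X [simp]: "X \<in> Mod" and Y [simp]: "Y \<in> Mod"
begin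

lemma act_first_second_simps [simp]:
  "arr (act_first X Y)" "src (act_first X Y) = K \<otimes> (fst X \<otimes> fst Y)"
  "trg (act_first X Y) = fst X \<otimes> fst Y" "mor (act_first X Y) = act1 C A X Y"
  "arr (act_second X Y)" "src (act_second X Y) = K \<otimes> (fst X \<otimes> fst Y)"
  "trg (act_second X Y) = fst X \<otimes> fst Y" "mor (act_second X Y) = act2 C A X Y"
  by (simp_all add: act_first_def act_second_def act1_def act2_def past_def B_def lift_def)

lemma quot_cokernel:
  "is_cokernel C (K \<otimes> (fst X \<otimes> fst Y)) (fst X \<otimes> fst Y) (act1 C A X Y - act2 C A X Y)
     (Q X Y) (quot_map C A X Y)"
proof -
  have "act1 C A X Y - act2 C A X Y \<in> Hom C (K \<otimes> (fst X \<otimes> fst Y)) (fst X \<otimes> fst Y)"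
    using mor_in_Hom [of "act_first X Y"] mor_in_Hom [of "act_second X Y"] by (simp add: Hom_diff)
  then obtain T p where "is_cokernel C (K \<otimes> (fst X \<otimes> fst Y)) (fst X \<otimes> fst Y)
      (act1 C A X Y - act2 C A X Y) T p"
    using ex_cokernel [of "K \<otimes> (fst X \<otimes> fst Y)" "fst X \<otimes> fst Y" "act1 C A X Y - act2 C A X Y"]
    by auto
  then have "\<exists>p. case p of (T, p) \<Rightarrow> is_cokernel C (K \<otimes> (fst X \<otimes> fst Y)) (fst X \<otimes> fst Y)
      (act1 C A X Y - act2 C A X Y) T p"
    by auto
  then have "case quot C A X Y of (T, p) \<Rightarrow> is_cokernel C (K \<otimes> (fst X \<otimes> fst Y)) (fst X \<otimes> fst Y)
      (act1 C A X Y - act2 C A X Y) T p"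
    unfolding quot_def by (rule someI_ex)
  then show ?thesis
    by (simp add: quot_ob_def quot_map_def case_prod_beta)
qed

lemma q_simps [simp]:
  "arr (q X Y)" "src (q X Y) = fst X \<otimes> fst Y" "trg (q X Y) = Q X Y"
  "mor (q X Y) = quot_map C A X Y" "Q X Y \<in> Ob C"
  using quot_cokernel by (simp_all add: q_def is_cokernel_def)

lemma coequalizes_iff:
  assumes "arr g" "src g = fst X \<otimes> fst Y"
  shows "mor g \<cdot> (act1 C A X Y - act2 C A X Y) = 0 \<longleftrightarrow> g \<bullet> act_first X Y = g \<bullet> act_second X Y"
proof -
  have "mor g \<cdot> (act1 C A X Y - act2 C A X Y) = mor (g \<bullet> act_first X Y) - mor (g \<bullet> act_second X Y)"
    using assms mor_in_Hom [of "act_first X Y"] mor_in_Hom [of "act_second X Y"] mor_in_Hom [of g]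
    by (subst Cmp_diff_right [of "K \<otimes> (fst X \<otimes> fst Y)" "fst X \<otimes> fst Y" "trg g"]) simp_all
  moreover have "mor (g \<bullet> act_first X Y) = mor (g \<bullet> act_second X Y) \<longleftrightarrow>
      g \<bullet> act_first X Y = g \<bullet> act_second X Y"
    using assms by (intro iffI, intro arrow_eqI) simp_all
  ultimately show ?thesis by simp
qed

lemma q_coequalizes: "q X Y \<bullet> act_first X Y = q X Y \<bullet> act_second X Y"
  using coequalizes_iff [of "q X Y"] quot_cokernel by (simp add: is_cokernel_def)

lemma desc_unique:
  assumes g: "arr g" "src g = fst X \<otimes> fst Y" "g \<bullet> act_first X Y = g \<bullet> act_second X Y"
  shows "\<exists>!h. arr h \<and> src h = Q X Y \<and> trg h = trg g \<and> h \<bullet> q X Y = g"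
proof -
  have "\<exists>!h. h \<in> Hom C (Q X Y) (trg g) \<and> h \<cdot> quot_map C A X Y = mor g"
    using quot_cokernel coequalizes_iff [OF g(1,2)] g by (simp add: is_cokernel_def mor_in_Hom)
  then obtain h where h: "h \<in> Hom C (Q X Y) (trg g)" "h \<cdot> quot_map C A X Y = mor g"
    and u: "\<And>h'. h' \<in> Hom C (Q X Y) (trg g) \<Longrightarrow> h' \<cdot> quot_map C A X Y = mor g \<Longrightarrow> h' = h"
    by blast
  show ?thesis
  proof (rule ex1I [of _ "Arrow (Q X Y) (trg g) h"])
    show "arr (Arrow (Q X Y) (trg g) h) \<and> src (Arrow (Q X Y) (trg g) h) = Q X Y \<and>
        trg (Arrow (Q X Y) (trg g) h) = trg g \<and> Arrow (Q X Y) (trg g) h \<bullet> q X Y = g"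
      using h g by (auto intro!: arrow_eqI)
  next
    fix k assume k: "arr k \<and> src k = Q X Y \<and> trg k = trg g \<and> k \<bullet> q X Y = g"
    then have "mor k \<cdot> quot_map C A X Y = mor g"
      by (metis comp_simps(3) q_simps(1,3,4))
    then have "mor k = h"
      using k by (intro u) (simp_all add: mor_in_Hom)
    with k g show "k = Arrow (Q X Y) (trg g) h"
      using h by (intro arrow_eqI) auto
  qed
qed

lemma desc_simps [simp]:
  assumes "arr g" "src g = fst X \<otimes> fst Y" "g \<bullet> act_first X Y = g \<bullet> act_second X Y"
  shows "arr (desc X Y g)" "src (desc X Y g) = Q X Y" "trg (desc X Y g) = trg g"
    "desc X Y g \<bullet> q X Y = g"
  using theI' [OF desc_unique [OF assms]] by (simp_all add: desc_def)

lemma q_epi: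
  assumes "arr h" "arr h'" "src h = Q X Y" "src h' = Q X Y" "h \<bullet> q X Y = h' \<bullet> q X Y"
  shows "h = h'"
proof -
  have "(h \<bullet> q X Y) \<bullet> act_first X Y = (h \<bullet> q X Y) \<bullet> act_second X Y"
    by (simp add: q_coequalizes)
  moreover have "trg h' = trg h"
    using assms by (metis comp_simps(2) q_simps(1,3))
  ultimately show ?thesis
    using desc_unique [of "h \<bullet> q X Y"] assms by simp metis
qed

text \<open>The morphisms out of \<open>X \<otimes>\<^sub>A Y\<close> are specified by definite descriptions; \<open>desc\<close> is the arrow that each describes.\<close>

lemma The_desc:
  assumes "arr g" "src g = fst X \<otimes> fst Y" "g \<bullet> act_first X Y = g \<bullet> act_second X Y"
    and "trg g = b" "mor g = m"
  shows "(THE h. h \<in> Hom C (Q X Y) b \<and> h \<cdot> quot_map C A X Y = m) = mor (desc X Y g)"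
proof (rule the_equality)
  have "mor (desc X Y g) \<cdot> quot_map C A X Y = mor (desc X Y g \<bullet> q X Y)"
    using assms by (simp del: desc_simps(4))
  also have "\<dots> = m"
    by (simp only: desc_simps(4) assms)
  finally show "mor (desc X Y g) \<in> Hom C (Q X Y) b \<and> mor (desc X Y g) \<cdot> quot_map C A X Y = m"
    using assms by (simp add: mor_in_Hom)
next
  fix h assume h: "h \<in> Hom C (Q X Y) b \<and> h \<cdot> quot_map C A X Y = m"
  have [simp]: "obj b" using assms(1,4) by auto
  have "Arrow (Q X Y) b h = desc X Y g"
  proof (rule q_epi)
    have "Arrow (Q X Y) b h \<bullet> q X Y = g"
      using h assms by (intro arrow_eqI) simp_all
    then show "Arrow (Q X Y) b h \<bullet> q X Y = desc X Y g \<bullet> q X Y"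
      using assms by simp
  qed (use h assms in simp_all)
  then show "h = mor (desc X Y g)" by (metis arrow.sel(3))
qed

end

subsection \<open>Tensor products with free modules\<close>

text \<open>The mutually inverse morphisms between \<open>V \<otimes> X\<close> and \<open>F(V) \<otimes>\<^sub>A X\<close>.\<close>

definition P :: "'o \<Rightarrow> 'o \<times> 'm \<Rightarrow> ('o, 'm) arrow" where
  "P V X = q (F V) X \<bullet> split_s V (act X)"

definition P' :: "'o \<Rightarrow> 'o \<times> 'm \<Rightarrow> ('o, 'm) arrow" where
  "P' V X = desc (F V) X (split_r V (act X))"

context
  fixes V X
  assumes V [simp]: "obj V" and X [simp]: "X \<in> Mod"
begin

lemma P_simps [simp]:
  "arr (P V X)" "src (P V X) = V \<otimes> fst X" "trg (P V X) = Q (F V) X"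
  "mor (P V X) = proj_map C A V X"
  by (simp_all add: P_def proj_map_def) (simp add: split_s_def)

lemma split_r_coequalizes:
  "split_r V (act X) \<bullet> act_first (F V) X = split_r V (act X) \<bullet> act_second (F V) X"
  using split_r_first [of V "act X"] split_r_second [of V "act X"]
  by (simp add: act_first_def act_second_def)

lemma P'_simps [simp]:
  "arr (P' V X)" "src (P' V X) = Q (F V) X" "trg (P' V X) = V \<otimes> fst X"
  "P' V X \<bullet> q (F V) X = split_r V (act X)"
  using split_r_coequalizes by (simp_all add: P'_def)

text \<open>The split coequalizer, tensored with \<open>Z\<close>: a morphism that does not distinguish the two actions factors
  through \<open>split_r\<close>.\<close>

lemma coequalizing_split:
  assumes "g \<bullet> (act_first (F V) X \<lhd> Z) = g \<bullet> (act_second (F V) X \<lhd> Z)"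
    and "arr g" "obj Z" "src g = ((K \<otimes> V) \<otimes> fst X) \<otimes> Z"
  shows "g \<bullet> ((split_s V (act X) \<bullet> split_r V (act X)) \<lhd> Z) = g"
proof -
  note [simp] = assms(2-4)
  have "g \<bullet> ((split_s V (act X) \<bullet> split_r V (act X)) \<lhd> Z) =
      g \<bullet> ((act_second (F V) X \<bullet> split_t V (act X)) \<lhd> Z)"
    using split_t_second [of V "act X"] by (simp add: act_second_def)
  also have "\<dots> = g \<bullet> ((act_first (F V) X \<bullet> split_t V (act X)) \<lhd> Z)"
    using reassoc [OF assms(1)] by simp
  also have "\<dots> = g"
    using split_t_first [of V "act X"] by (simp add: act_first_def)
  finally show ?thesis .
qed

lemma P_split_r: "P V X \<bullet> split_r V (act X) = q (F V) X"
proof -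
  have "P V X \<bullet> split_r V (act X) = (q (F V) X \<bullet> act_second (F V) X) \<bullet> split_t V (act X)"
    using split_t_second [of V "act X"] by (simp add: P_def act_second_def)
  also have "\<dots> = (q (F V) X \<bullet> act_first (F V) X) \<bullet> split_t V (act X)"
    by (simp only: q_coequalizes F_ob_simps V X)
  also have "\<dots> = q (F V) X"
    using split_t_first [of V "act X"] by (simp add: act_first_def)
  finally show ?thesis .
qed

lemma inverses_P: "inverses (P V X) (P' V X)"
proof -
  have "P' V X \<bullet> P V X = ide (V \<otimes> fst X)"
    using split_r_split_s [of V "act X"]
    by (simp add: P_def reassoc [OF P'_simps(4)])
  moreover have "P V X \<bullet> P' V X = ide (Q (F V) X)"
    by (rule q_epi [of "F V" X]) (simp_all add: P_split_r)
  ultimately show ?thesis by (simp add: inverses_def)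
qed

lemma q_split: "q (F V) X \<bullet> (split_s V (act X) \<bullet> P' V X) = ide (Q (F V) X)"
  using inverses_P by (simp add: inverses_def P_def)

text \<open>The module structure of \<open>F(V) \<otimes>\<^sub>A X\<close> is the one of \<open>V \<otimes> X\<close> transported along \<open>P\<close>.\<close>

lemma transported_action_q:
  "(P V X \<bullet> past V (act X) \<bullet> (K \<rhd> P' V X)) \<bullet> (K \<rhd> q (F V) X) =
   q (F V) X \<bullet> act_first (F V) X"
proof -
  have "(P V X \<bullet> past V (act X) \<bullet> (K \<rhd> P' V X)) \<bullet> (K \<rhd> q (F V) X) =
      P V X \<bullet> past V (act X) \<bullet> (K \<rhd> (P' V X \<bullet> q (F V) X))"
    by (simp del: P'_simps(4))
  also have "\<dots> = P V X \<bullet> split_r V (act X) \<bullet> act_first (F V) X"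
    using split_r_first [of V "act X"] by (simp add: act_first_def)
  also have "\<dots> = q (F V) X \<bullet> act_first (F V) X"
    by (simp add: reassoc [OF P_split_r])
  finally show ?thesis .
qed

lemma whisker_q_split:
  "(K \<rhd> q (F V) X) \<bullet> (K \<rhd> (split_s V (act X) \<bullet> P' V X)) = ide (K \<otimes> Q (F V) X)"
proof -
  have "(K \<rhd> q (F V) X) \<bullet> (K \<rhd> (split_s V (act X) \<bullet> P' V X)) =
      K \<rhd> (q (F V) X \<bullet> (split_s V (act X) \<bullet> P' V X))"
    by (subst whisker_comp(1)) simp_all
  then show ?thesis by (simp only: q_split) simp
qed

lemma act_tensA: "act (F V \<odot> X) = P V X \<bullet> past V (act X) \<bullet> (K \<rhd> P' V X)"
proof -
  let ?Q = "Q (F V) X" and ?n = "P V X \<bullet> past V (act X) \<bullet> (K \<rhd> P' V X)"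
  have "snd (F V \<odot> X) = mor ?n"
    unfolding tensA_def snd_conv
  proof (rule the_equality)
    have "mor (?n \<bullet> (K \<rhd> q (F V) X)) = mor (q (F V) X \<bullet> act_first (F V) X)"
      by (simp only: transported_action_q)
    then show "mor ?n \<in> Hom C (K \<otimes> ?Q) ?Q \<and>
        mor ?n \<cdot> (Id C K \<boxtimes> quot_map C A (F V) X) =
          quot_map C A (F V) X \<cdot> act1 C A (F V) X"
      using mor_in_Hom [of ?n] by (simp del: comp_assoc)
  next
    fix m assume m: "m \<in> Hom C (K \<otimes> ?Q) ?Q \<and> m \<cdot> (Id C K \<boxtimes> quot_map C A (F V) X) =
          quot_map C A (F V) X \<cdot> act1 C A (F V) X"
    have "Arrow (K \<otimes> ?Q) ?Q m \<bullet> (K \<rhd> q (F V) X) = q (F V) X \<bullet> act_first (F V) X"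
      by (rule arrow_eqI) (use m in simp_all)
    then have "Arrow (K \<otimes> ?Q) ?Q m \<bullet> (K \<rhd> q (F V) X) = ?n \<bullet> (K \<rhd> q (F V) X)"
      by (simp only: transported_action_q)
    then have "Arrow (K \<otimes> ?Q) ?Q m = ?n"
    proof (rule split_epi_cancel [rotated])
      show "(K \<rhd> q (F V) X) \<bullet> (K \<rhd> (split_s V (act X) \<bullet> P' V X)) =
          ide (trg (K \<rhd> q (F V) X))"
        by (simp only: whisker_q_split) simp
    qed (use m in simp_all)
    then show "m = mor ?n" by (metis arrow.sel(3))
  qed
  then have "act (F V \<odot> X) = Arrow (K \<otimes> ?Q) ?Q (mor ?n)"
    by (simp only: act_def [of "F V \<odot> X"] fst_tensA)
  also have "\<dots> = ?n"
    using Arrow_src_trg [of ?n] by simp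
  finally show ?thesis .
qed

lemma tensA_object [simp]: "F V \<odot> X \<in> Mod"
  using is_action_inverses [OF is_action_past [OF V is_action_act [OF X]] inverses_P]
  by (subst Rep_Ob_iff) (simp add: act_tensA)

end

subsection \<open>Morphisms induced on tensor products\<close>

definition induced :: "'o \<times> 'm \<Rightarrow> 'o \<times> 'm \<Rightarrow> 'o \<times> 'm \<Rightarrow> 'o \<times> 'm \<Rightarrow>
    ('o, 'm) arrow \<Rightarrow> ('o, 'm) arrow \<Rightarrow> ('o, 'm) arrow" where
  "induced X X' Y Y' f g = desc X Y (q X' Y' \<bullet> (f \<star> g))"

lemma actions_natural:
  assumes [simp]: "X \<in> Mod" "X' \<in> Mod" "Y \<in> Mod" "Y' \<in> Mod"
    and f: "hom X X' f" and g: "hom Y Y' g"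
  shows "(f \<star> g) \<bullet> act_first X Y = act_first X' Y' \<bullet> (K \<rhd> (f \<star> g))"
    and "(f \<star> g) \<bullet> act_second X Y = act_second X' Y' \<bullet> (K \<rhd> (f \<star> g))"
proof -
  note [simp] = homD(1-3) [OF f] homD(1-3) [OF g]
  have fg: "f \<star> g = (f \<lhd> fst Y') \<bullet> (fst X \<rhd> g)"
    by (rule tens_whiskers) simp_all
  have "act_first X' Y' \<bullet> (K \<rhd> (f \<star> g)) =
      lift K (fst X) (fst Y') (act X' \<bullet> (K \<rhd> f)) \<bullet> (K \<rhd> (fst X \<rhd> g))"
    by (subst lift_comp_left) (simp_all add: fg act_first_def)
  also have "\<dots> = lift K (fst X) (fst Y') (f \<bullet> act X) \<bullet> (K \<rhd> (fst X \<rhd> g))"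
    by (simp only: homD(4) [OF f])
  also have "\<dots> = (f \<star> g) \<bullet> act_first X Y"
    by (subst lift_comp) (simp_all add: fg act_first_def lift_natural)
  finally show "(f \<star> g) \<bullet> act_first X Y = act_first X' Y' \<bullet> (K \<rhd> (f \<star> g))" ..
  have "act_second X' Y' \<bullet> (K \<rhd> (f \<star> g)) =
      (fst X' \<rhd> act Y') \<bullet> (f \<lhd> (K \<otimes> fst Y')) \<bullet> (fst X \<rhd> (K \<rhd> g)) \<bullet> B K (fst X) (fst Y)"
    by (simp add: fg act_second_def past_def B_natural reassoc [OF B_natural(2)])
  also have "\<dots> = (f \<lhd> fst Y') \<bullet> (fst X \<rhd> (act Y' \<bullet> (K \<rhd> g))) \<bullet> B K (fst X) (fst Y)"
    by (simp add: reassoc [OF slide])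
  also have "\<dots> = (f \<lhd> fst Y') \<bullet> (fst X \<rhd> (g \<bullet> act Y)) \<bullet> B K (fst X) (fst Y)"
    by (simp only: homD(4) [OF g])
  also have "\<dots> = (f \<star> g) \<bullet> act_second X Y"
    by (simp add: fg act_second_def past_def)
  finally show "(f \<star> g) \<bullet> act_second X Y = act_second X' Y' \<bullet> (K \<rhd> (f \<star> g))" ..
qed

lemma induced_simps:
  assumes [simp]: "X \<in> Mod" "X' \<in> Mod" "Y \<in> Mod" "Y' \<in> Mod"
    and f: "hom X X' f" and g: "hom Y Y' g"
  shows "arr (induced X X' Y Y' f g)" "src (induced X X' Y Y' f g) = Q X Y"
    "trg (induced X X' Y Y' f g) = Q X' Y'"
    "induced X X' Y Y' f g \<bullet> q X Y = q X' Y' \<bullet> (f \<star> g)"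
    "mor (induced X X' Y Y' f g) = tensA_mor C A X X' Y Y' (mor f) (mor g)"
proof -
  note [simp] = homD(1-3) [OF f] homD(1-3) [OF g]
  have 1: "(q X' Y' \<bullet> (f \<star> g)) \<bullet> act_first X Y = (q X' Y' \<bullet> (f \<star> g)) \<bullet> act_second X Y"
    using actions_natural [OF assms] reassoc [OF q_coequalizes [of X' Y']] by simp
  have 2: "arr (q X' Y' \<bullet> (f \<star> g))" "src (q X' Y' \<bullet> (f \<star> g)) = fst X \<otimes> fst Y"
    by simp_all
  show "arr (induced X X' Y Y' f g)" "src (induced X X' Y Y' f g) = Q X Y"
    "trg (induced X X' Y Y' f g) = Q X' Y'"
    "induced X X' Y Y' f g \<bullet> q X Y = q X' Y' \<bullet> (f \<star> g)"
    using desc_simps [OF _ _ 2 1] by (simp_all add: induced_def)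
  show "mor (induced X X' Y Y' f g) = tensA_mor C A X X' Y Y' (mor f) (mor g)"
    unfolding tensA_mor_def induced_def by (rule The_desc [OF _ _ 2 1, symmetric]) simp_all
qed

lemma hom_ide: "X \<in> Mod \<Longrightarrow> hom X X (ide (fst X))"
  by (simp add: hom_iff)

lemma hom_free:
  assumes [simp]: "arr f"
  shows "hom (F (src f)) (F (trg f)) (K \<rhd> f)"
  by (simp add: hom_iff lift_natural)

lemma Rep_iso:
  assumes X [simp]: "X \<in> Mod" and Y [simp]: "Y \<in> Mod"
    and f: "hom X Y f" and inv: "inverses f g"
  shows "is_iso (Rep C A) X Y (mor f)"
proof -
  note [simp] = homD(1-3) [OF f] inverses_ends [OF inv]
  note c [simp] = inverses_comp [OF inv] inverses_comp [OF inverses_whisker(1) [OF inv K_object]]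
  have "g \<bullet> (act Y \<bullet> (K \<rhd> f)) \<bullet> (K \<rhd> g) = g \<bullet> (f \<bullet> act X) \<bullet> (K \<rhd> g)"
    by (simp only: homD(4) [OF f])
  then have "hom Y X g"
    by (simp add: hom_iff)
  moreover have "mor g \<cdot> mor f = mor (g \<bullet> f)" "mor f \<cdot> mor g = mor (f \<bullet> g)"
    by (simp_all del: c)
  then have "mor g \<cdot> mor f = Id C (fst X)" "mor f \<cdot> mor g = Id C (fst Y)"
    by simp_all
  ultimately show ?thesis
    using modules.homD(4) [OF f] modules.homD(4) [of Y X g]
    unfolding is_iso_def by (intro conjI bexI [of _ "mor g"]) simp_all
qed

section \<open>The tensor structure of the free module functor\<close>

definition J :: "'o \<Rightarrow> 'o \<Rightarrow> ('o, 'm) arrow" where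
  "J V W = q (F V) (F W) \<bullet> ((K \<otimes> V) \<rhd> \<eta> W) \<bullet> \<alpha>' K V W"

lemma J_simps [simp]:
  assumes "obj V" "obj W"
  shows "arr (J V W)" "src (J V W) = K \<otimes> (V \<otimes> W)"
    "trg (J V W) = Q (F V) (F W)" "mor (J V W) = F_tens C A V W"
  using assms by (simp_all add: J_def F_tens_def)

text \<open>With \<open>F(V) \<otimes>\<^sub>A F(W)\<close> identified with \<open>V \<otimes> (A \<otimes> W)\<close>, the unit of \<open>F(W)\<close> inserted by \<open>J\<close> absorbs
  the copy of \<open>A\<close> that arrives from the left.\<close>

lemma J_eq_braiding:
  assumes [simp]: "obj V" "obj W"
  shows "J V W = P V (F W) \<bullet> B K V W"
proof -
  have "split_r V (lift K K W \<mu>) \<bullet> ((K \<otimes> V) \<rhd> \<eta> W) \<bullet> \<alpha>' K V W =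
      past V (lift K K W \<mu>) \<bullet> (K \<rhd> (V \<rhd> \<eta> W))"
    by (simp add: split_r_def reassoc [OF \<alpha>_natural_whisker(3)])
  also have "\<dots> = (V \<rhd> (lift K K W \<mu> \<bullet> (K \<rhd> \<eta> W))) \<bullet> B K V W"
    by (simp add: past_def B_natural)
  also have "\<dots> = B K V W"
    by (simp only: free_\<eta> assms) simp
  finally have r: "split_r V (lift K K W \<mu>) \<bullet> ((K \<otimes> V) \<rhd> \<eta> W) \<bullet> \<alpha>' K V W = B K V W" .
  have "J V W = (P V (F W) \<bullet> split_r V (act (F W))) \<bullet> ((K \<otimes> V) \<rhd> \<eta> W) \<bullet> \<alpha>' K V W"
    by (subst P_split_r) (simp_all add: J_def)
  then show ?thesis
    by (simp add: r)
qed

text \<open>The second hexagon, in the form \<open>B_lift\<close>, says that the braiding in \<open>J_eq_braiding\<close> respects the actions.\<close>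

lemma J_iso:
  assumes [simp]: "obj V" "obj W"
  shows "hom (F (V \<otimes> W)) (F V \<odot> F W) (J V W)"
    and "is_iso (Rep C A) (F (V \<otimes> W)) (F V \<odot> F W) (F_tens C A V W)"
proof -
  let ?P = "P V (F W)" and ?P' = "P' V (F W)"
  have PP: "(K \<rhd> ?P') \<bullet> (K \<rhd> ?P) = ide (K \<otimes> (V \<otimes> (K \<otimes> W)))"
    using iso_whisker_comp(1) [OF inverses_P [of V "F W"] K_object] by simp
  have "act (F V \<odot> F W) \<bullet> (K \<rhd> J V W) =
      ?P \<bullet> past V (lift K K W \<mu>) \<bullet> (K \<rhd> B K V W)"
    by (simp add: act_tensA J_eq_braiding reassoc [OF PP])
  also have "\<dots> = ?P \<bullet> B K V W \<bullet> lift K K (V \<otimes> W) \<mu>"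
    using B_lift [of K K V W \<mu>] by (simp add: past_def)
  finally show hom: "hom (F (V \<otimes> W)) (F V \<odot> F W) (J V W)"
    by (simp add: hom_iff J_eq_braiding)
  obtain b where "inverses (B K V W) b"
    using inverses_B [of K V W] by auto
  then have "inverses (J V W) (b \<bullet> ?P')"
    unfolding J_eq_braiding [OF assms] by (intro inverses_trans inverses_P) simp_all
  then have "is_iso (Rep C A) (F (V \<otimes> W)) (F V \<odot> F W) (mor (J V W))"
    using hom by (intro Rep_iso) simp_all
  then show "is_iso (Rep C A) (F (V \<otimes> W)) (F V \<odot> F W) (F_tens C A V W)"
    by simp
qed

lemma J_natural:
  assumes [simp]: "arr f" "arr g"
  shows "J (trg f) (trg g) \<bullet> (K \<rhd> (f \<star> g)) =
    induced (F (src f)) (F (trg f)) (F (src g)) (F (trg g)) (K \<rhd> f) (K \<rhd> g) \<bullet>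
      J (src f) (src g)"
proof -
  have "((K \<otimes> trg f) \<rhd> \<eta> (trg g)) \<bullet> ((K \<rhd> f) \<star> g) = (K \<rhd> f) \<star> ((K \<rhd> g) \<bullet> \<eta> (src g))"
    by (simp add: interchange \<eta>_natural del: whisker_comp)
  also have "\<dots> = ((K \<rhd> f) \<star> (K \<rhd> g)) \<bullet> ((K \<otimes> src f) \<rhd> \<eta> (src g))"
    by (simp add: interchange del: whisker_comp)
  finally have sl: "((K \<otimes> trg f) \<rhd> \<eta> (trg g)) \<bullet> ((K \<rhd> f) \<star> g) =
      ((K \<rhd> f) \<star> (K \<rhd> g)) \<bullet> ((K \<otimes> src f) \<rhd> \<eta> (src g))" .
  have "J (trg f) (trg g) \<bullet> (K \<rhd> (f \<star> g)) = q (F (trg f)) (F (trg g)) \<bullet>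
      (((K \<rhd> f) \<star> (K \<rhd> g)) \<bullet> ((K \<otimes> src f) \<rhd> \<eta> (src g))) \<bullet> \<alpha>' K (src f) (src g)"
    using \<alpha>'_natural [of "ide K" f g] by (simp add: J_def reassoc [OF sl])
  then show ?thesis
    by (simp add: J_def reassoc [OF induced_simps(4) [OF _ _ _ _ hom_free hom_free]])
qed

lemma P_natural:
  assumes [simp]: "arr f" and [simp]: "X \<in> Mod" "X' \<in> Mod" and g: "hom X X' g"
  shows "P (trg f) X' \<bullet> (f \<star> g) =
    induced (F (src f)) (F (trg f)) X X' (K \<rhd> f) g \<bullet> P (src f) X"
proof -
  note [simp] = homD(1-3) [OF g]
  have "(\<eta> (trg f) \<lhd> fst X') \<bullet> (f \<star> g) = ((K \<rhd> f) \<star> g) \<bullet> (\<eta> (src f) \<lhd> fst X)"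
    by (simp add: interchange \<eta>_natural del: whisker_comp)
  then show ?thesis
    by (simp add: P_def split_s_def reassoc [OF induced_simps(4) [OF _ _ _ _ hom_free g]])
qed

subsection \<open>Compatibility with associativity\<close>

text \<open>The composite \<open>(X \<otimes> Y) \<otimes> Z \<rightarrow> X \<otimes>\<^sub>A (Y \<otimes>\<^sub>A Z)\<close> that induces the associativity constraint.\<close>

definition \<kappa> :: "'o \<times> 'm \<Rightarrow> 'o \<times> 'm \<Rightarrow> 'o \<times> 'm \<Rightarrow> ('o, 'm) arrow" where
  "\<kappa> X Y Z = q X (Y \<odot> Z) \<bullet> (fst X \<rhd> q Y Z) \<bullet> \<alpha> (fst X) (fst Y) (fst Z)"

context
  fixes X Y Z
  assumes X [simp]: "X \<in> Mod" and Y [simp]: "Y \<in> Mod" and Z [simp]: "Z \<in> Mod"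
    and T [simp]: "Y \<odot> Z \<in> Mod"
    and act_T: "act (Y \<odot> Z) \<bullet> (K \<rhd> q Y Z) = q Y Z \<bullet> act_first Y Z"
begin

lemma \<kappa>_simps [simp]:
  "arr (\<kappa> X Y Z)" "src (\<kappa> X Y Z) = (fst X \<otimes> fst Y) \<otimes> fst Z"
  "trg (\<kappa> X Y Z) = Q X (Y \<odot> Z)"
  by (simp_all add: \<kappa>_def)

text \<open>
  Letting \<open>A\<close> act on \<open>X\<close>, on \<open>Y\<close> or on \<open>Z\<close> gives the same morphism into \<open>X \<otimes>\<^sub>A (Y \<otimes>\<^sub>A Z)\<close>: all three are
  brought to the form in which \<open>A\<close> is braided past \<open>X\<close> and then acts on \<open>Y \<otimes> Z\<close>.
\<close>

lemma \<kappa>_act_left: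
  "\<kappa> X Y Z \<bullet> (act_first X Y \<lhd> fst Z) =
    q X (Y \<odot> Z) \<bullet> (fst X \<rhd> (q Y Z \<bullet> act_first Y Z)) \<bullet> B K (fst X) (fst Y \<otimes> fst Z) \<bullet>
      (K \<rhd> \<alpha> (fst X) (fst Y) (fst Z)) \<bullet> \<alpha> K (fst X \<otimes> fst Y) (fst Z)"
proof -
  let ?T = "Y \<odot> Z" and ?\<alpha> = "(K \<rhd> \<alpha> (fst X) (fst Y) (fst Z)) \<bullet> \<alpha> K (fst X \<otimes> fst Y) (fst Z)"
  have "\<kappa> X Y Z \<bullet> (act_first X Y \<lhd> fst Z) =
      q X ?T \<bullet> (fst X \<rhd> q Y Z) \<bullet> lift K (fst X) (fst Y \<otimes> fst Z) (act X) \<bullet> ?\<alpha>"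
    by (simp add: \<kappa>_def act_first_def lift_assoc)
  also have "\<dots> = q X ?T \<bullet> act_first X ?T \<bullet> (K \<rhd> (fst X \<rhd> q Y Z)) \<bullet> ?\<alpha>"
    by (simp add: act_first_def reassoc [OF lift_natural])
  also have "\<dots> = q X ?T \<bullet> act_second X ?T \<bullet> (K \<rhd> (fst X \<rhd> q Y Z)) \<bullet> ?\<alpha>"
    by (simp only: reassoc [OF q_coequalizes] X T comp_assoc)
  also have "\<dots> = q X ?T \<bullet> (fst X \<rhd> (act ?T \<bullet> (K \<rhd> q Y Z))) \<bullet> B K (fst X) (fst Y \<otimes> fst Z) \<bullet> ?\<alpha>"
    by (simp add: act_second_def past_def reassoc [OF B_natural(1)])
  also have "\<dots> = q X ?T \<bullet> (fst X \<rhd> (q Y Z \<bullet> act_first Y Z)) \<bullet> B K (fst X) (fst Y \<otimes> fst Z) \<bullet> ?\<alpha>"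
    by (simp only: act_T)
  finally show ?thesis .
qed

lemma \<kappa>_act_middle:
  "\<kappa> X Y Z \<bullet> (act_second X Y \<lhd> fst Z) =
    q X (Y \<odot> Z) \<bullet> (fst X \<rhd> (q Y Z \<bullet> act_first Y Z)) \<bullet> B K (fst X) (fst Y \<otimes> fst Z) \<bullet>
      (K \<rhd> \<alpha> (fst X) (fst Y) (fst Z)) \<bullet> \<alpha> K (fst X \<otimes> fst Y) (fst Z)"
proof -
  let ?T = "Y \<odot> Z" and ?x = "fst X" and ?y = "fst Y" and ?z = "fst Z"
  have 1: "act Y \<lhd> ?z = act_first Y Z \<bullet> \<alpha> K ?y ?z"
    by (simp add: act_first_def lift_\<alpha>)
  have "\<kappa> X Y Z \<bullet> (act_second X Y \<lhd> ?z) =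
      q X ?T \<bullet> (?x \<rhd> q Y Z) \<bullet> (?x \<rhd> (act Y \<lhd> ?z)) \<bullet> \<alpha> ?x (K \<otimes> ?y) ?z \<bullet> (B K ?x ?y \<lhd> ?z)"
    by (simp add: \<kappa>_def act_second_def past_def reassoc [OF \<alpha>_natural_whisker(2)])
  also have "\<dots> = q X ?T \<bullet> (?x \<rhd> q Y Z) \<bullet> (?x \<rhd> act_first Y Z) \<bullet>
      ((?x \<rhd> \<alpha> K ?y ?z) \<bullet> \<alpha> ?x (K \<otimes> ?y) ?z \<bullet> (B K ?x ?y \<lhd> ?z))"
    by (simp add: 1)
  also have "\<dots> = q X ?T \<bullet> (?x \<rhd> (q Y Z \<bullet> act_first Y Z)) \<bullet> B K ?x (?y \<otimes> ?z) \<bullet>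
      (K \<rhd> \<alpha> ?x ?y ?z) \<bullet> \<alpha> K (?x \<otimes> ?y) ?z"
    by (simp add: B_assoc)
  finally show ?thesis .
qed

lemma \<kappa>_act_right:
  "\<kappa> X Y Z \<bullet> past (fst X \<otimes> fst Y) (act Z) =
    q X (Y \<odot> Z) \<bullet> (fst X \<rhd> (q Y Z \<bullet> act_first Y Z)) \<bullet> B K (fst X) (fst Y \<otimes> fst Z) \<bullet>
      (K \<rhd> \<alpha> (fst X) (fst Y) (fst Z))"
proof -
  let ?T = "Y \<odot> Z" and ?x = "fst X" and ?y = "fst Y" and ?z = "fst Z"
  have "\<kappa> X Y Z \<bullet> past (?x \<otimes> ?y) (act Z) =
      q X ?T \<bullet> (?x \<rhd> q Y Z) \<bullet> (?x \<rhd> (?y \<rhd> act Z)) \<bullet> (\<alpha> ?x ?y (K \<otimes> ?z) \<bullet> B K (?x \<otimes> ?y) ?z)"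
    by (simp add: \<kappa>_def past_def reassoc [OF \<alpha>_natural_whisker(3)])
  also have "\<dots> = q X ?T \<bullet> (?x \<rhd> (q Y Z \<bullet> act_second Y Z)) \<bullet> B K ?x (?y \<otimes> ?z) \<bullet> (K \<rhd> \<alpha> ?x ?y ?z)"
    by (simp add: B_hexagon1 act_second_def past_def)
  also have "\<dots> = q X ?T \<bullet> (?x \<rhd> (q Y Z \<bullet> act_first Y Z)) \<bullet> B K ?x (?y \<otimes> ?z) \<bullet> (K \<rhd> \<alpha> ?x ?y ?z)"
    by (simp only: q_coequalizes Y Z)
  finally show ?thesis .
qed

end

context
  fixes U V Z
  assumes U [simp]: "obj U" and V [simp]: "obj V" and Z [simp]: "Z \<in> Mod"
begin

lemma tensA_free_act_q: "act (F V \<odot> Z) \<bullet> (K \<rhd> q (F V) Z) =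
    q (F V) Z \<bullet> act_first (F V) Z"
  using transported_action_q [of V Z] by (simp only: act_tensA V Z)

text \<open>
  \<open>\<kappa>\<close> descends first along \<open>X \<otimes> Y \<rightarrow> X \<otimes>\<^sub>A Y\<close>, by \<open>\<kappa>_act_left\<close> and \<open>\<kappa>_act_middle\<close>, where the splitting
  gives the factor explicitly, and then along the outer quotient map, by \<open>\<kappa>_act_right\<close>.
\<close>

definition assoc_arrow :: "('o, 'm) arrow" where
  "assoc_arrow = desc (F U \<odot> F V) Z
    (\<kappa> (F U) (F V) Z \<bullet>
      ((split_s U (act (F V)) \<bullet> P' U (F V)) \<lhd> fst Z))"

lemma assoc_arrow:
  fixes h
  defines "X \<equiv> F U" and "Y \<equiv> F V"
  shows "arr assoc_arrow" "src assoc_arrow = Q (X \<odot> Y) Z"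
    "trg assoc_arrow = Q X (Y \<odot> Z)"
    "assoc_arrow \<bullet> q (X \<odot> Y) Z \<bullet> (q X Y \<lhd> fst Z) = \<kappa> X Y Z"
    "mor assoc_arrow = assocA C A X Y Z"
proof -
  have X [simp]: "X \<in> Mod" and Y [simp]: "Y \<in> Mod"
    and xy: "fst X = K \<otimes> U" "fst Y = K \<otimes> V"
    by (simp_all add: X_def Y_def)
  have TX [simp]: "X \<odot> Y \<in> Mod" and TY [simp]: "Y \<odot> Z \<in> Mod"
    by (simp_all add: X_def Y_def)
  have actY: "act (Y \<odot> Z) \<bullet> (K \<rhd> q Y Z) = q Y Z \<bullet> act_first Y Z"
    unfolding Y_def by (rule tensA_free_act_q)
  have actX: "act (X \<odot> Y) \<bullet> (K \<rhd> q X Y) = q X Y \<bullet> act_first X Y"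
    using transported_action_q [of U Y] act_tensA [of U Y] by (simp only: X_def U Y)
  note \<kappa>_simps' [simp] = \<kappa>_simps [OF X Y Z TY actY]
  let ?z = "fst Z" and ?Q = "Q X Y"
  let ?s = "split_s U (act Y) \<bullet> P' U Y"
  have s [simp]: "arr (split_s U (act Y))" "src (split_s U (act Y)) = U \<otimes> fst Y"
      "trg (split_s U (act Y)) = fst X \<otimes> fst Y" "arr (P' U Y)" "src (P' U Y) = ?Q"
      "trg (P' U Y) = U \<otimes> fst Y"
    using split_simps [of U "act Y"] P'_simps [of U Y] by (simp_all add: X_def)
  let ?k = "\<kappa> X Y Z \<bullet> (?s \<lhd> ?z)"
  have k [simp]: "arr ?k" "src ?k = ?Q \<otimes> ?z" "trg ?k = Q X (Y \<odot> Z)"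
    by simp_all
  have k_q: "?k \<bullet> (q X Y \<lhd> ?z) = \<kappa> X Y Z"
  proof -
    have "?s \<bullet> q X Y = split_s U (act Y) \<bullet> split_r U (act Y)"
      using P'_simps(4) [of U Y] by (simp add: X_def)
    moreover have "?k \<bullet> (q X Y \<lhd> ?z) = \<kappa> X Y Z \<bullet> ((?s \<bullet> q X Y) \<lhd> ?z)"
      by simp
    moreover have "\<kappa> X Y Z \<bullet> ((split_s U (act Y) \<bullet> split_r U (act Y)) \<lhd> ?z) = \<kappa> X Y Z"
    proof (rule coequalizing_split [of U Y])
      show "\<kappa> X Y Z \<bullet> (act_first (F U) Y \<lhd> ?z) = \<kappa> X Y Z \<bullet> (act_second (F U) Y \<lhd> ?z)"
        unfolding X_def [symmetric] by (simp only: \<kappa>_act_left [OF X Y Z TY actY] \<kappa>_act_middle [OF X Y Z TY actY])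
    qed (simp_all add: xy)
    ultimately show ?thesis by simp
  qed
  have split: "q X Y \<bullet> ?s = ide ?Q"
    using q_split [of U Y] by (simp add: X_def)
  have split_z: "(q X Y \<lhd> ?z) \<bullet> (?s \<lhd> ?z) = ide (trg (q X Y \<lhd> ?z))"
  proof -
    have "(q X Y \<lhd> ?z) \<bullet> (?s \<lhd> ?z) = (q X Y \<bullet> ?s) \<lhd> ?z"
      by (subst whisker_comp(2)) simp_all
    then show ?thesis by (simp only: split) simp
  qed
  have split_Kz: "(K \<rhd> (q X Y \<lhd> ?z)) \<bullet> (K \<rhd> (?s \<lhd> ?z)) = ide (trg (K \<rhd> (q X Y \<lhd> ?z)))"
  proof -
    have "(K \<rhd> (q X Y \<lhd> ?z)) \<bullet> (K \<rhd> (?s \<lhd> ?z)) = K \<rhd> ((q X Y \<lhd> ?z) \<bullet> (?s \<lhd> ?z))"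
      by (subst whisker_comp(1)) simp_all
    then show ?thesis by (simp only: split_z) simp
  qed
  \<comment> \<open>The two actions on \<open>(X \<otimes>\<^sub>A Y) \<otimes> Z\<close> are compared on \<open>A \<otimes> ((X \<otimes> Y) \<otimes> Z)\<close>.\<close>
  have "?k \<bullet> act_first (X \<odot> Y) Z = ?k \<bullet> act_second (X \<odot> Y) Z"
  proof (rule split_epi_cancel [OF split_Kz])
    have "act_first (X \<odot> Y) Z \<bullet> (K \<rhd> (q X Y \<lhd> ?z)) =
        lift K (fst X \<otimes> fst Y) ?z (act (X \<odot> Y) \<bullet> (K \<rhd> q X Y))"
      by (subst lift_comp_left) (simp_all add: act_first_def)
    also have "\<dots> = (q X Y \<lhd> ?z) \<bullet> lift K (fst X \<otimes> fst Y) ?z (act_first X Y)"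
      unfolding actX by (rule lift_comp) simp_all
    finally have "(?k \<bullet> act_first (X \<odot> Y) Z) \<bullet> (K \<rhd> (q X Y \<lhd> ?z)) =
        (?k \<bullet> (q X Y \<lhd> ?z)) \<bullet> lift K (fst X \<otimes> fst Y) ?z (act_first X Y)"
      by (simp only: comp_assoc)
    also have "\<dots> = (\<kappa> X Y Z \<bullet> (act_first X Y \<lhd> ?z)) \<bullet> \<alpha>' K (fst X \<otimes> fst Y) ?z"
      by (simp only: k_q) (simp only: lift_def comp_assoc)
    also have "\<dots> = \<kappa> X Y Z \<bullet> past (fst X \<otimes> fst Y) (act Z)"
      by (simp only: \<kappa>_act_left [OF X Y Z TY actY] \<kappa>_act_right [OF X Y Z TY actY]) simp
    also have "\<dots> = (?k \<bullet> (q X Y \<lhd> ?z)) \<bullet> past (fst X \<otimes> fst Y) (act Z)"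
      by (simp only: k_q)
    also have "\<dots> = ?k \<bullet> act_second (X \<odot> Y) Z \<bullet> (K \<rhd> (q X Y \<lhd> ?z))"
    proof -
      have "act_second (X \<odot> Y) Z \<bullet> (K \<rhd> (q X Y \<lhd> ?z)) = (q X Y \<lhd> ?z) \<bullet> past (fst X \<otimes> fst Y) (act Z)"
        by (simp add: act_second_def past_def B_natural reassoc [OF slide])
      then show ?thesis by (simp only: comp_assoc)
    qed
    finally show "(?k \<bullet> act_first (X \<odot> Y) Z) \<bullet> (K \<rhd> (q X Y \<lhd> ?z)) =
        (?k \<bullet> act_second (X \<odot> Y) Z) \<bullet> (K \<rhd> (q X Y \<lhd> ?z))"
      by (simp only: comp_assoc)
  qed simp_all
  note d = desc_simps [OF TX Z _ _ this]
  have eq: "assoc_arrow = desc (X \<odot> Y) Z ?k"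
    by (simp only: assoc_arrow_def X_def Y_def)
  show a: "arr assoc_arrow" "src assoc_arrow = Q (X \<odot> Y) Z"
    "trg assoc_arrow = Q X (Y \<odot> Z)"
    unfolding eq by (subst d; simp)+
  have dq: "assoc_arrow \<bullet> q (X \<odot> Y) Z = ?k"
    unfolding eq by (rule d(4)) simp_all
  have "assoc_arrow \<bullet> q (X \<odot> Y) Z \<bullet> (q X Y \<lhd> ?z) = ?k \<bullet> (q X Y \<lhd> ?z)"
    by (rule reassoc [OF dq])
  then show aq: "assoc_arrow \<bullet> q (X \<odot> Y) Z \<bullet> (q X Y \<lhd> ?z) = \<kappa> X Y Z"
    by (simp only: k_q)
  show "mor assoc_arrow = assocA C A X Y Z"
    unfolding assocA_def
  proof (rule the_equality [symmetric])
    have "mor (assoc_arrow \<bullet> q (X \<odot> Y) Z \<bullet> (q X Y \<lhd> ?z)) = mor (\<kappa> X Y Z)"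
      by (simp only: aq)
    then show "mor assoc_arrow \<in> Hom C (Q (X \<odot> Y) Z) (Q X (Y \<odot> Z)) \<and>
        mor assoc_arrow \<cdot> quot_map C A (X \<odot> Y) Z \<cdot> (quot_map C A X Y \<boxtimes> Id C ?z) =
        quot_map C A X (Y \<odot> Z) \<cdot> (Id C (fst X) \<boxtimes> quot_map C A Y Z) \<cdot>
          Assoc C (fst X) (fst Y) ?z"
      using mor_in_Hom [OF a] by (simp add: a \<kappa>_def)
  next
    fix h assume h: "h \<in> Hom C (Q (X \<odot> Y) Z) (Q X (Y \<odot> Z)) \<and>
        h \<cdot> quot_map C A (X \<odot> Y) Z \<cdot> (quot_map C A X Y \<boxtimes> Id C ?z) =
        quot_map C A X (Y \<odot> Z) \<cdot> (Id C (fst X) \<boxtimes> quot_map C A Y Z) \<cdot>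
          Assoc C (fst X) (fst Y) ?z"
    let ?h = "Arrow (Q (X \<odot> Y) Z) (Q X (Y \<odot> Z)) h"
    have "?h \<bullet> q (X \<odot> Y) Z \<bullet> (q X Y \<lhd> ?z) = \<kappa> X Y Z"
      by (rule arrow_eqI) (use h in \<open>simp_all add: \<kappa>_def\<close>)
    then have "(?h \<bullet> q (X \<odot> Y) Z) \<bullet> (q X Y \<lhd> ?z) = (assoc_arrow \<bullet> q (X \<odot> Y) Z) \<bullet> (q X Y \<lhd> ?z)"
      by (simp only: aq comp_assoc)
    then have hq: "?h \<bullet> q (X \<odot> Y) Z = assoc_arrow \<bullet> q (X \<odot> Y) Z"
      by (rule split_epi_cancel [OF split_z]) (use h a in simp_all)
    have "?h = assoc_arrow"
      by (rule q_epi [OF TX Z _ _ _ _ hq]) (use h a in simp_all)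
    then show "h = mor assoc_arrow" by (metis arrow.sel(3))
  qed
qed

end

text \<open>Both sides insert the units of \<open>F(V)\<close> and \<open>F(W)\<close> and then apply the quotient maps; the orders of bracketing
  are compared by the pentagon.\<close>

lemma J_assoc:
  assumes [simp]: "obj U" "obj V" "obj W"
  shows "assoc_arrow U V (F W) \<bullet>
      induced (F (U \<otimes> V)) (F U \<odot> F V) (F W) (F W)
        (J U V) (ide (K \<otimes> W)) \<bullet> J (U \<otimes> V) W =
    induced (F U) (F U) (F (V \<otimes> W)) (F V \<odot> F W)
        (ide (K \<otimes> U)) (J V W) \<bullet> J U (V \<otimes> W) \<bullet> (K \<rhd> \<alpha> U V W)"
proof -
  let ?X = "F U" and ?Y = "F V" and ?Z = "F W"
  have idZ: "hom ?Z ?Z (ide (K \<otimes> W))" and idX: "hom ?X ?X (ide (K \<otimes> U))"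
    using hom_ide [of ?Z] hom_ide [of ?X] by simp_all
  note tm1 = induced_simps [OF _ _ _ _ J_iso(1) [of U V] idZ, simplified]
  note tm2 = induced_simps [OF _ _ _ _ idX J_iso(1) [of V W], simplified]
  note as = assoc_arrow [of U V ?Z, simplified]
  define c where "c = q ?X (?Y \<odot> ?Z) \<bullet> ((K \<otimes> U) \<rhd> q ?Y ?Z) \<bullet> ((K \<otimes> U) \<rhd> ((K \<otimes> V) \<rhd> \<eta> W)) \<bullet>
      ((K \<otimes> U) \<rhd> (\<eta> V \<lhd> W)) \<bullet> \<alpha>' K U (V \<otimes> W) \<bullet> (K \<rhd> \<alpha> U V W)"
  have "assoc_arrow U V ?Z \<bullet>
      induced (F (U \<otimes> V)) (?X \<odot> ?Y) ?Z ?Z (J U V) (ide (K \<otimes> W)) \<bullet> J (U \<otimes> V) W =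
      (assoc_arrow U V ?Z \<bullet> q (?X \<odot> ?Y) ?Z \<bullet> (q ?X ?Y \<lhd> (K \<otimes> W))) \<bullet>
        (((K \<otimes> U) \<rhd> \<eta> V) \<lhd> (K \<otimes> W)) \<bullet> (\<alpha>' K U V \<lhd> (K \<otimes> W)) \<bullet>
        ((K \<otimes> (U \<otimes> V)) \<rhd> \<eta> W) \<bullet> \<alpha>' K (U \<otimes> V) W"
    by (simp add: J_def [of "U \<otimes> V"] reassoc [OF tm1(4)]) (simp add: J_def)
  also have "\<dots> = \<kappa> ?X ?Y ?Z \<bullet> (((K \<otimes> U) \<rhd> \<eta> V) \<lhd> (K \<otimes> W)) \<bullet> (\<alpha>' K U V \<lhd> (K \<otimes> W)) \<bullet>
        ((K \<otimes> (U \<otimes> V)) \<rhd> \<eta> W) \<bullet> \<alpha>' K (U \<otimes> V) W"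
    by (simp only: as(4))
  also have "\<dots> = \<kappa> ?X ?Y ?Z \<bullet> (((K \<otimes> U) \<otimes> (K \<otimes> V)) \<rhd> \<eta> W) \<bullet> (((K \<otimes> U) \<rhd> \<eta> V) \<lhd> W) \<bullet>
        (\<alpha>' K U V \<lhd> W) \<bullet> \<alpha>' K (U \<otimes> V) W"
    by (simp add: reassoc [OF slide [of "\<alpha>' K U V" "\<eta> W", symmetric]]
        reassoc [OF slide [of "(K \<otimes> U) \<rhd> \<eta> V" "\<eta> W", symmetric]])
  also have "\<dots> = q ?X (?Y \<odot> ?Z) \<bullet> ((K \<otimes> U) \<rhd> q ?Y ?Z) \<bullet> ((K \<otimes> U) \<rhd> ((K \<otimes> V) \<rhd> \<eta> W)) \<bullet>
      ((K \<otimes> U) \<rhd> (\<eta> V \<lhd> W)) \<bullet> \<alpha> (K \<otimes> U) V W \<bullet> (\<alpha>' K U V \<lhd> W) \<bullet> \<alpha>' K (U \<otimes> V) W"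
    by (simp add: \<kappa>_def reassoc [OF \<alpha>_natural_whisker(3)] reassoc [OF \<alpha>_natural_whisker(2)])
  also have "\<dots> = c"
    by (simp add: c_def pentagon_\<alpha>')
  finally have lhs: "assoc_arrow U V ?Z \<bullet>
      induced (F (U \<otimes> V)) (?X \<odot> ?Y) ?Z ?Z (J U V) (ide (K \<otimes> W)) \<bullet> J (U \<otimes> V) W = c" .
  have "J V W \<bullet> \<eta> (V \<otimes> W) = q ?Y ?Z \<bullet> ((K \<otimes> V) \<rhd> \<eta> W) \<bullet> (\<eta> V \<lhd> W)"
    by (simp add: J_def \<eta>_tens)
  then have w: "((K \<otimes> U) \<rhd> J V W) \<bullet> ((K \<otimes> U) \<rhd> \<eta> (V \<otimes> W)) =
      (K \<otimes> U) \<rhd> (q ?Y ?Z \<bullet> ((K \<otimes> V) \<rhd> \<eta> W) \<bullet> (\<eta> V \<lhd> W))"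
    by (subst whisker_comp(1) [symmetric]) simp_all
  have "induced ?X ?X (F (V \<otimes> W)) (?Y \<odot> ?Z) (ide (K \<otimes> U)) (J V W) \<bullet>
      J U (V \<otimes> W) \<bullet> (K \<rhd> \<alpha> U V W) = c"
    by (simp add: J_def [of U] reassoc [OF tm2(4)] reassoc [OF w] c_def)
  with lhs show ?thesis by simp
qed

subsection \<open>Compatibility with the units\<close>

lemma Rep_unit_simps [simp]:
  "fst (Rep_unit A) = K" "act (Rep_unit A) = \<mu>" "Rep_unit A \<in> Mod"
proof -
  show *: "fst (Rep_unit A) = K" "act (Rep_unit A) = \<mu>"
    by (simp_all add: Rep_unit_def act_def \<mu>_def)
  have "\<mu> \<bullet> lift K K K \<mu> = \<mu> \<bullet> (K \<rhd> \<mu>)"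
    by (simp add: lift_def reassoc [OF \<mu>_assoc])
  then show "Rep_unit A \<in> Mod"
    by (simp add: Rep_Ob_iff * is_action_def \<mu>_unit_left)
qed

definition lunit :: "'o \<times> 'm \<Rightarrow> ('o, 'm) arrow" where
  "lunit X = desc (Rep_unit A) X (act X)"

definition runit :: "'o \<times> 'm \<Rightarrow> ('o, 'm) arrow" where
  "runit X = desc X (Rep_unit A) (act X \<bullet> R' K (fst X))"

lemma lunit:
  assumes [simp]: "X \<in> Mod"
  shows "arr (lunit X)" "src (lunit X) = Q (Rep_unit A) X" "trg (lunit X) = fst X"
    "lunit X \<bullet> q (Rep_unit A) X = act X" "mor (lunit X) = lunA C A X"
proof -
  have eq: "act X \<bullet> act_first (Rep_unit A) X = act X \<bullet> act_second (Rep_unit A) X"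
    using act_past [of "act X"] by (simp add: act_first_def act_second_def act_assoc)
  show "arr (lunit X)" "src (lunit X) = Q (Rep_unit A) X" "trg (lunit X) = fst X"
    "lunit X \<bullet> q (Rep_unit A) X = act X"
    using desc_simps [OF _ _ _ _ eq] by (simp_all add: lunit_def)
  show "mor (lunit X) = lunA C A X"
    unfolding lunA_def lunit_def by (rule The_desc [OF _ _ _ _ eq, symmetric]) simp_all
qed

text \<open>
  The two actions on \<open>X \<otimes> A\<close> are compared with the right-hand copy of \<open>A\<close> braided to the left of \<open>X\<close>.  By the
  hexagons, one becomes the successive action of the two copies on \<open>X\<close> and the other the action of
  their product in the exchanged order.
\<close>

lemma runit:
  assumes [simp]: "X \<in> Mod"
  shows "arr (runit X)" "src (runit X) = Q X (Rep_unit A)" "trg (runit X) = fst X"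
    "runit X \<bullet> q X (Rep_unit A) = act X \<bullet> R' K (fst X)" "mor (runit X) = runA C A X"
proof -
  let ?x = "fst X" and ?m = "act X \<bullet> R' K (fst X)"
  have inv: "inverses ((K \<rhd> R K ?x) \<bullet> B K K ?x)
      (((\<alpha> K K ?x \<bullet> (R' K K \<lhd> ?x)) \<bullet> \<alpha>' K K ?x) \<bullet> (K \<rhd> R' K ?x))"
    by (intro inverses_trans inverses_B inverses_whisker inverses_R) simp_all
  have hex: "(K \<rhd> R K ?x) \<bullet> B K K ?x = \<alpha> K ?x K \<bullet> R K (K \<otimes> ?x)"
  proof (rule inverses_cancel_right [OF inverses_\<alpha> [of K K ?x]])
    show "((K \<rhd> R K ?x) \<bullet> B K K ?x) \<bullet> \<alpha> K K ?x = (\<alpha> K ?x K \<bullet> R K (K \<otimes> ?x)) \<bullet> \<alpha> K K ?x"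
      by (simp add: hexagon1_R B_def lift_\<alpha>)
  qed simp_all
  have first: "act_first X (Rep_unit A) \<bullet> (K \<rhd> R K ?x) \<bullet> B K K ?x = R K ?x \<bullet> (K \<rhd> act X)"
    by (simp add: hex) (simp add: act_first_def lift_def R_natural_whisker)
  have "act_second X (Rep_unit A) \<bullet> (K \<rhd> R K ?x) = (?x \<rhd> \<mu>) \<bullet> R (K \<otimes> K) ?x \<bullet> \<alpha>' K K ?x"
    by (simp add: act_second_def past_def R_hexagon2)
  also have "\<dots> = R K ?x \<bullet> lift K K ?x \<mu>"
    by (simp add: lift_def reassoc [OF R_natural_whisker(1)])
  finally have "act_second X (Rep_unit A) \<bullet> (K \<rhd> R K ?x) = R K ?x \<bullet> lift K K ?x \<mu>" .
  from reassoc [OF this] have "act_second X (Rep_unit A) \<bullet> (K \<rhd> R K ?x) \<bullet> B K K ?x = R K ?x \<bullet> lift K K ?x \<mu>"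
    by (simp add: lift_\<mu>_B)
  then have "(?m \<bullet> act_first X (Rep_unit A)) \<bullet> ((K \<rhd> R K ?x) \<bullet> B K K ?x) =
      (?m \<bullet> act_second X (Rep_unit A)) \<bullet> ((K \<rhd> R K ?x) \<bullet> B K K ?x)"
    by (simp add: first act_assoc)
  then have eq: "?m \<bullet> act_first X (Rep_unit A) = ?m \<bullet> act_second X (Rep_unit A)"
    by (rule inverses_cancel_right [OF inv]) simp_all
  have m: "arr ?m" "src ?m = fst X \<otimes> fst (Rep_unit A)"
    by simp_all
  show "arr (runit X)" "src (runit X) = Q X (Rep_unit A)" "trg (runit X) = fst X"
    "runit X \<bullet> q X (Rep_unit A) = act X \<bullet> R' K (fst X)"
    using desc_simps [OF _ _ m eq] by (simp_all add: runit_def)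
  show "mor (runit X) = runA C A X"
    unfolding runA_def runit_def by (rule The_desc [OF _ _ m eq, symmetric]) simp_all
qed

lemma F_unit_iso:
  shows "hom (F \<one>) (Rep_unit A) (ru K)"
    and "is_iso (Rep C A) (F \<one>) (Rep_unit A) (F_unit C A)"
proof -
  have "ru K \<bullet> lift K K \<one> \<mu> = \<mu> \<bullet> ((K \<rhd> ru K) \<bullet> \<alpha> K K \<one>) \<bullet> \<alpha>' K K \<one>"
    by (simp only: ru_tens K_object) (simp add: lift_def reassoc [OF ru_natural])
  then show hom: "hom (F \<one>) (Rep_unit A) (ru K)"
    by (simp add: hom_iff)
  have "is_iso (Rep C A) (F \<one>) (Rep_unit A) (mor (ru K))"
    using hom inverses_ru [of K] by (intro Rep_iso) simp_all
  then show "is_iso (Rep C A) (F \<one>) (Rep_unit A) (F_unit C A)"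
    by (simp add: F_unit_def)
qed

text \<open>The units cancel by \<open>free_\<eta>\<close>, and the triangle remains.\<close>

lemma J_lunit:
  assumes [simp]: "obj V"
  shows "lunit (F V) \<bullet>
      induced (F \<one>) (Rep_unit A) (F V) (F V) (ru K) (ide (K \<otimes> V)) \<bullet> J \<one> V =
    K \<rhd> lu V"
proof -
  have id: "hom (F V) (F V) (ide (K \<otimes> V))"
    using hom_ide [of "F V"] by simp
  note induced = induced_simps [OF _ _ _ _ F_unit_iso(1) id, simplified]
  have "lunit (F V) \<bullet>
      induced (F \<one>) (Rep_unit A) (F V) (F V) (ru K) (ide (K \<otimes> V)) \<bullet> J \<one> V =
      lift K K V \<mu> \<bullet> (ru K \<lhd> (K \<otimes> V)) \<bullet> ((K \<otimes> \<one>) \<rhd> \<eta> V) \<bullet> \<alpha>' K \<one> V"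
    by (simp add: J_def reassoc [OF induced(4)] reassoc [OF lunit(4)])
  also have "\<dots> = (lift K K V \<mu> \<bullet> (K \<rhd> \<eta> V)) \<bullet> (ru K \<lhd> V) \<bullet> \<alpha>' K \<one> V"
    by (simp add: reassoc [OF slide [symmetric]])
  also have "\<dots> = K \<rhd> lu V"
    by (simp only: free_\<eta> assms) (simp flip: triangle_\<alpha>)
  finally show ?thesis .
qed

lemma J_runit:
  assumes [simp]: "obj V"
  shows "runit (F V) \<bullet>
      induced (F V) (F V) (F \<one>) (Rep_unit A) (ide (K \<otimes> V)) (ru K) \<bullet> J V \<one> =
    K \<rhd> ru V"
proof -
  have id: "hom (F V) (F V) (ide (K \<otimes> V))"
    using hom_ide [of "F V"] by simp
  note induced = induced_simps [OF _ _ _ _ id F_unit_iso(1), simplified]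
  have \<eta>1: "ru K \<bullet> \<eta> \<one> = \<iota>"
    by (simp add: \<eta>_def reassoc [OF ru_natural] flip: lu_unit)
  have R\<iota>: "R' K (K \<otimes> V) \<bullet> ((K \<otimes> V) \<rhd> \<iota>) = (\<iota> \<lhd> (K \<otimes> V)) \<bullet> R' \<one> (K \<otimes> V)"
  proof (rule inverses_cancel_left [OF inverses_R [of K "K \<otimes> V"]])
    show "R K (K \<otimes> V) \<bullet> (R' K (K \<otimes> V) \<bullet> ((K \<otimes> V) \<rhd> \<iota>)) =
        R K (K \<otimes> V) \<bullet> ((\<iota> \<lhd> (K \<otimes> V)) \<bullet> R' \<one> (K \<otimes> V))"
      by (simp add: reassoc [OF R_natural_whisker(1)])
  qed simp_all
  have unit: "lift K K V \<mu> \<bullet> (\<iota> \<lhd> (K \<otimes> V)) = ru (K \<otimes> V) \<bullet> R \<one> (K \<otimes> V)"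
    using is_actionD(3) [OF is_action_free [of V]] by (simp add: ru_R)
  have "runit (F V) \<bullet>
      induced (F V) (F V) (F \<one>) (Rep_unit A) (ide (K \<otimes> V)) (ru K) \<bullet> J V \<one> =
      lift K K V \<mu> \<bullet> R' K (K \<otimes> V) \<bullet> ((K \<otimes> V) \<rhd> (ru K \<bullet> \<eta> \<one>)) \<bullet> \<alpha>' K V \<one>"
    by (simp add: J_def reassoc [OF induced(4)] reassoc [OF runit(4)])
  also have "\<dots> = (lift K K V \<mu> \<bullet> (\<iota> \<lhd> (K \<otimes> V))) \<bullet> R' \<one> (K \<otimes> V) \<bullet> \<alpha>' K V \<one>"
    by (simp only: \<eta>1) (simp add: reassoc [OF R\<iota>])
  also have "\<dots> = (ru (K \<otimes> V) \<bullet> R \<one> (K \<otimes> V)) \<bullet> R' \<one> (K \<otimes> V) \<bullet> \<alpha>' K V \<one>"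
    by (simp only: unit)
  also have "\<dots> = K \<rhd> ru V"
    by (simp flip: ru_tens)
  finally show ?thesis .
qed

subsection \<open>The tensor functor\<close>

lemma F_linear: "linear_functor C (Rep C A) (F_ob C A) (F_mor C A)"
proof
  fix a b f
  assume [simp]: "obj a" "obj b" and f: "f \<in> Hom C a b"
  have "hom (F a) (F b) (K \<rhd> Arrow a b f)"
    using hom_free [of "Arrow a b f"] f by simp
  from modules.homD(4) [OF this] show "F_mor C A f \<in> HomA (F a) (F b)"
    using f by (simp add: F_mor_def)
next
  fix a assume "obj a"
  then show "F_mor C A (Id C a) = Id (Rep C A) (F a)"
    by (simp add: F_mor_def TensM_Id)
next
  fix a b c f g
  assume "obj a" "obj b" "obj c" "f \<in> Hom C a b" "g \<in> Hom C b c"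
  then show "F_mor C A (g \<cdot> f) = F_mor C A g \<cdot>\<^bsub>Rep C A\<^esub> F_mor C A f"
    using TensM_Cmp [of K K K a b c "Id C K" "Id C K" f g]
    by (simp add: F_mor_def Id_in_Hom Cmp_Id_left [of K K])
qed (simp_all add: F_mor_def TensM_add_right [of K K] TensM_Scl_right [of K K] Id_in_Hom)

lemma F_tensor_functor:
  "tensor_functor_to_Rep C A (F_ob C A) (F_mor C A) (F_tens C A) (F_unit C A)"
  unfolding tensor_functor_to_Rep_def
proof (intro conjI ballI)
  show "linear_functor C (Rep C A) (F_ob C A) (F_mor C A)"
    by (rule F_linear)
next
  fix V W assume "obj V" "obj W"
  then show "is_iso (Rep C A) (F (V \<otimes> W)) (F V \<odot> F W) (F_tens C A V W)"
    by (rule J_iso(2))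
next
  fix V V' W W' f g
  assume [simp]: "obj V" "obj V'" "obj W" "obj W'" "f \<in> Hom C V V'" "g \<in> Hom C W W'"
  let ?f = "Arrow V V' f" and ?g = "Arrow W W' g"
  note induced = induced_simps [OF _ _ _ _ hom_free [of ?f] hom_free [of ?g], simplified]
  have "mor (J V' W' \<bullet> (K \<rhd> (?f \<star> ?g))) =
      mor (induced (F V) (F V') (F W) (F W') (K \<rhd> ?f) (K \<rhd> ?g) \<bullet> J V W)"
    using J_natural [of ?f ?g] by simp
  then show "F_tens C A V' W' \<cdot> F_mor C A (f \<boxtimes> g) =
      tensA_mor C A (F V) (F V') (F W) (F W') (F_mor C A f) (F_mor C A g) \<cdot>
        F_tens C A V W"
    by (simp add: induced F_mor_def)
next
  show "is_iso (Rep C A) (F \<one>) (Rep_unit A) (F_unit C A)"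
    by (rule F_unit_iso(2))
next
  fix U V W
  assume [simp]: "obj U" "obj V" "obj W"
  let ?X = "F U" and ?Y = "F V" and ?Z = "F W"
  have idZ: "hom ?Z ?Z (ide (K \<otimes> W))" and idX: "hom ?X ?X (ide (K \<otimes> U))"
    using hom_ide [of ?Z] hom_ide [of ?X] by simp_all
  note tm1 = induced_simps [OF _ _ _ _ J_iso(1) [of U V] idZ, simplified]
  note tm2 = induced_simps [OF _ _ _ _ idX J_iso(1) [of V W], simplified]
  note as = assoc_arrow [of U V ?Z, simplified]
  show "assocA C A ?X ?Y ?Z \<cdot>
        tensA_mor C A (F (U \<otimes> V)) (?X \<odot> ?Y) ?Z ?Z (F_tens C A U V) (Id C (fst ?Z)) \<cdot>
        F_tens C A (U \<otimes> V) W =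
      tensA_mor C A ?X ?X (F (V \<otimes> W)) (?Y \<odot> ?Z) (Id C (fst ?X)) (F_tens C A V W) \<cdot>
        F_tens C A U (V \<otimes> W) \<cdot> F_mor C A (Assoc C U V W)"
    using arg_cong [OF J_assoc [of U V W], of mor] by (simp add: tm1 tm2 as F_mor_def)
next
  fix V assume [simp]: "obj V"
  have id: "hom (F V) (F V) (ide (K \<otimes> V))"
    using hom_ide [of "F V"] by simp
  note tm1 = induced_simps [OF _ _ _ _ F_unit_iso(1) id, simplified]
  note tm2 = induced_simps [OF _ _ _ _ id F_unit_iso(1), simplified]
  show "lunA C A (F V) \<cdot>
        tensA_mor C A (F \<one>) (Rep_unit A) (F V) (F V) (F_unit C A)
          (Id C (fst (F V))) \<cdot> F_tens C A \<one> V = F_mor C A (Lun C V)"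
    using arg_cong [OF J_lunit [of V], of mor] by (simp add: tm1 lunit F_mor_def F_unit_def)
  show "runA C A (F V) \<cdot>
        tensA_mor C A (F V) (F V) (F \<one>) (Rep_unit A) (Id C (fst (F V)))
          (F_unit C A) \<cdot> F_tens C A V \<one> = F_mor C A (Run C V)"
    using arg_cong [OF J_runit [of V], of mor] by (simp add: tm2 runit F_mor_def F_unit_def)
qed

end

section \<open>Dualizable objects\<close>

context monoidal_category
begin

definition dual_unit :: "'o \<Rightarrow> 'o \<Rightarrow> 'm \<Rightarrow> 'o \<Rightarrow> ('o, 'm) arrow" where
  "dual_unit v w c x = \<alpha> v w x \<bullet> (Arrow \<one> (v \<otimes> w) c \<lhd> x) \<bullet> lu' x"

definition dual_counit :: "'o \<Rightarrow> 'o \<Rightarrow> 'm \<Rightarrow> 'o \<Rightarrow> ('o, 'm) arrow" where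
  "dual_counit v w e x = lu x \<bullet> lift w v x (Arrow (w \<otimes> v) \<one> e)"

context
  fixes v w e c
  assumes dual: "dual_pair C v w e c"
begin

lemma dual_objects [simp]:
  "obj v" "obj w" "e \<in> Hom C (w \<otimes> v) \<one>" "c \<in> Hom C \<one> (v \<otimes> w)"
  using dual by (auto simp: dual_pair_def)

lemma dual_unit_simps [simp]:
  assumes "obj x"
  shows "arr (dual_unit v w c x)" "src (dual_unit v w c x) = x"
    "trg (dual_unit v w c x) = v \<otimes> (w \<otimes> x)"
  using assms by (simp_all add: dual_unit_def)

lemma dual_counit_simps [simp]:
  assumes "obj x"
  shows "arr (dual_counit v w e x)" "src (dual_counit v w e x) = w \<otimes> (v \<otimes> x)"
    "trg (dual_counit v w e x) = x"
  using assms by (simp_all add: dual_counit_def)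

lemma dual_unit_natural:
  assumes [simp]: "arr f" "y = trg f"
  shows "dual_unit v w c y \<bullet> f = (v \<rhd> (w \<rhd> f)) \<bullet> dual_unit v w c (src f)"
proof -
  have "dual_unit v w c y \<bullet> f = \<alpha> v w y \<bullet> (Arrow \<one> (v \<otimes> w) c \<lhd> y) \<bullet> (\<one> \<rhd> f) \<bullet> lu' (src f)"
    by (simp add: dual_unit_def lu'_natural)
  also have "\<dots> = \<alpha> v w y \<bullet> ((v \<otimes> w) \<rhd> f) \<bullet> (Arrow \<one> (v \<otimes> w) c \<lhd> src f) \<bullet> lu' (src f)"
    by (simp add: reassoc [OF slide [symmetric]])
  also have "\<dots> = (v \<rhd> (w \<rhd> f)) \<bullet> dual_unit v w c (src f)"
    by (simp add: dual_unit_def reassoc [OF \<alpha>_natural_whisker(3)])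
  finally show ?thesis .
qed

lemma dual_counit_natural:
  assumes [simp]: "arr f" "y = trg f"
  shows "dual_counit v w e y \<bullet> (w \<rhd> (v \<rhd> f)) = f \<bullet> dual_counit v w e (src f)"
  by (simp add: dual_counit_def lift_natural reassoc [OF lu_natural])

text \<open>The zigzag identities of the dual pair, tensored with \<open>x\<close>, are the triangle identities of the
  adjunction between tensoring with \<open>w\<close> and tensoring with \<open>v\<close>.\<close>

lemma dual_triangle1:
  assumes [simp]: "obj x"
  shows "(v \<rhd> dual_counit v w e x) \<bullet> dual_unit v w c (v \<otimes> x) = ide (v \<otimes> x)"
proof -
  let ?e = "Arrow (w \<otimes> v) \<one> e" and ?c = "Arrow \<one> (v \<otimes> w) c"
  have zigzag: "ru v \<bullet> (v \<rhd> ?e) \<bullet> \<alpha> v w v \<bullet> (?c \<lhd> v) = lu v"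
    using dual by (intro arrow_eqI) (simp_all add: dual_pair_def)
  have inv: "inverses (lu (v \<otimes> x) \<bullet> \<alpha> \<one> v x) (\<alpha>' \<one> v x \<bullet> lu' (v \<otimes> x))"
    by (intro inverses_trans inverses_\<alpha> inverses_lu) simp_all
  have "((v \<rhd> dual_counit v w e x) \<bullet> dual_unit v w c (v \<otimes> x)) \<bullet> lu (v \<otimes> x) \<bullet> \<alpha> \<one> v x =
      (v \<rhd> dual_counit v w e x) \<bullet> \<alpha> v w (v \<otimes> x) \<bullet> (?c \<lhd> (v \<otimes> x)) \<bullet> \<alpha> \<one> v x"
    by (simp add: dual_unit_def)
  also have "\<dots> = (v \<rhd> dual_counit v w e x) \<bullet> \<alpha> v w (v \<otimes> x) \<bullet> \<alpha> (v \<otimes> w) v x \<bullet> ((?c \<lhd> v) \<lhd> x)"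
    by (simp add: \<alpha>_natural_whisker)
  also have "\<dots> = (v \<rhd> (lu x \<bullet> lift w v x ?e \<bullet> \<alpha> w v x)) \<bullet> \<alpha> v (w \<otimes> v) x \<bullet> (\<alpha> v w v \<lhd> x) \<bullet> ((?c \<lhd> v) \<lhd> x)"
    by (simp add: reassoc [OF pentagon_\<alpha> [symmetric]] dual_counit_def)
  also have "\<dots> = (v \<rhd> lu x) \<bullet> \<alpha> v \<one> x \<bullet> ((v \<rhd> ?e) \<lhd> x) \<bullet> (\<alpha> v w v \<lhd> x) \<bullet> ((?c \<lhd> v) \<lhd> x)"
    by (simp add: lift_\<alpha> reassoc [OF \<alpha>_natural_whisker(2)])
  also have "\<dots> = (ru v \<bullet> (v \<rhd> ?e) \<bullet> \<alpha> v w v \<bullet> (?c \<lhd> v)) \<lhd> x"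
    by (simp add: reassoc [OF triangle_\<alpha>])
  also have "\<dots> = ide (v \<otimes> x) \<bullet> lu (v \<otimes> x) \<bullet> \<alpha> \<one> v x"
    by (simp only: zigzag) (simp add: lu_tens)
  finally show ?thesis
    by (rule inverses_cancel_right [OF inv]) simp_all
qed

lemma dual_triangle2:
  assumes [simp]: "obj x"
  shows "dual_counit v w e (w \<otimes> x) \<bullet> (w \<rhd> dual_unit v w c x) = ide (w \<otimes> x)"
proof -
  let ?e = "Arrow (w \<otimes> v) \<one> e" and ?c = "Arrow \<one> (v \<otimes> w) c"
  have zigzag: "lu w \<bullet> (?e \<lhd> w) \<bullet> \<alpha>' w v w \<bullet> (w \<rhd> ?c) = ru w"
    using dual by (intro arrow_eqI) (simp_all add: dual_pair_def)
  have pent: "\<alpha>' w v (w \<otimes> x) \<bullet> (w \<rhd> \<alpha> v w x) \<bullet> \<alpha> w (v \<otimes> w) x = \<alpha> (w \<otimes> v) w x \<bullet> (\<alpha>' w v w \<lhd> x)"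
  proof (rule inverses_cancel_right [OF inverses_whisker(2) [OF inverses_\<alpha> [of w v w]]])
    show "(\<alpha>' w v (w \<otimes> x) \<bullet> (w \<rhd> \<alpha> v w x) \<bullet> \<alpha> w (v \<otimes> w) x) \<bullet> (\<alpha> w v w \<lhd> x) =
        (\<alpha> (w \<otimes> v) w x \<bullet> (\<alpha>' w v w \<lhd> x)) \<bullet> (\<alpha> w v w \<lhd> x)"
      by (simp add: pentagon_\<alpha>)
  qed simp_all
  have inv: "inverses ((w \<rhd> lu x) \<bullet> \<alpha> w \<one> x) (\<alpha>' w \<one> x \<bullet> (w \<rhd> lu' x))"
    by (intro inverses_trans inverses_\<alpha> inverses_whisker inverses_lu) simp_all
  have "(dual_counit v w e (w \<otimes> x) \<bullet> (w \<rhd> dual_unit v w c x)) \<bullet> (w \<rhd> lu x) \<bullet> \<alpha> w \<one> x =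
      dual_counit v w e (w \<otimes> x) \<bullet> (w \<rhd> \<alpha> v w x) \<bullet> (w \<rhd> (?c \<lhd> x)) \<bullet> (w \<rhd> (lu' x \<bullet> lu x)) \<bullet> \<alpha> w \<one> x"
    by (simp add: dual_unit_def del: lu_cancel)
  also have "\<dots> = dual_counit v w e (w \<otimes> x) \<bullet> (w \<rhd> \<alpha> v w x) \<bullet> \<alpha> w (v \<otimes> w) x \<bullet> ((w \<rhd> ?c) \<lhd> x)"
    by (simp add: \<alpha>_natural_whisker)
  also have "\<dots> = lu (w \<otimes> x) \<bullet> (?e \<lhd> (w \<otimes> x)) \<bullet> \<alpha> (w \<otimes> v) w x \<bullet> (\<alpha>' w v w \<lhd> x) \<bullet> ((w \<rhd> ?c) \<lhd> x)"
    by (simp add: dual_counit_def lift_def reassoc3 [OF pent])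
  also have "\<dots> = lu (w \<otimes> x) \<bullet> \<alpha> \<one> w x \<bullet> ((?e \<lhd> w) \<lhd> x) \<bullet> (\<alpha>' w v w \<lhd> x) \<bullet> ((w \<rhd> ?c) \<lhd> x)"
    by (simp add: reassoc [OF \<alpha>_natural_whisker(1)])
  also have "\<dots> = (lu w \<bullet> (?e \<lhd> w) \<bullet> \<alpha>' w v w \<bullet> (w \<rhd> ?c)) \<lhd> x"
    by (simp add: reassoc [OF lu_tens])
  also have "\<dots> = ide (w \<otimes> x) \<bullet> (w \<rhd> lu x) \<bullet> \<alpha> w \<one> x"
    by (simp only: zigzag) (simp add: triangle_\<alpha>)
  finally show ?thesis
    by (rule inverses_cancel_right [OF inv]) simp_all
qed

end

lemma mor_zero_whisker:
  assumes "obj a" "arr f" "mor f = 0"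
  shows "mor (a \<rhd> f) = 0"
  using assms TensM_add_right [of a a "src f" "trg f" "Id C a" 0 0]
  by (simp add: Id_in_Hom Hom_zero)

text \<open>Tensoring with \<open>v\<close> is right adjoint to tensoring with \<open>w\<close>.  So equations and factorizations are transposed to
  \<open>w \<otimes> -\<close>, solved there, and transposed back by the first triangle identity.\<close>

lemma dual_preserves_mono:
  assumes dual: "dual_pair C v w e c" and "arr i"
    and mono: "\<And>x y. arr x \<Longrightarrow> arr y \<Longrightarrow> src x = src y \<Longrightarrow> trg x = src i \<Longrightarrow> trg y = src i \<Longrightarrow>
      i \<bullet> x = i \<bullet> y \<Longrightarrow> x = y"
    and xy: "arr x" "arr y" "src x = src y" "trg x = v \<otimes> src i" "trg y = v \<otimes> src i"
    and eq: "(v \<rhd> i) \<bullet> x = (v \<rhd> i) \<bullet> y"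
  shows "x = y"
proof -
  note [simp] = dual_objects [OF dual] dual_unit_simps [OF dual] dual_counit_simps [OF dual] assms(2) xy
  let ?\<epsilon> = "dual_counit v w e"
  have *: "z = (v \<rhd> (?\<epsilon> (src i) \<bullet> (w \<rhd> z))) \<bullet> dual_unit v w c (src z)"
    if [simp]: "arr z" "trg z = v \<otimes> src i" for z
  proof -
    have "z = ((v \<rhd> ?\<epsilon> (src i)) \<bullet> dual_unit v w c (v \<otimes> src i)) \<bullet> z"
      by (simp only: dual_triangle1 [OF dual] arr_objects assms(2)) simp
    then show ?thesis by (simp add: dual_unit_natural [OF dual])
  qed
  have **: "i \<bullet> ?\<epsilon> (src i) \<bullet> (w \<rhd> z) = ?\<epsilon> (trg i) \<bullet> (w \<rhd> ((v \<rhd> i) \<bullet> z))"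
    if [simp]: "arr z" "trg z = v \<otimes> src i" for z
    by (simp add: reassoc [OF dual_counit_natural [OF dual]])
  have "i \<bullet> (?\<epsilon> (src i) \<bullet> (w \<rhd> x)) = i \<bullet> (?\<epsilon> (src i) \<bullet> (w \<rhd> y))"
    by (simp only: ** xy eq)
  then have "?\<epsilon> (src i) \<bullet> (w \<rhd> x) = ?\<epsilon> (src i) \<bullet> (w \<rhd> y)"
    by (rule mono [rotated -1]) simp_all
  then show "x = y"
    using * [of x] * [of y] xy by metis
qed

lemma dual_preserves_kernel:
  assumes dual: "dual_pair C v w e c" and ker: "is_kernel C a b f k i"
  shows "is_kernel C (v \<otimes> a) (v \<otimes> b) (Id C v \<boxtimes> f) (v \<otimes> k) (Id C v \<boxtimes> i)"
proof -
  let ?f = "Arrow a b f" and ?i = "Arrow k a i" and ?\<epsilon> = "dual_counit v w e" and ?\<eta> = "dual_unit v w c"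
  note k = kernelD [OF ker]
  note [simp] = dual_objects [OF dual] dual_unit_simps [OF dual] dual_counit_simps [OF dual]
  have o [simp]: "obj a" "obj b" "obj k" "f \<in> Hom C a b" "i \<in> Hom C k a"
    using k(1,2) by simp_all
  have "is_kernel C (src (v \<rhd> ?f)) (trg (v \<rhd> ?f)) (mor (v \<rhd> ?f)) (src (v \<rhd> ?i)) (mor (v \<rhd> ?i))"
  proof (rule kernelI)
    have "mor (v \<rhd> (?f \<bullet> ?i)) = 0"
      using k(3) by (intro mor_zero_whisker) simp_all
    then show "mor ((v \<rhd> ?f) \<bullet> (v \<rhd> ?i)) = 0"
      by (simp del: tens_simps)
  next
    fix g assume [simp]: "arr g" "trg g = src (v \<rhd> ?f)" and 0: "mor ((v \<rhd> ?f) \<bullet> g) = 0"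
    have "?f \<bullet> ?\<epsilon> a \<bullet> (w \<rhd> g) = ?\<epsilon> b \<bullet> (w \<rhd> ((v \<rhd> ?f) \<bullet> g))"
      using reassoc [OF dual_counit_natural [OF dual, of ?f b]] by simp
    moreover have "mor (w \<rhd> ((v \<rhd> ?f) \<bullet> g)) = 0"
      by (rule mor_zero_whisker [OF _ _ 0]) simp_all
    then have "mor (?\<epsilon> b \<bullet> (w \<rhd> ((v \<rhd> ?f) \<bullet> g))) = 0"
      by (rule mor_zero_comp(1) [rotated 3]) simp_all
    ultimately have "mor (?f \<bullet> ?\<epsilon> a \<bullet> (w \<rhd> g)) = 0"
      by simp
    then obtain h where [simp]: "arr h" "src h = w \<otimes> src g" "trg h = k" and h: "?i \<bullet> h = ?\<epsilon> a \<bullet> (w \<rhd> g)"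
      using k(4) [of "?\<epsilon> a \<bullet> (w \<rhd> g)"] by auto
    have "(v \<rhd> ?i) \<bullet> (v \<rhd> h) \<bullet> ?\<eta> (src g) = (v \<rhd> (?i \<bullet> h)) \<bullet> ?\<eta> (src g)"
      by simp
    also have "\<dots> = (v \<rhd> ?\<epsilon> a) \<bullet> ?\<eta> (v \<otimes> a) \<bullet> g"
      by (simp only: h) (simp add: dual_unit_natural [OF dual])
    also have "\<dots> = g"
      by (simp add: reassoc [OF dual_triangle1 [OF dual]])
    finally show "\<exists>h. arr h \<and> src h = src g \<and> trg h = src (v \<rhd> ?i) \<and> (v \<rhd> ?i) \<bullet> h = g"
      by (intro exI [of _ "(v \<rhd> h) \<bullet> ?\<eta> (src g)"]) simp
  next
    fix x y assume xy: "arr x" "arr y" "src x = src y" "trg x = src (v \<rhd> ?i)" "trg y = src (v \<rhd> ?i)"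
      "(v \<rhd> ?i) \<bullet> x = (v \<rhd> ?i) \<bullet> y"
    have i: "arr ?i" by simp
    have mono: "x' = y'" if "arr x'" "arr y'" "src x' = src y'" "trg x' = src ?i" "trg y' = src ?i"
        "?i \<bullet> x' = ?i \<bullet> y'" for x' y'
      by (rule k(5) [OF that(1-3) _ _ that(6)]) (simp_all add: that(4,5))
    show "x = y"
      by (rule dual_preserves_mono [OF dual i mono xy(1-3) _ _ xy(6)]) (simp_all add: xy(4,5))
  qed simp_all
  then show ?thesis by simp
qed

text \<open>Dually, tensoring with \<open>w\<close> is a left adjoint; the second triangle identity transposes back.\<close>

lemma dual_preserves_cokernel:
  assumes dual: "dual_pair C v w e c" and coker: "is_cokernel C a b f k p"
  shows "is_cokernel C (w \<otimes> a) (w \<otimes> b) (Id C w \<boxtimes> f) (w \<otimes> k) (Id C w \<boxtimes> p)"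
proof -
  let ?f = "Arrow a b f" and ?p = "Arrow b k p" and ?\<epsilon> = "dual_counit v w e" and ?\<eta> = "dual_unit v w c"
  note k = cokernelD [OF coker]
  note [simp] = dual_objects [OF dual] dual_unit_simps [OF dual] dual_counit_simps [OF dual]
  have o [simp]: "obj a" "obj b" "obj k" "f \<in> Hom C a b" "p \<in> Hom C b k"
    using k(1,2) by simp_all
  have *: "z = ?\<epsilon> (trg z) \<bullet> (w \<rhd> ((v \<rhd> z) \<bullet> ?\<eta> d))"
    if [simp]: "arr z" "src z = w \<otimes> d" "obj d" for z d
  proof -
    have "z = z \<bullet> (?\<epsilon> (w \<otimes> d) \<bullet> (w \<rhd> ?\<eta> d))"
      by (simp add: dual_triangle2 [OF dual])
    then show ?thesis by (simp add: reassoc [OF dual_counit_natural [OF dual]])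
  qed
  have "is_cokernel C (src (w \<rhd> ?f)) (trg (w \<rhd> ?f)) (mor (w \<rhd> ?f)) (trg (w \<rhd> ?p)) (mor (w \<rhd> ?p))"
  proof (rule cokernelI)
    have "mor (w \<rhd> (?p \<bullet> ?f)) = 0"
      using k(3) by (intro mor_zero_whisker) simp_all
    then show "mor ((w \<rhd> ?p) \<bullet> (w \<rhd> ?f)) = 0"
      by (simp del: tens_simps)
  next
    fix g assume [simp]: "arr g" "src g = trg (w \<rhd> ?f)" and 0: "mor (g \<bullet> (w \<rhd> ?f)) = 0"
    have "((v \<rhd> g) \<bullet> ?\<eta> b) \<bullet> ?f = (v \<rhd> (g \<bullet> (w \<rhd> ?f))) \<bullet> ?\<eta> a"
      using dual_unit_natural [OF dual, of ?f b] by simp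
    moreover have "mor (v \<rhd> (g \<bullet> (w \<rhd> ?f))) = 0"
      by (rule mor_zero_whisker [OF _ _ 0]) simp_all
    then have "mor ((v \<rhd> (g \<bullet> (w \<rhd> ?f))) \<bullet> ?\<eta> a) = 0"
      by (rule mor_zero_comp(2) [rotated 3]) simp_all
    ultimately have "mor (((v \<rhd> g) \<bullet> ?\<eta> b) \<bullet> ?f) = 0"
      by simp
    then obtain h where [simp]: "arr h" "src h = k" "trg h = v \<otimes> trg g" and h: "h \<bullet> ?p = (v \<rhd> g) \<bullet> ?\<eta> b"
      using k(4) [of "(v \<rhd> g) \<bullet> ?\<eta> b"] by auto
    have "(?\<epsilon> (trg g) \<bullet> (w \<rhd> h)) \<bullet> (w \<rhd> ?p) = ?\<epsilon> (trg g) \<bullet> (w \<rhd> (h \<bullet> ?p))"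
      by simp
    also have "\<dots> = g"
      using * [of g b] by (simp only: h) simp
    finally show "\<exists>h. arr h \<and> src h = trg (w \<rhd> ?p) \<and> trg h = trg g \<and> h \<bullet> (w \<rhd> ?p) = g"
      by (intro exI [of _ "?\<epsilon> (trg g) \<bullet> (w \<rhd> h)"]) simp
  next
    fix x y assume xy [simp]: "arr x" "arr y" "src x = trg (w \<rhd> ?p)" "src y = trg (w \<rhd> ?p)" "trg x = trg y"
      and eq: "x \<bullet> (w \<rhd> ?p) = y \<bullet> (w \<rhd> ?p)"
    have "((v \<rhd> z) \<bullet> ?\<eta> k) \<bullet> ?p = (v \<rhd> (z \<bullet> (w \<rhd> ?p))) \<bullet> ?\<eta> b"
      if "arr z" "src z = w \<otimes> k" for z
      using dual_unit_natural [OF dual, of ?p k] that by simp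
    then have "((v \<rhd> x) \<bullet> ?\<eta> k) \<bullet> ?p = ((v \<rhd> y) \<bullet> ?\<eta> k) \<bullet> ?p"
      by (simp del: comp_assoc whisker_comp add: eq)
    then have "(v \<rhd> x) \<bullet> ?\<eta> k = (v \<rhd> y) \<bullet> ?\<eta> k"
      by (rule k(5) [rotated -1]) simp_all
    moreover have "x = ?\<epsilon> (trg y) \<bullet> (w \<rhd> ((v \<rhd> x) \<bullet> ?\<eta> k))" "y = ?\<epsilon> (trg y) \<bullet> (w \<rhd> ((v \<rhd> y) \<bullet> ?\<eta> k))"
      using * [of x k] * [of y k] by (simp_all only: xy) simp_all
    ultimately show "x = y" by metis
  qed simp_all
  then show ?thesis by simp
qed

end

section \<open>The adjunction\<close>

context commutative_algebra
begin

definition free_ext :: "'o \<times> 'm \<Rightarrow> ('o, 'm) arrow \<Rightarrow> ('o, 'm) arrow" where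
  "free_ext X \<psi> = act X \<bullet> (K \<rhd> \<psi>)"

context
  fixes V X \<psi>
  assumes V [simp]: "obj V" and X [simp]: "X \<in> Mod"
    and \<psi> [simp]: "arr \<psi>" "src \<psi> = V" "trg \<psi> = fst X"
begin

lemma hom_free_ext: "hom (F V) X (free_ext X \<psi>)"
proof -
  have "free_ext X \<psi> \<bullet> lift K K V \<mu> = act X \<bullet> lift K K (fst X) \<mu> \<bullet> (K \<rhd> (K \<rhd> \<psi>))"
    by (simp add: free_ext_def lift_natural)
  also have "\<dots> = act X \<bullet> (K \<rhd> free_ext X \<psi>)"
    by (simp add: reassoc [OF act_assoc] free_ext_def)
  finally show ?thesis
    by (simp add: hom_iff) (simp add: free_ext_def)
qed

lemma free_ext_\<eta>: "free_ext X \<psi> \<bullet> \<eta> V = \<psi>"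
proof -
  have "free_ext X \<psi> \<bullet> \<eta> V = act X \<bullet> \<eta> (fst X) \<bullet> \<psi>"
    by (simp add: free_ext_def \<eta>_natural)
  then show ?thesis
    by (simp add: reassoc [OF act_\<eta>])
qed

end

lemma free_ext_of_hom:
  assumes [simp]: "obj V" and [simp]: "X \<in> Mod" and h: "hom (F V) X \<phi>"
  shows "free_ext X (\<phi> \<bullet> \<eta> V) = \<phi>"
proof -
  note [simp] = homD(1-3) [OF h]
  have "free_ext X (\<phi> \<bullet> \<eta> V) = (act X \<bullet> (K \<rhd> \<phi>)) \<bullet> (K \<rhd> \<eta> V)"
    by (simp add: free_ext_def)
  also have "\<dots> = (\<phi> \<bullet> act (F V)) \<bullet> (K \<rhd> \<eta> V)"
    by (simp only: homD(4) [OF h])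
  also have "\<dots> = \<phi>"
    by (simp add: free_\<eta>)
  finally show ?thesis .
qed

lemma hom_free_eqI:
  assumes "obj V" "X \<in> Mod" "hom (F V) X \<phi>" "hom (F V) X \<psi>"
    and "\<phi> \<bullet> \<eta> V = \<psi> \<bullet> \<eta> V"
  shows "\<phi> = \<psi>"
  using free_ext_of_hom assms by metis

lemma Rep_Hom_subset:
  assumes "obj V" "\<phi> \<in> HomA (F V) X"
  shows "\<phi> \<in> Hom C (K \<otimes> V) (fst X)"
  using assms by (simp add: Rep_Hom)

lemma adj_map_bij:
  assumes [simp]: "obj V" and [simp]: "X \<in> Mod"
  shows "bij_betw (adj_map C A V) (HomA (F V) X) (Hom C V (G_ob X))"
proof (rule bij_betw_imageI)
  have mor_eq: "adj_map C A V \<phi> = mor (Arrow (K \<otimes> V) (fst X) \<phi> \<bullet> \<eta> V)"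
    if "\<phi> \<in> HomA (F V) X" for \<phi>
    using Rep_Hom_subset [OF assms(1) that] by (simp add: adj_map_def)
  have hom: "hom (F V) X (Arrow (K \<otimes> V) (fst X) \<phi>)"
    if "\<phi> \<in> HomA (F V) X" for \<phi>
    using modules.hom_Arrow [OF _ _ that] by simp
  show "inj_on (adj_map C A V) (HomA (F V) X)"
  proof (rule inj_onI)
    fix \<phi> \<psi> assume \<phi>: "\<phi> \<in> HomA (F V) X" and \<psi>: "\<psi> \<in> HomA (F V) X"
      and eq: "adj_map C A V \<phi> = adj_map C A V \<psi>"
    note [simp] = Rep_Hom_subset [OF assms(1) \<phi>] Rep_Hom_subset [OF assms(1) \<psi>]
    have "Arrow (K \<otimes> V) (fst X) \<phi> \<bullet> \<eta> V = Arrow (K \<otimes> V) (fst X) \<psi> \<bullet> \<eta> V"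
      using eq \<phi> \<psi> by (intro arrow_eqI) (simp_all only: mor_eq, simp_all)
    then have "Arrow (K \<otimes> V) (fst X) \<phi> = Arrow (K \<otimes> V) (fst X) \<psi>"
      using hom_free_eqI [OF assms hom [OF \<phi>] hom [OF \<psi>]] by simp
    then show "\<phi> = \<psi>" by simp
  qed
  show "adj_map C A V ` HomA (F V) X = Hom C V (G_ob X)"
  proof (intro equalityI subsetI)
    fix \<psi> assume "\<psi> \<in> adj_map C A V ` HomA (F V) X"
    then obtain \<phi> where \<phi>: "\<phi> \<in> HomA (F V) X" and \<psi>: "\<psi> = adj_map C A V \<phi>"
      by auto
    show "\<psi> \<in> Hom C V (G_ob X)"
      unfolding \<psi> mor_eq [OF \<phi>] using homD(1) [OF hom [OF \<phi>]]
      by (intro mor_in_Hom) (simp_all add: G_ob_def)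
  next
    fix \<psi> assume "\<psi> \<in> Hom C V (G_ob X)"
    then have \<psi>: "arr (Arrow V (fst X) \<psi>)" "src (Arrow V (fst X) \<psi>) = V" "trg (Arrow V (fst X) \<psi>) = fst X"
      by (simp_all add: G_ob_def)
    let ?e = "free_ext X (Arrow V (fst X) \<psi>)"
    have e: "hom (F V) X ?e"
      by (rule hom_free_ext [OF assms \<psi>])
    have m: "mor ?e \<in> HomA (F V) X"
      by (rule modules.homD(4) [OF e])
    have "Arrow (K \<otimes> V) (fst X) (mor ?e) = ?e"
      using Arrow_src_trg [of ?e] homD(1-3) [OF e] by simp
    then have "adj_map C A V (mor ?e) = \<psi>"
      using free_ext_\<eta> [OF assms \<psi>] by (simp add: mor_eq [OF m])
    with imageI [OF m, of "adj_map C A V"] show "\<psi> \<in> adj_map C A V ` HomA (F V) X"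
      by simp
  qed
qed

lemma unit_ins_in_Hom: "obj V \<Longrightarrow> unit_ins C A V \<in> Hom C V (K \<otimes> V)"
  using mor_in_Hom [of "\<eta> V" V "K \<otimes> V"] by simp

lemma adj_map_linear:
  assumes "obj V" and "X \<in> Mod"
    and "\<phi> \<in> HomA (F V) X" "\<psi> \<in> HomA (F V) X"
  shows "adj_map C A V (\<phi> + \<psi>) = adj_map C A V \<phi> + adj_map C A V \<psi>"
    and "adj_map C A V (Scl C z \<phi>) = Scl C z (adj_map C A V \<phi>)"
  using assms Rep_Hom_subset [OF assms(1,3)] Rep_Hom_subset [OF assms(1,4)] unit_ins_in_Hom [of V]
    Cmp_add_left [of V "K \<otimes> V" "fst X" "unit_ins C A V" \<phi> \<psi>]
    Cmp_Scl_left [of V "K \<otimes> V" "fst X" "unit_ins C A V" \<phi> z]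
  by (simp_all add: adj_map_def)

lemma adj_map_natural:
  assumes [simp]: "obj V" "obj V'" "X \<in> Mod" "X' \<in> Mod" "f \<in> Hom C V' V"
    and g: "g \<in> HomA X X'" and \<phi>: "\<phi> \<in> HomA (F V) X"
  shows "adj_map C A V' (g \<cdot>\<^bsub>Rep C A\<^esub> \<phi> \<cdot>\<^bsub>Rep C A\<^esub> F_mor C A f) =
    G_mor g \<cdot> adj_map C A V \<phi> \<cdot> f"
proof -
  let ?f = "Arrow V' V f" and ?g = "Arrow (fst X) (fst X') g" and ?\<phi> = "Arrow (K \<otimes> V) (fst X) \<phi>"
  have [simp]: "g \<in> Hom C (fst X) (fst X')" "\<phi> \<in> Hom C (K \<otimes> V) (fst X)"
    using g Rep_Hom_subset [OF _ \<phi>] by (simp_all add: Rep_Hom)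
  have "mor ((?g \<bullet> ?\<phi> \<bullet> (K \<rhd> ?f)) \<bullet> \<eta> V') = mor (?g \<bullet> (?\<phi> \<bullet> \<eta> V) \<bullet> ?f)"
    using \<eta>_natural [of ?f V] by simp
  moreover have "mor ((?g \<bullet> ?\<phi> \<bullet> (K \<rhd> ?f)) \<bullet> \<eta> V') = (g \<cdot> \<phi> \<cdot> (Id C K \<boxtimes> f)) \<cdot> unit_ins C A V'"
    by (simp del: comp_assoc)
  moreover have "mor (?g \<bullet> (?\<phi> \<bullet> \<eta> V) \<bullet> ?f) = g \<cdot> (\<phi> \<cdot> unit_ins C A V) \<cdot> f"
    by (simp del: comp_assoc)
  ultimately show ?thesis
    by (simp add: adj_map_def F_mor_def G_mor_def)
qed

end

section \<open>Exactness\<close>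

context monoidal_category
begin

lemma rigid_preserves_kernel:
  assumes "rigid C" "obj v" "is_kernel C a b f k i"
  shows "is_kernel C (v \<otimes> a) (v \<otimes> b) (Id C v \<boxtimes> f) (v \<otimes> k) (Id C v \<boxtimes> i)"
  using assms dual_preserves_kernel unfolding rigid_def by blast

lemma rigid_preserves_cokernel:
  assumes "rigid C" "obj v" "is_cokernel C a b f k p"
  shows "is_cokernel C (v \<otimes> a) (v \<otimes> b) (Id C v \<boxtimes> f) (v \<otimes> k) (Id C v \<boxtimes> p)"
  using assms dual_preserves_cokernel unfolding rigid_def by blast

end

context commutative_algebra
begin

lemma hom_comp_free_ext:
  assumes f: "hom X Y f" and [simp]: "X \<in> Mod" "Y \<in> Mod" "arr \<psi>" "trg \<psi> = fst X"
  shows "f \<bullet> free_ext X \<psi> = free_ext Y (f \<bullet> \<psi>)"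
proof -
  note [simp] = homD(1-3) [OF f]
  have "f \<bullet> free_ext X \<psi> = (f \<bullet> act X) \<bullet> (K \<rhd> \<psi>)"
    by (simp add: free_ext_def)
  then show ?thesis
    by (simp only: homD(4) [OF f]) (simp add: free_ext_def)
qed

text \<open>A morphism from \<open>V\<close> to a module is the same as a module morphism from \<open>F(V)\<close>, so the universal property among modules
  yields the one in \<open>C\<close>.\<close>

lemma G_kernel:
  assumes ker: "is_kernel (Rep C A) X Y f Z i"
  shows "is_kernel C (fst X) (fst Y) f (fst Z) i"
proof -
  let ?f = "Arrow (fst X) (fst Y) f" and ?i = "Arrow (fst Z) (fst X) i"
  note D = modules.kernelD [OF ker]
  note X [simp] = modules.homD(5) [OF D(1)] and Y [simp] = modules.homD(6) [OF D(1)]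
    and Z [simp] = modules.homD(5) [OF D(2)] and fi = homD(1) [OF D(1)] homD(1) [OF D(2)]
  have "is_kernel C (src ?f) (trg ?f) (mor ?f) (src ?i) (mor ?i)"
  proof (rule kernelI)
    show "arr ?f" "arr ?i" "mor (?f \<bullet> ?i) = 0" by (rule fi D(3))+
    show "trg ?i = src ?f" by simp
  next
    fix g assume g: "arr g" "trg g = src ?f" "mor (?f \<bullet> g) = 0"
    have g': "arr g" "trg g = fst X" and V: "src g \<in> Ob C" using g by simp_all
    have e: "hom (F (src g)) X (free_ext X g)"
      by (rule hom_free_ext) (use g' V in simp_all)
    have "mor (K \<rhd> (?f \<bullet> g)) = 0"
      by (rule mor_zero_whisker [OF _ _ g(3)]) (use fi g' in simp_all)
    then have "mor (free_ext Y (?f \<bullet> g)) = 0"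
      unfolding free_ext_def by (rule mor_zero_comp(1) [rotated 3]) (use fi g' in simp_all)
    then have "mor (?f \<bullet> free_ext X g) = 0"
      using g' by (simp only: hom_comp_free_ext [OF D(1) X Y g'])
    then obtain h where h: "hom (F (src g)) Z h" "?i \<bullet> h = free_ext X g"
      using D(4) [OF e] by blast
    have "?i \<bullet> h \<bullet> \<eta> (src g) = free_ext X g \<bullet> \<eta> (src g)"
      by (rule reassoc [OF h(2)])
    also have "\<dots> = g"
      by (rule free_ext_\<eta>) (use g' V in simp_all)
    finally show "\<exists>h. arr h \<and> src h = src g \<and> trg h = src ?i \<and> ?i \<bullet> h = g"
      using homD(1-3) [OF h(1)] V by (intro exI [of _ "h \<bullet> \<eta> (src g)"]) simp
  next
    fix x y assume xy: "arr x" "arr y" "src x = src y" "trg x = src ?i" "trg y = src ?i" "?i \<bullet> x = ?i \<bullet> y"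
    have x: "trg x = fst Z" and y: "trg y = fst Z" and V: "src y \<in> Ob C" using xy by simp_all
    have "?i \<bullet> free_ext Z x = ?i \<bullet> free_ext Z y"
      by (simp only: hom_comp_free_ext [OF D(2) Z X xy(1) x] hom_comp_free_ext [OF D(2) Z X xy(2) y] xy(6))
    then have "free_ext Z x = free_ext Z y"
      by (rule D(5) [rotated 2]) (rule hom_free_ext; use xy x y V in simp)+
    then have "free_ext Z x \<bullet> \<eta> (src y) = free_ext Z y \<bullet> \<eta> (src y)"
      by (rule arg_cong)
    then show "x = y"
      by (simp only: free_ext_\<eta> [OF V Z xy(1,3) x] free_ext_\<eta> [OF V Z xy(2) refl y])
  qed
  then show ?thesis by simp
qed

text \<open>
  The cokernel in \<open>C\<close> of a module morphism inherits an action, because tensoring with \<open>A\<close> preserves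
  cokernels, and is then compared with the cokernel among modules.
\<close>

lemma G_cokernel:
  assumes rigid: "rigid C" and coker: "is_cokernel (Rep C A) X Y f Z g"
  shows "is_cokernel C (fst X) (fst Y) f (fst Z) g"
proof -
  let ?f = "Arrow (fst X) (fst Y) f" and ?g = "Arrow (fst Y) (fst Z) g"
  note D = modules.cokernelD [OF coker]
  note [simp] = modules.homD(5,6) [OF D(1)] modules.homD(6) [OF D(2)]
    and fg [simp] = homD(1) [OF D(1), simplified] homD(1) [OF D(2), simplified]
  have f_in: "f \<in> Hom C (fst X) (fst Y)" and g_in: "g \<in> Hom C (fst Y) (fst Z)"
    using fg by simp_all
  obtain T p where T: "is_cokernel C (fst X) (fst Y) f T p"
    using ex_cokernel [OF _ _ f_in] by auto
  let ?p = "Arrow (fst Y) T p"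
  note E = cokernelD [OF T]
  have [simp]: "obj T" "p \<in> Hom C (fst Y) T" using E(2) by simp_all
  have pf: "mor (?p \<bullet> ?f) = 0" by (rule E(3))
  note KT = rigid_preserves_cokernel [OF rigid K_object T]
  note KKT = rigid_preserves_cokernel [OF rigid K_object KT]
  note IT = rigid_preserves_cokernel [OF rigid Unit_in_Ob T]
  have Kp: "Arrow (K \<otimes> fst Y) (K \<otimes> T) (Id C K \<boxtimes> p) = K \<rhd> ?p"
    and Kf: "Arrow (K \<otimes> fst X) (K \<otimes> fst Y) (Id C K \<boxtimes> f) = K \<rhd> ?f"
    and KKp: "Arrow (K \<otimes> (K \<otimes> fst Y)) (K \<otimes> (K \<otimes> T)) (Id C K \<boxtimes> (Id C K \<boxtimes> p)) = K \<rhd> (K \<rhd> ?p)"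
    and Ip: "Arrow (\<one> \<otimes> fst Y) (\<one> \<otimes> T) (Id C \<one> \<boxtimes> p) = \<one> \<rhd> ?p"
    using f_in by (auto intro!: arrow_eqI TensM_in_Hom simp: Id_in_Hom)
  have "(?p \<bullet> act Y) \<bullet> (K \<rhd> ?f) = ?p \<bullet> (?f \<bullet> act X)"
    by (simp only: homD(4) [OF D(1)] comp_assoc)
  moreover have "mor ((?p \<bullet> ?f) \<bullet> act X) = 0"
    by (rule mor_zero_comp(2) [OF _ _ _ pf]) (use f_in in simp_all)
  ultimately have "mor ((?p \<bullet> act Y) \<bullet> (K \<rhd> ?f)) = 0"
    by (simp only: comp_assoc)
  \<comment> \<open>\<open>n\<close> is the induced action on the cokernel \<open>T\<close>; its axioms hold after precomposing with epimorphisms obtained from \<open>p\<close>.\<close>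
  then obtain n where n: "arr n" "src n = K \<otimes> T" "trg n = T" "n \<bullet> (K \<rhd> ?p) = ?p \<bullet> act Y"
    using cokernelD(4) [OF KT, of "?p \<bullet> act Y"] unfolding Kp Kf by auto
  note [simp] = n(1-3)
  have "(n \<bullet> lift K K T \<mu>) \<bullet> (K \<rhd> (K \<rhd> ?p)) = (n \<bullet> (K \<rhd> ?p)) \<bullet> lift K K (fst Y) \<mu>"
    by (simp add: lift_natural)
  also have "\<dots> = (?p \<bullet> act Y) \<bullet> (K \<rhd> act Y)"
    by (simp only: n(4)) (simp add: act_assoc)
  also have "\<dots> = n \<bullet> (K \<rhd> (?p \<bullet> act Y))"
    by (subst n(4) [symmetric]) simp
  also have "\<dots> = n \<bullet> (K \<rhd> (n \<bullet> (K \<rhd> ?p)))"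
    by (simp only: n(4))
  also have "\<dots> = (n \<bullet> (K \<rhd> n)) \<bullet> (K \<rhd> (K \<rhd> ?p))"
    by simp
  finally have assoc: "n \<bullet> lift K K T \<mu> = n \<bullet> (K \<rhd> n)"
    by (rule cokernelD(5) [OF KKT, unfolded KKp, rotated -1]) simp_all
  have "(n \<bullet> (\<iota> \<lhd> T)) \<bullet> (\<one> \<rhd> ?p) = (n \<bullet> (K \<rhd> ?p)) \<bullet> (\<iota> \<lhd> fst Y)"
    using slide [of \<iota> ?p \<one> K "fst Y" T] by simp
  also have "\<dots> = ?p \<bullet> lu (fst Y)"
    by (simp only: n(4)) (simp add: act_unit)
  also have "\<dots> = lu T \<bullet> (\<one> \<rhd> ?p)"
    by (simp add: lu_natural)
  finally have unit: "n \<bullet> (\<iota> \<lhd> T) = lu T"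
    by (rule cokernelD(5) [OF IT, unfolded Ip, rotated -1]) simp_all
  let ?T = "(T, mor n)"
  have act_T: "act ?T = n"
    using Arrow_src_trg [OF n(1)] by (simp add: act_def)
  have T' [simp]: "?T \<in> Mod"
    unfolding Rep_Ob_iff act_T by (simp add: is_action_def assoc unit)
  have p: "hom Y ?T ?p"
    using n(4) by (simp add: hom_iff act_T)
  \<comment> \<open>The comparison morphisms between the two cokernels.\<close>
  obtain u where u: "hom Z ?T u" "u \<bullet> ?g = ?p"
    using D(4) [OF p pf] by auto
  obtain v where v: "arr v" "src v = T" "trg v = fst Z" "v \<bullet> ?p = ?g"
    using E(4) [of ?g] D(3) by auto
  note [simp] = v(1-3) homD(1-3) [OF u(1), simplified]
  have "(v \<bullet> n) \<bullet> (K \<rhd> ?p) = (v \<bullet> ?p) \<bullet> act Y"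
    by (simp only: n(4) comp_assoc)
  also have "\<dots> = act Z \<bullet> (K \<rhd> ?g)"
    by (simp only: v(4) homD(4) [OF D(2)])
  also have "\<dots> = (act Z \<bullet> (K \<rhd> v)) \<bullet> (K \<rhd> ?p)"
    by (simp only: v(4) [symmetric]) simp
  finally have "v \<bullet> n = act Z \<bullet> (K \<rhd> v)"
    by (rule cokernelD(5) [OF KT, unfolded Kp, rotated -1]) simp_all
  then have v_hom: "hom ?T Z v"
    by (simp add: hom_iff act_T)
  have vu: "v \<bullet> u = ide (fst Z)"
  proof (rule D(5))
    show "hom Z Z (v \<bullet> u)" by (rule modules.hom_comp [OF u(1) v_hom])
    show "hom Z Z (ide (fst Z))" by (rule hom_ide) simp
    show "(v \<bullet> u) \<bullet> ?g = ide (fst Z) \<bullet> ?g"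
      using g_in by (simp add: u(2) v(4))
  qed
  have "is_cokernel C (src ?f) (trg ?f) (mor ?f) (trg ?g) (mor ?g)"
  proof (rule cokernelI)
    show "arr ?f" "arr ?g" using f_in g_in by simp_all
    show "mor (?g \<bullet> ?f) = 0" by (rule D(3))
    show "src ?g = trg ?f" by simp
  next
    fix x assume x: "arr x" "src x = trg ?f" "mor (x \<bullet> ?f) = 0"
    then obtain y where y: "arr y" "src y = T" "trg y = trg x" "y \<bullet> ?p = x"
      using E(4) [of x] by auto
    then show "\<exists>h. arr h \<and> src h = trg ?g \<and> trg h = trg x \<and> h \<bullet> ?g = x"
      by (intro exI [of _ "y \<bullet> u"]) (simp add: u(2))
  next
    fix x y assume xy: "arr x" "arr y" "src x = trg ?g" "src y = trg ?g" "trg x = trg y"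
      and eq: "x \<bullet> ?g = y \<bullet> ?g"
    have "(x \<bullet> v) \<bullet> ?p = (y \<bullet> v) \<bullet> ?p"
      using eq by (simp only: comp_assoc v(4))
    then have "x \<bullet> v = y \<bullet> v"
      by (rule E(5) [rotated -1]) (use xy in simp_all)
    then have "(x \<bullet> v) \<bullet> u = (y \<bullet> v) \<bullet> u"
      by (rule arg_cong)
    then show "x = y"
      using xy by (simp add: vu)
  qed
  then show ?thesis by simp
qed

text \<open>The factorization through the kernel in \<open>C\<close> is a module morphism, as this may be checked after composing with
  a monomorphism.\<close>

lemma F_kernel:
  assumes rigid: "rigid C" and ker: "is_kernel C a b f k i"
  shows "is_kernel (Rep C A) (F a) (F b) (F_mor C A f) (F k) (F_mor C A i)"
proof -
  let ?f = "Arrow a b f" and ?i = "Arrow k a i"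
  have o [simp]: "obj a" "obj b" "obj k" "f \<in> Hom C a b" "i \<in> Hom C k a"
    using kernelD(1,2) [OF ker] by simp_all
  note D = kernelD [OF rigid_preserves_kernel [OF rigid K_object ker]]
  have Kf: "Arrow (K \<otimes> a) (K \<otimes> b) (Id C K \<boxtimes> f) = K \<rhd> ?f" and Ki: "Arrow (K \<otimes> k) (K \<otimes> a) (Id C K \<boxtimes> i) = K \<rhd> ?i"
    by (auto intro!: arrow_eqI TensM_in_Hom simp: Id_in_Hom)
  note D = D [unfolded Kf Ki]
  have f: "hom (F a) (F b) (K \<rhd> ?f)" and i: "hom (F k) (F a) (K \<rhd> ?i)"
    using hom_free [of ?f] hom_free [of ?i] by simp_all
  have "is_kernel (Rep C A) (F a) (F b) (mor (K \<rhd> ?f)) (F k) (mor (K \<rhd> ?i))"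
  proof (rule modules.kernelI [OF f i D(3)])
    fix W g assume g: "hom W (F a) g" and 0: "mor ((K \<rhd> ?f) \<bullet> g) = 0"
    note [simp] = homD(1-3) [OF g] modules.homD(5) [OF g]
    obtain h where h: "arr h" "src h = fst W" "trg h = K \<otimes> k" "(K \<rhd> ?i) \<bullet> h = g"
      using D(4) [of g] 0 by auto
    note [simp] = h(1-3)
    have "(K \<rhd> ?i) \<bullet> (h \<bullet> act W) = act (F a) \<bullet> (K \<rhd> ((K \<rhd> ?i) \<bullet> h))"
      using homD(4) [OF g] by (simp only: h(4) reassoc [OF h(4)])
    also have "\<dots> = (act (F a) \<bullet> (K \<rhd> (K \<rhd> ?i))) \<bullet> (K \<rhd> h)"
      by simp
    also have "\<dots> = (K \<rhd> ?i) \<bullet> (act (F k) \<bullet> (K \<rhd> h))"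
      by (simp only: homD(4) [OF i, symmetric] comp_assoc)
    finally have "h \<bullet> act W = act (F k) \<bullet> (K \<rhd> h)"
      by (rule D(5) [rotated -1]) simp_all
    then have "hom W (F k) h"
      by (subst hom_iff) (simp_all only: F_ob_simps(1) o modules.homD(5) [OF g], simp)
    with h(4) show "\<exists>h. hom W (F k) h \<and> (K \<rhd> ?i) \<bullet> h = g" by blast
  next
    fix W x y assume x: "hom W (F k) x" and y: "hom W (F k) y"
      and eq: "(K \<rhd> ?i) \<bullet> x = (K \<rhd> ?i) \<bullet> y"
    show "x = y"
      by (rule D(5) [OF _ _ _ _ _ eq]) (simp_all add: homD(1-3) [OF x] homD(1-3) [OF y])
  qed
  then show ?thesis by (simp add: F_mor_def)
qed

text \<open>The universal property is transported by restricting module morphisms along \<open>\<eta>\<close>.\<close>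

lemma F_cokernel:
  assumes coker: "is_cokernel C a b f k p"
  shows "is_cokernel (Rep C A) (F a) (F b) (F_mor C A f) (F k) (F_mor C A p)"
proof -
  let ?f = "Arrow a b f" and ?p = "Arrow b k p"
  note D = cokernelD [OF coker]
  have o [simp]: "obj a" "obj b" "obj k" "f \<in> Hom C a b" "p \<in> Hom C b k"
    using D(1,2) by simp_all
  have f: "hom (F a) (F b) (K \<rhd> ?f)" and p: "hom (F b) (F k) (K \<rhd> ?p)"
    using hom_free [of ?f] hom_free [of ?p] by simp_all
  have "mor (K \<rhd> (?p \<bullet> ?f)) = 0"
    by (rule mor_zero_whisker [OF _ _ D(3)]) simp_all
  then have pf: "mor ((K \<rhd> ?p) \<bullet> (K \<rhd> ?f)) = 0"
    by (simp del: tens_simps)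
  have "is_cokernel (Rep C A) (F a) (F b) (mor (K \<rhd> ?f)) (F k) (mor (K \<rhd> ?p))"
  proof (rule modules.cokernelI [OF f p pf])
    fix W g assume g: "hom (F b) W g" and 0: "mor (g \<bullet> (K \<rhd> ?f)) = 0"
    note W [simp] = modules.homD(6) [OF g] and [simp] = homD(1-3) [OF g]
    have "mor ((g \<bullet> (K \<rhd> ?f)) \<bullet> \<eta> a) = 0"
      by (rule mor_zero_comp(2) [OF _ _ _ 0]) simp_all
    then have "mor ((g \<bullet> \<eta> b) \<bullet> ?f) = 0"
      using \<eta>_natural [of ?f b] by simp
    then obtain y where y: "arr y" "src y = k" "trg y = fst W" "y \<bullet> ?p = g \<bullet> \<eta> b"
      using D(4) [of "g \<bullet> \<eta> b"] by auto
    note [simp] = y(1-3)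
    have "free_ext W y \<bullet> (K \<rhd> ?p) = free_ext W (y \<bullet> ?p)"
      by (simp add: free_ext_def)
    also have "\<dots> = g"
      by (simp only: y(4)) (rule free_ext_of_hom [OF _ W g], simp)
    finally show "\<exists>h. hom (F k) W h \<and> h \<bullet> (K \<rhd> ?p) = g"
      using hom_free_ext [of k W y] by auto
  next
    fix W x y assume x: "hom (F k) W x" and y: "hom (F k) W y"
      and eq: "x \<bullet> (K \<rhd> ?p) = y \<bullet> (K \<rhd> ?p)"
    note [simp] = homD(1-3) [OF x] homD(1-3) [OF y]
    have *: "z \<bullet> \<eta> k \<bullet> ?p = (z \<bullet> (K \<rhd> ?p)) \<bullet> \<eta> b" for z
      using \<eta>_natural [of ?p k] by simp
    have "(x \<bullet> \<eta> k) \<bullet> ?p = (y \<bullet> \<eta> k) \<bullet> ?p"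
      by (simp only: comp_assoc * eq)
    then have "x \<bullet> \<eta> k = y \<bullet> \<eta> k"
      by (rule D(5) [rotated -1]) simp_all
    then show "x = y"
      using hom_free_eqI [OF _ modules.homD(6) [OF x] x y] by simp
  qed
  then show ?thesis by (simp add: F_mor_def)
qed

lemma F_exact:
  assumes "rigid C"
  shows "exact_functor C (Rep C A) (F_ob C A) (F_mor C A)"
proof -
  interpret linear_functor C "Rep C A" "F_ob C A" "F_mor C A" by (rule F_linear)
  show ?thesis
    by unfold_locales (simp add: short_exact_def F_kernel [OF assms] F_cokernel)
qed

lemma G_exact:
  assumes "rigid C"
  shows "exact_functor (Rep C A) C G_ob G_mor"
  by unfold_locales
    (simp_all add: G_ob_def G_mor_def Rep_Hom short_exact_def G_kernel G_cokernel [OF assms])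

text \<open>
  The unit of the algebra is a monomorphism, and tensoring with a dualizable object preserves
  monomorphisms.  The braiding moves \<open>V\<close> to the side on which this has been shown.
\<close>

lemma \<eta>_mono:
  assumes rigid: "rigid C" and V [simp]: "obj V"
    and xy [simp]: "arr x" "arr y" "src x = src y" "trg x = V" "trg y = V" and eq: "\<eta> V \<bullet> x = \<eta> V \<bullet> y"
  shows "x = y"
proof -
  obtain w e c where dual: "dual_pair C V w e c"
    using rigid V unfolding rigid_def by blast
  have \<iota>_mono: "x' = y'" if [simp]: "arr x'" "arr y'" "src x' = src y'" "trg x' = src \<iota>" "trg y' = src \<iota>"
    and eq: "\<iota> \<bullet> x' = \<iota> \<bullet> y'" for x' y'
  proof -
    have "mor (\<iota> \<bullet> x') = mor (\<iota> \<bullet> y')" by (simp only: eq)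
    then have "Iota A \<cdot> mor x' = Iota A \<cdot> mor y'" using that(4,5) by simp
    moreover have "mor x' \<in> Hom C (src y') \<one>" "mor y' \<in> Hom C (src y') \<one>"
      using that(4,5) by (simp_all add: mor_in_Hom)
    ultimately have "mor x' = mor y'"
      using algebra arr_objects(1) [OF that(2)] unfolding C_algebra_def is_mono_def by blast
    then show ?thesis using that(4,5) by (intro arrow_eqI) simp_all
  qed
  have *: "(V \<rhd> \<iota>) \<bullet> (R \<one> V \<bullet> lu' V \<bullet> z) = R K V \<bullet> (\<eta> V \<bullet> z)" for z
    by (simp add: \<eta>_def reassoc [OF R_natural_whisker(1)])
  have "(V \<rhd> \<iota>) \<bullet> (R \<one> V \<bullet> lu' V \<bullet> x) = (V \<rhd> \<iota>) \<bullet> (R \<one> V \<bullet> lu' V \<bullet> y)"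
    by (simp only: * eq)
  then have "R \<one> V \<bullet> lu' V \<bullet> x = R \<one> V \<bullet> lu' V \<bullet> y"
    by (rule dual_preserves_mono [OF dual _ \<iota>_mono, rotated -1]) simp_all
  then have "lu V \<bullet> R' \<one> V \<bullet> R \<one> V \<bullet> lu' V \<bullet> x = lu V \<bullet> R' \<one> V \<bullet> R \<one> V \<bullet> lu' V \<bullet> y"
    by simp
  then show ?thesis by simp
qed

lemma F_faithful:
  assumes "rigid C"
  shows "injective_on_morphisms C (F_mor C A)"
  unfolding injective_on_morphisms_def
proof (intro ballI inj_onI)
  fix a b f g
  assume [simp]: "obj a" "obj b" "f \<in> Hom C a b" "g \<in> Hom C a b" and eq: "F_mor C A f = F_mor C A g"
  let ?f = "Arrow a b f" and ?g = "Arrow a b g"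
  have "K \<rhd> ?f = K \<rhd> ?g"
    using eq by (intro arrow_eqI) (simp_all add: F_mor_def)
  then have "\<eta> b \<bullet> ?f = \<eta> b \<bullet> ?g"
    using \<eta>_natural [of ?f b] \<eta>_natural [of ?g b] by simp
  then have "?f = ?g"
    by (rule \<eta>_mono [OF assms, rotated -1]) simp_all
  then show "f = g" by simp
qed

lemma proj_map_iso:
  assumes [simp]: "obj V" and [simp]: "X \<in> Mod"
  shows "is_iso C (V \<otimes> G_ob X) (G_ob (F V \<odot> X)) (proj_map C A V X)"
proof -
  have "Arrow (V \<otimes> fst X) (Q (F V) X) (proj_map C A V X) = P V X"
    using Arrow_src_trg [of "P V X"] by simp
  then show ?thesis
    using inverses_P [of V X] inverses_is_iso [of "V \<otimes> fst X" "Q (F V) X" "proj_map C A V X"]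
    by (simp add: G_ob_def)
qed

lemma proj_map_natural:
  assumes [simp]: "obj V" "obj V'" "X \<in> Mod" "X' \<in> Mod" "f \<in> Hom C V V'"
    and g: "g \<in> HomA X X'"
  shows "proj_map C A V' X' \<cdot> (f \<boxtimes> G_mor g) =
    G_mor (tensA_mor C A (F V) (F V') X X' (F_mor C A f) g) \<cdot> proj_map C A V X"
proof -
  let ?f = "Arrow V V' f" and ?g = "Arrow (fst X) (fst X') g"
  have g': "hom X X' ?g" by (rule modules.hom_Arrow [OF _ _ g]) simp_all
  note [simp] = homD(1) [OF g', simplified]
  have f': "hom (F V) (F V') (K \<rhd> ?f)"
    using hom_free [of ?f] by simp
  note induced = induced_simps [OF _ _ _ _ f' g', simplified]
  have "mor (P V' X' \<bullet> (?f \<star> ?g)) = mor (induced (F V) (F V') X X' (K \<rhd> ?f) ?g \<bullet> P V X)"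
    using P_natural [of ?f X X' ?g] g' by simp
  then show ?thesis
    by (simp add: induced G_mor_def F_mor_def)
qed

end

theorem theorem1p6:
  fixes C :: "('o, 'm::ab_group_add) bal_cat" and A :: "('o, 'm) alg"
  assumes "abelian_category C" and "semisimple C" and "hom_finite C"
    and "balanced_category C" and "rigid C" and "is_simple C \<one>\<^bsub>C\<^esub>"
    and "C_algebra C A"
  shows "
    \<comment> \<open>Part 1\<close>
    (exact_functor C (Rep C A) (F_ob C A) (F_mor C A) \<and> injective_on_morphisms C (F_mor C A) \<and>
     exact_functor (Rep C A) C G_ob G_mor \<and> injective_on_morphisms (Rep C A) (G_mor :: 'm \<Rightarrow> 'm)) \<and>
    \<comment> \<open>Part 2\<close>
    ((\<forall>V\<in>Ob C. \<forall>X\<in>Ob (Rep C A).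
        bij_betw (adj_map C A V) (Hom (Rep C A) (F_ob C A V) X) (Hom C V (G_ob X)) \<and>
        (\<forall>\<phi>\<in>Hom (Rep C A) (F_ob C A V) X. \<forall>\<psi>\<in>Hom (Rep C A) (F_ob C A V) X.
          adj_map C A V (\<phi> + \<psi>) = adj_map C A V \<phi> + adj_map C A V \<psi>) \<and>
        (\<forall>z. \<forall>\<phi>\<in>Hom (Rep C A) (F_ob C A V) X.
          adj_map C A V (Scl C z \<phi>) = Scl C z (adj_map C A V \<phi>))) \<and>
     (\<forall>V\<in>Ob C. \<forall>V'\<in>Ob C. \<forall>X\<in>Ob (Rep C A). \<forall>X'\<in>Ob (Rep C A).
        \<forall>f\<in>Hom C V' V. \<forall>g\<in>Hom (Rep C A) X X'. \<forall>\<phi>\<in>Hom (Rep C A) (F_ob C A V) X.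
          adj_map C A V' (g \<cdot>\<^bsub>Rep C A\<^esub> \<phi> \<cdot>\<^bsub>Rep C A\<^esub> F_mor C A f) =
            G_mor g \<cdot>\<^bsub>C\<^esub> adj_map C A V \<phi> \<cdot>\<^bsub>C\<^esub> f)) \<and>
    \<comment> \<open>Part 3\<close>
    (tensor_functor_to_Rep C A (F_ob C A) (F_mor C A) (F_tens C A) (F_unit C A)) \<and>
    \<comment> \<open>Part 4\<close>
    ((\<forall>V\<in>Ob C. G_ob (F_ob C A V) = Car A \<otimes>\<^bsub>C\<^esub> V) \<and>
     (\<forall>V\<in>Ob C. \<forall>V'\<in>Ob C. \<forall>f\<in>Hom C V V'. G_mor (F_mor C A f) = Id C (Car A) \<boxtimes>\<^bsub>C\<^esub> f) \<and>
     (\<forall>V\<in>Ob C. \<forall>X\<in>Ob (Rep C A).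
        is_iso C (V \<otimes>\<^bsub>C\<^esub> G_ob X) (G_ob (tensA C A (F_ob C A V) X)) (proj_map C A V X)) \<and>
     (\<forall>V\<in>Ob C. \<forall>V'\<in>Ob C. \<forall>X\<in>Ob (Rep C A). \<forall>X'\<in>Ob (Rep C A).
        \<forall>f\<in>Hom C V V'. \<forall>g\<in>Hom (Rep C A) X X'.
          proj_map C A V' X' \<cdot>\<^bsub>C\<^esub> (f \<boxtimes>\<^bsub>C\<^esub> G_mor g) =
            G_mor (tensA_mor C A (F_ob C A V) (F_ob C A V') X X' (F_mor C A f) g) \<cdot>\<^bsub>C\<^esub> proj_map C A V X))"
proof -
  interpret abelian_category C by fact
  interpret balanced_category C by fact
  interpret commutative_algebra C A by unfold_locales fact
  have "injective_on_morphisms (Rep C A) (G_mor :: 'm \<Rightarrow> 'm)"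
    by (simp add: injective_on_morphisms_def G_mor_def inj_on_def)
  then show ?thesis
    using F_exact [OF \<open>rigid C\<close>] F_faithful [OF \<open>rigid C\<close>] G_exact [OF \<open>rigid C\<close>] F_tensor_functor
    by (simp add: adj_map_bij adj_map_linear adj_map_natural [simplified] proj_map_iso proj_map_natural)
      (simp add: G_ob_def G_mor_def F_mor_def)
qed

end
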